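(* For every $\delta>0$ there exists an integer $n_0$ such that every directed graph $D$ with $n\ge n_0$ vertices satisfies \[\tau_t(D)\le 1.8\,\nu_t(D)+\delta n^2 .\] Equivalently, for $n$-vertex directed graphs $D$, $\tau_t(D)\le 1.8\,\nu_t(D)+o(n^2)$.
   Context: A directed graph has no loops and no parallel arcs, but may contain bigons (a pair of arcs $uv$ and $vu$). A (directed) triangle is a triple of arcs $uv, vw, wu$ on three distinct vertices. $\nu_t(D)$ denotes the maximum number of pairwise arc-disjoint directed triangles in $D$, and $\tau_t(D)$ denotes the minimum number of arcs whose removal leaves no directed triangle. *)

theory Defs
  imports
    "HOL-Library.Landau_Symbols"
    "Graph_Theory.Pair_Digraph"
begin

text \<open>
  A directed graph without loops and parallel arcs, with bigons allowed, is a finite digraph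
  in the sense of \<^locale>\<open>pair_digraph\<close>: arcs are ordered pairs of distinct vertices.
\<close>

text \<open>
  A triangle is identified with its set of three arcs, so the three rotations of
  \<open>(uv, vw, wu)\<close> are one and the same triangle, and the two orientations are different ones.
\<close>

definition dir_triangles :: "'a pair_pre_digraph \<Rightarrow> ('a \<times> 'a) set set" where
  "dir_triangles D =
     {{(u, v), (v, w), (w, u)} | u v w.
        distinct [u, v, w] \<and> {(u, v), (v, w), (w, u)} \<subseteq> parcs D}"

definition triangle_packings :: "'a pair_pre_digraph \<Rightarrow> ('a \<times> 'a) set set set" where
  "triangle_packings D = {T. T \<subseteq> dir_triangles D \<and> pairwise disjnt T}"

definition triangle_covers :: "'a pair_pre_digraph \<Rightarrow> ('a \<times> 'a) set set" where
  "triangle_covers D =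
     {S. S \<subseteq> parcs D \<and> dir_triangles (D\<lparr>parcs := parcs D - S\<rparr>) = {}}"

text \<open>
  \<^const>\<open>Max\<close> and \<^const>\<open>Min\<close> are meaningful below only for finitely many arcs; then the sets
  are finite and nonempty.
\<close>

definition nu_t :: "'a pair_pre_digraph \<Rightarrow> nat" where
  "nu_t D = Max (card ` triangle_packings D)"

definition tau_t :: "'a pair_pre_digraph \<Rightarrow> nat" where
  "tau_t D = Min (card ` triangle_covers D)"

lemma finite_dir_triangles: "finite (parcs D) \<Longrightarrow> finite (dir_triangles D)"
  by (rule finite_subset[of _ "Pow (parcs D)"]) (auto simp: dir_triangles_def)

lemma finite_triangle_packings: "finite (parcs D) \<Longrightarrow> finite (triangle_packings D)"
  by (rule finite_subset[of _ "Pow (dir_triangles D)"])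
     (auto simp: triangle_packings_def finite_dir_triangles)

lemma finite_triangle_covers: "finite (parcs D) \<Longrightarrow> finite (triangle_covers D)"
  by (rule finite_subset[of _ "Pow (parcs D)"]) (auto simp: triangle_covers_def)

lemma empty_in_triangle_packings: "{} \<in> triangle_packings D"
  by (simp add: triangle_packings_def)

lemma parcs_in_triangle_covers: "parcs D \<in> triangle_covers D"
  by (simp add: triangle_covers_def dir_triangles_def)

lemma nu_t_attained:
  assumes "finite (parcs D)"
  obtains T where "T \<in> triangle_packings D" "card T = nu_t D"
  using Max_in[of "card ` triangle_packings D"] finite_triangle_packings[OF assms]
    empty_in_triangle_packings[of D]
  unfolding nu_t_def by fastforce

lemma card_le_nu_t: "finite (parcs D) \<Longrightarrow> T \<in> triangle_packings D \<Longrightarrow> card T \<le> nu_t D"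
  unfolding nu_t_def by (simp add: finite_triangle_packings)

lemma tau_t_attained:
  assumes "finite (parcs D)"
  obtains S where "S \<in> triangle_covers D" "card S = tau_t D"
  using Min_in[of "card ` triangle_covers D"] finite_triangle_covers[OF assms]
    parcs_in_triangle_covers[of D]
  unfolding tau_t_def by fastforce

lemma tau_t_le_card: "finite (parcs D) \<Longrightarrow> S \<in> triangle_covers D \<Longrightarrow> tau_t D \<le> card S"
  unfolding tau_t_def by (simp add: finite_triangle_covers)

end

theory Submission
  imports Defs
begin

text \<open>
  Linear programming duality provides a fractional triangle packing \<open>f\<close> and a fractional cover \<open>w\<close> of
  equal value.

  Covers: give every vertex a random bit and fix a linear order or its reverse. An arc of positive
  weight survives iff its weight is below a threshold: \<open>1 - a\<close> or \<open>0\<close> if the bits of its ends differ,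
  \<open>a\<close> or \<open>1 - 2 a\<close>, depending on the order, if they agree. For \<open>1/3 \<le> a \<le> 1/2\<close> the thresholds
  around a triangle sum to at most \<open>1\<close>, so no triangle survives. By complementary slackness the
  expected number of deleted arcs is a combination, with coefficients \<open>f T\<close>, of the expected numbers
  of deleted arcs of tight triangles \<open>T\<close>; averaged over \<open>a\<close> these are at most \<open>1.8\<close>.

  Packings: if \<open>f T \<le> \<epsilon>\<close> for all \<open>T\<close>, the nibble turns \<open>f\<close> into an integral packing with a loss of
  \<open>o(n\<^sup>2)\<close>. With this constraint the dual only covers the triangles outside a set of \<open>O(n\<^sup>2)\<close>
  exceptions, which the triangle removal lemma destroys by deleting \<open>o(n\<^sup>2)\<close> arcs.
\<close>

text \<open>A single \<open>a\<close> gives no factor below 2: a tight triangle with weights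
  \<open>a\<close>, \<open>a\<close>, \<open>1 - 2 * a\<close> loses at least two arcs in
  expectation. Averaging helps because, for \<open>a\<close> in [1/3, 1/2], the values
  \<open>1 - 2 * a\<close>, \<open>a\<close>, \<open>1 - a\<close> sweep the adjacent intervals
  [0, 1/3], [1/3, 1/2], [1/2, 2/3]. For uniform \<open>a\<close>, an arc of weight x > 0 is deleted
  with probability (1 + 3x)/4 up to 1/3, 3x/2 up to 2/3 and 1 beyond; over a tight triangle these
  sum to at most 7/4.

  Rounding needs an exactly complementary pair: saturated arcs, triangles of weight exactly 1. The
  dual weights of the capped program cover triangles only up to a slack, so they serve merely as a
  bound. The uncapped program of the digraph left after the removal is solved anew, weak duality
  compares its value with the capped one, and its own optimal pair is rounded.

  The removal lemma tolerates \<gamma> n^3 exceptions, far more than the O(n^2) that occur, so the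
  cap may be as small as the nibble demands.\<close>

section \<open>Linear programming duality\<close>

text \<open>A linear constraint \<open>\<Sum>j. a j * x j \<le> b\<close> is represented by the pair \<open>(a, b)\<close>.\<close>

inductive_set lin_cone :: "(('j \<Rightarrow> real) \<times> real) set \<Rightarrow> (('j \<Rightarrow> real) \<times> real) set"
  for C where
  base: "c \<in> C \<Longrightarrow> c \<in> lin_cone C"
| add: "(a, b) \<in> lin_cone C \<Longrightarrow> (a', b') \<in> lin_cone C \<Longrightarrow> (\<lambda>j. a j + a' j, b + b') \<in> lin_cone C"
| scale: "(a, b) \<in> lin_cone C \<Longrightarrow> r \<ge> 0 \<Longrightarrow> (\<lambda>j. r * a j, r * b) \<in> lin_cone C"

lemma lin_cone_subset:
  assumes "c \<in> lin_cone C" "C \<subseteq> lin_cone C'"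
  shows "c \<in> lin_cone C'"
  using assms(1) by induction (use assms(2) in \<open>auto intro: lin_cone.intros\<close>)

text \<open>The inductive closure lets the elimination forget how its rows arose. The explicit
  multipliers are recovered here, indexed by \<open>I\<close> because \<open>g\<close> may take a
  value twice.\<close>

lemma lin_cone_combination:
  assumes "c \<in> lin_cone (g ` I)" "finite I"
  obtains y where "\<And>i. y i \<ge> 0" "\<And>j. fst c j = (\<Sum>i\<in>I. y i * fst (g i) j)"
    "snd c = (\<Sum>i\<in>I. y i * snd (g i))"
proof -
  have "\<exists>y. (\<forall>i. y i \<ge> 0) \<and> (\<forall>j. fst c j = (\<Sum>i\<in>I. y i * fst (g i) j))
    \<and> snd c = (\<Sum>i\<in>I. y i * snd (g i))"
    using assms(1)
  proof induction
    case (base c)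
    then obtain k where "k \<in> I" "c = g k" by blast
    then show ?case
      using assms(2) by (intro exI[of _ "\<lambda>i. if i = k then 1 else 0"])
        (auto simp: if_distrib[of "\<lambda>x. x * _"] sum.delta cong: if_cong)
  next
    case (add a b a' b')
    then obtain y y' where
      "\<forall>i. y i \<ge> 0" "\<forall>j. a j = (\<Sum>i\<in>I. y i * fst (g i) j)" "b = (\<Sum>i\<in>I. y i * snd (g i))"
      "\<forall>i. y' i \<ge> 0" "\<forall>j. a' j = (\<Sum>i\<in>I. y' i * fst (g i) j)" "b' = (\<Sum>i\<in>I. y' i * snd (g i))"
      by auto
    then show ?case
      by (intro exI[of _ "\<lambda>i. y i + y' i"]) (auto simp: distrib_right sum.distrib)
  next
    case (scale a b r)
    then obtain y where
      "\<forall>i. y i \<ge> 0" "\<forall>j. a j = (\<Sum>i\<in>I. y i * fst (g i) j)" "b = (\<Sum>i\<in>I. y i * snd (g i))"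
      by auto
    with scale show ?case
      by (intro exI[of _ "\<lambda>i. r * y i"]) (auto simp: sum_distrib_left mult.assoc)
  qed
  with that show ?thesis by blast
qed

text \<open>Either side may be empty: then the eliminated variable is bounded from at most one side,
  and \<open>Min\<close> or \<open>Max\<close> of the other set serves.\<close>

lemma exists_between_finite:
  fixes L U :: "real set"
  assumes "finite L" "finite U" "\<And>l u. l \<in> L \<Longrightarrow> u \<in> U \<Longrightarrow> l \<le> u"
  shows "\<exists>z. (\<forall>l\<in>L. l \<le> z) \<and> (\<forall>u\<in>U. z \<le> u)"
proof (cases "L = {}")
  case True
  show ?thesis
  proof (cases "U = {}")
    case False
    with True assms show ?thesis by (intro exI[of _ "Min U"]) auto
  qed (use True in auto)
next
  case False
  with assms show ?thesis by (intro exI[of _ "Max L"]) auto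
qed

text \<open>Fourier--Motzkin elimination of one variable per step.\<close>

lemma farkas_cone:
  fixes C :: "(('j \<Rightarrow> real) \<times> real) set"
  assumes "finite J" "finite C"
    and "\<nexists>x. \<forall>(a, b)\<in>C. (\<Sum>j\<in>J. a j * x j) \<le> b"
  shows "\<exists>(a, b)\<in>lin_cone C. (\<forall>j\<in>J. a j = 0) \<and> b < 0"
  using assms
proof (induction J arbitrary: C rule: finite_induct)
  case empty
  then obtain a b where "(a, b) \<in> C" "b < 0" by auto
  then show ?case by (intro bexI[of _ "(a, b)"]) (auto intro: lin_cone.base)
next
  case (insert k J)
  define Z P N where "Z = {c\<in>C. fst c k = 0}" and "P = {c\<in>C. fst c k > 0}" and "N = {c\<in>C. fst c k < 0}"
  \<comment> \<open>Each upper bound on variable \<open>k\<close> is combined with each lower bound;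
    both multipliers are positive and cancel the coefficient of \<open>k\<close>.\<close>
  define comb :: "(('j \<Rightarrow> real) \<times> real) \<times> (('j \<Rightarrow> real) \<times> real) \<Rightarrow> ('j \<Rightarrow> real) \<times> real"
    where "comb = (\<lambda>(p, n). (\<lambda>j. - fst n k * fst p j + fst p k * fst n j, - fst n k * snd p + fst p k * snd n))"
  define C' where "C' = Z \<union> comb ` (P \<times> N)"
  have fin: "finite Z" "finite P" "finite N" "finite C'"
    using insert.prems(1) by (auto simp: Z_def P_def N_def C'_def)
  have sub: "C' \<subseteq> lin_cone C"
  proof
    fix c assume "c \<in> C'"
    then consider "c \<in> Z" | p n where "p \<in> P" "n \<in> N" "c = comb (p, n)" by (auto simp: C'_def)
    then show "c \<in> lin_cone C"
    proof cases
      case 2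
      have "(fst p, snd p) \<in> lin_cone C" "(fst n, snd n) \<in> lin_cone C"
        using 2 by (auto simp: P_def N_def intro: lin_cone.base)
      from lin_cone.add[OF lin_cone.scale[OF this(1), of "- fst n k"] lin_cone.scale[OF this(2), of "fst p k"]]
      show ?thesis using 2 by (auto simp: P_def N_def comb_def)
    qed (auto simp: Z_def intro: lin_cone.base)
  qed
  have zero: "\<forall>c\<in>C'. fst c k = 0"
    by (auto simp: C'_def Z_def comb_def)
  have "\<nexists>x. \<forall>(a, b)\<in>C'. (\<Sum>j\<in>J. a j * x j) \<le> b"
  proof
    assume "\<exists>x. \<forall>(a, b)\<in>C'. (\<Sum>j\<in>J. a j * x j) \<le> b"
    then obtain x where x: "\<And>c. c \<in> C' \<Longrightarrow> (\<Sum>j\<in>J. fst c j * x j) \<le> snd c" by fastforce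
    define s where "s = (\<lambda>c :: ('j \<Rightarrow> real) \<times> real. \<Sum>j\<in>J. fst c j * x j)"
    \<comment> \<open>The value of variable \<open>k\<close> at which row \<open>c\<close> becomes
      tight: an upper bound for rows in \<open>P\<close>, a lower bound for rows in
      \<open>N\<close>.\<close>
    define t where "t = (\<lambda>c :: ('j \<Rightarrow> real) \<times> real. (snd c - s c) / fst c k)"
    have "t n \<le> t p" if "p \<in> P" "n \<in> N" for p n
    proof -
      have "s (comb (p, n)) \<le> snd (comb (p, n))"
        unfolding s_def using that by (intro x) (auto simp: C'_def)
      moreover have "s (comb (p, n)) = - fst n k * s p + fst p k * s n"
        by (simp add: s_def comb_def sum_distrib_left sum.distrib[symmetric] algebra_simps sum_subtractf)
      ultimately have "fst p k * (s n - snd n) \<le> - fst n k * (snd p - s p)"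
        by (simp add: comb_def algebra_simps)
      then have "fst p k * (snd n - s n) \<ge> fst n k * (snd p - s p)"
        by (simp add: algebra_simps)
      with that show ?thesis
        by (simp add: t_def P_def N_def divide_simps mult.commute)
    qed
    then have "\<exists>z. (\<forall>l\<in>t ` N. l \<le> z) \<and> (\<forall>u\<in>t ` P. z \<le> u)"
      by (intro exists_between_finite) (use fin in auto)
    then obtain z where zN: "\<And>n. n \<in> N \<Longrightarrow> t n \<le> z" and zP: "\<And>p. p \<in> P \<Longrightarrow> z \<le> t p" by auto
    have "(\<Sum>j\<in>insert k J. fst c j * (x(k := z)) j) \<le> snd c" if "c \<in> C" for c
    proof -
      have "(\<Sum>j\<in>J. fst c j * (x(k := z)) j) = s c"
        unfolding s_def using insert.hyps by (intro sum.cong) auto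
      then have eq: "(\<Sum>j\<in>insert k J. fst c j * (x(k := z)) j) = fst c k * z + s c"
        using insert.hyps by simp
      consider "fst c k = 0" | "fst c k > 0" | "fst c k < 0" by linarith
      then have "fst c k * z + s c \<le> snd c"
      proof cases
        case 1
        with that x[of c] show ?thesis by (simp add: C'_def Z_def s_def)
      next
        case 2
        with that zP[of c] show ?thesis by (simp add: P_def t_def field_simps)
      next
        case 3
        with that zN[of c] show ?thesis by (simp add: N_def t_def field_simps)
      qed
      with eq show ?thesis by simp
    qed
    with insert.prems(2) show False by fastforce
  qed
  from insert.IH[OF fin(4) this] obtain a b
    where ab: "(a, b) \<in> lin_cone C'" "\<forall>j\<in>J. a j = 0" "b < 0" by auto
  \<comment> \<open>All generators in \<open>C'\<close> have coefficient 0 at \<open>k\<close>, so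
    the certificate vanishes on \<open>insert k J\<close> and not only on \<open>J\<close>.\<close>
  have "fst c k = 0" if "c \<in> lin_cone C'" for c
    using that by induction (use zero in auto)
  from this[OF ab(1)] ab lin_cone_subset[OF ab(1) sub] show ?case
    by (intro bexI[of _ "(a, b)"]) auto
qed

lemma farkas:
  fixes a :: "'i \<Rightarrow> 'j \<Rightarrow> real" and b :: "'i \<Rightarrow> real"
  assumes "finite I" "finite J" "\<nexists>x. \<forall>i\<in>I. (\<Sum>j\<in>J. a i j * x j) \<le> b i"
  obtains y where "\<And>i. y i \<ge> 0" "\<And>j. j \<in> J \<Longrightarrow> (\<Sum>i\<in>I. y i * a i j) = 0"
    "(\<Sum>i\<in>I. y i * b i) < 0"
proof -
  let ?g = "\<lambda>i. (a i, b i)"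
  have "\<exists>(a', b')\<in>lin_cone (?g ` I). (\<forall>j\<in>J. a' j = 0) \<and> b' < 0"
    using assms by (intro farkas_cone) auto
  then obtain c where c: "c \<in> lin_cone (?g ` I)" "\<forall>j\<in>J. fst c j = 0" "snd c < 0" by auto
  from c(1) assms(1) obtain y where "\<And>i. y i \<ge> 0" "\<And>j. fst c j = (\<Sum>i\<in>I. y i * fst (?g i) j)"
    "snd c = (\<Sum>i\<in>I. y i * snd (?g i))"
    by (rule lin_cone_combination) blast
  with c show thesis by (intro that[of y]) auto
qed

text \<open>
  The primal and dual constraints together with \<open>b y \<le> c x\<close> form one system; a Farkas certificate of
  its infeasibility contradicts weak duality.
\<close>

datatype ('i, 'j) lp_row = Primal 'i | NonnegP 'j | Dual 'j | NonnegD 'i | Gap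

lemma lp_strong_duality:
  fixes a :: "'i \<Rightarrow> 'j \<Rightarrow> real" and b :: "'i \<Rightarrow> real" and c :: "'j \<Rightarrow> real"
  assumes fin: "finite I" "finite J"
    and b: "\<And>i. i \<in> I \<Longrightarrow> b i \<ge> 0"
    and y0: "\<And>i. i \<in> I \<Longrightarrow> y0 i \<ge> 0" "\<And>j. j \<in> J \<Longrightarrow> (\<Sum>i\<in>I. y0 i * a i j) \<ge> c j"
  shows "\<exists>x y. (\<forall>j\<in>J. x j \<ge> 0) \<and> (\<forall>i\<in>I. (\<Sum>j\<in>J. a i j * x j) \<le> b i) \<and>
    (\<forall>i\<in>I. y i \<ge> 0) \<and> (\<forall>j\<in>J. (\<Sum>i\<in>I. y i * a i j) \<ge> c j) \<and>
    (\<Sum>j\<in>J. c j * x j) = (\<Sum>i\<in>I. b i * y i)"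
proof -
  define R where "R = Primal ` I \<union> NonnegP ` J \<union> Dual ` J \<union> NonnegD ` I \<union> {Gap :: ('i, 'j) lp_row}"
  \<comment> \<open>Columns \<open>Inl j\<close> are the primal variables, columns
    \<open>Inr i\<close> the dual ones. Every row has to be an upper bound, whence the negative
    signs.\<close>
  define A where "A = (\<lambda>r :: ('i, 'j) lp_row. \<lambda>v :: 'j + 'i. case r of
       Primal i \<Rightarrow> (case v of Inl j \<Rightarrow> a i j | Inr _ \<Rightarrow> 0)
     | NonnegP j' \<Rightarrow> (case v of Inl j \<Rightarrow> if j = j' then - 1 else 0 | Inr _ \<Rightarrow> 0)
     | Dual j' \<Rightarrow> (case v of Inl _ \<Rightarrow> 0 | Inr i \<Rightarrow> - a i j')
     | NonnegD i' \<Rightarrow> (case v of Inl _ \<Rightarrow> 0 | Inr i \<Rightarrow> if i = i' then - 1 else 0)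
     | Gap \<Rightarrow> (case v of Inl j \<Rightarrow> - c j | Inr i \<Rightarrow> b i))"
  define B where "B = (\<lambda>r :: ('i, 'j) lp_row. case r of Primal i \<Rightarrow> b i | NonnegP _ \<Rightarrow> 0
     | Dual j \<Rightarrow> - c j | NonnegD _ \<Rightarrow> 0 | Gap \<Rightarrow> 0)"
  have sumV: "(\<Sum>v\<in>J <+> I. g v) = (\<Sum>j\<in>J. g (Inl j)) + (\<Sum>i\<in>I. g (Inr i))" for g :: "'j + 'i \<Rightarrow> real"
    using fin by (simp add: sum.Plus)
  have sumR: "(\<Sum>r\<in>R. g r) = (\<Sum>i\<in>I. g (Primal i)) + (\<Sum>j\<in>J. g (NonnegP j)) + (\<Sum>j\<in>J. g (Dual j))
      + (\<Sum>i\<in>I. g (NonnegD i)) + g Gap" for g :: "('i, 'j) lp_row \<Rightarrow> real"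
  proof -
    have "inj_on (Primal :: 'i \<Rightarrow> ('i, 'j) lp_row) I" "inj_on (NonnegP :: 'j \<Rightarrow> ('i, 'j) lp_row) J"
      "inj_on (Dual :: 'j \<Rightarrow> ('i, 'j) lp_row) J" "inj_on (NonnegD :: 'i \<Rightarrow> ('i, 'j) lp_row) I"
      by (auto simp: inj_on_def)
    then show ?thesis
      unfolding R_def using fin
      by (subst sum.union_disjoint, simp, simp, blast)+ (simp add: sum.reindex)
  qed
  have "\<exists>x. \<forall>r\<in>R. (\<Sum>v\<in>J <+> I. A r v * x v) \<le> B r"
  proof (rule ccontr)
    assume "\<not> ?thesis"
    then obtain z where z: "\<And>r. z r \<ge> 0" "\<And>v. v \<in> J <+> I \<Longrightarrow> (\<Sum>r\<in>R. z r * A r v) = 0"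
      "(\<Sum>r\<in>R. z r * B r) < 0"
      by (rule farkas[rotated 2]) (use fin in \<open>auto simp: R_def\<close>)
    define p q r s t where "p = (\<lambda>i. z (Primal i))" and "q = (\<lambda>j. z (NonnegP j))"
      and "r = (\<lambda>j. z (Dual j))" and "s = (\<lambda>i. z (NonnegD i))" and "t = z Gap"
    have nn: "p i \<ge> 0" "q j \<ge> 0" "r j \<ge> 0" "s i \<ge> 0" "t \<ge> 0" for i j
      unfolding p_def q_def r_def s_def t_def by (auto intro: z(1))
    have pA: "(\<Sum>i\<in>I. p i * a i j) \<ge> t * c j" if "j \<in> J" for j
    proof -
      have "(\<Sum>i\<in>I. p i * a i j) - q j - t * c j = 0"
        using z(2)[OF InlI[OF that]] that fin
        by (simp add: sumR A_def p_def q_def t_def if_distrib[of "(*) _"] sum.delta cong: if_cong)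
      with nn(2)[of j] show ?thesis by linarith
    qed
    have Ar: "(\<Sum>j\<in>J. a i j * r j) \<le> t * b i" if "i \<in> I" for i
    proof -
      have "- (\<Sum>j\<in>J. r j * a i j) - s i + t * b i = 0"
        using z(2)[OF InrI[OF that]] that fin
        by (simp add: sumR A_def r_def s_def t_def if_distrib[of "(*) _"] sum.delta sum_negf cong: if_cong)
      with nn(4)[of i] show ?thesis by (simp add: mult.commute)
    qed
    have neg: "(\<Sum>i\<in>I. p i * b i) < (\<Sum>j\<in>J. r j * c j)"
      using z(3) by (simp add: sumR B_def p_def r_def sum_negf)
    have swap: "(\<Sum>i\<in>I. w i * (\<Sum>j\<in>J. a i j * r j)) = (\<Sum>j\<in>J. r j * (\<Sum>i\<in>I. w i * a i j))" for w
      by (simp add: sum_distrib_left, subst sum.swap) (simp add: mult_ac)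
    show False
    proof (cases "t = 0")
      \<comment> \<open>The certificate does not use the gap row, so \<open>r\<close> is a direction
        along which no primal constraint increases. The feasible \<open>y0\<close> shows that the
        objective does not increase along \<open>r\<close> either, while the left side of
        \<open>neg\<close> is nonnegative because \<open>b\<close> is.\<close>
      case True
      have "(\<Sum>j\<in>J. r j * c j) \<le> (\<Sum>j\<in>J. r j * (\<Sum>i\<in>I. y0 i * a i j))"
        by (intro sum_mono mult_left_mono y0 nn)
      also have "\<dots> = (\<Sum>i\<in>I. y0 i * (\<Sum>j\<in>J. a i j * r j))" by (simp add: swap)
      also have "\<dots> \<le> 0"
        using Ar True y0(1) by (intro sum_nonpos) (simp add: mult_nonneg_nonpos)
      finally show False
        using neg sum_nonneg[of I "\<lambda>i. p i * b i"] nn(1) b by fastforce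
    next
      \<comment> \<open>Divided by \<open>t\<close>, the vectors \<open>r\<close> and
        \<open>p\<close> are feasible for the two programs, and \<open>neg\<close> contradicts weak
        duality.\<close>
      case False
      with nn(5) have t: "t > 0" by simp
      have "t * (\<Sum>j\<in>J. r j * c j) = (\<Sum>j\<in>J. r j * (t * c j))"
        by (simp add: sum_distrib_left mult_ac)
      also have "\<dots> \<le> (\<Sum>j\<in>J. r j * (\<Sum>i\<in>I. p i * a i j))"
        by (intro sum_mono mult_left_mono pA nn)
      also have "\<dots> = (\<Sum>i\<in>I. p i * (\<Sum>j\<in>J. a i j * r j))" by (simp add: swap)
      also have "\<dots> \<le> (\<Sum>i\<in>I. p i * (t * b i))"
        by (intro sum_mono mult_left_mono Ar nn)
      also have "\<dots> = t * (\<Sum>i\<in>I. p i * b i)" by (simp add: sum_distrib_left mult_ac)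
      finally show False using neg t by simp
    qed
  qed
  then obtain xy where xy: "\<And>r. r \<in> R \<Longrightarrow> (\<Sum>v\<in>J <+> I. A r v * xy v) \<le> B r" by blast
  define x y where "x = (\<lambda>j. xy (Inl j))" and "y = (\<lambda>i. xy (Inr i))"
  have x: "x j \<ge> 0" if "j \<in> J" for j
    using xy[of "NonnegP j"] that fin
    by (simp add: R_def sumV A_def B_def x_def if_distrib[of "\<lambda>u. u * _"] sum.delta cong: if_cong)
  have y: "y i \<ge> 0" if "i \<in> I" for i
    using xy[of "NonnegD i"] that fin
    by (simp add: R_def sumV A_def B_def y_def if_distrib[of "\<lambda>u. u * _"] sum.delta cong: if_cong)
  have Ax: "(\<Sum>j\<in>J. a i j * x j) \<le> b i" if "i \<in> I" for i
    using xy[of "Primal i"] that by (simp add: R_def sumV A_def B_def x_def)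
  have yA: "(\<Sum>i\<in>I. y i * a i j) \<ge> c j" if "j \<in> J" for j
    using xy[of "Dual j"] that by (simp add: R_def sumV A_def B_def y_def sum_negf mult.commute)
  have "(\<Sum>i\<in>I. b i * y i) \<le> (\<Sum>j\<in>J. c j * x j)"
    using xy[of Gap] by (simp add: R_def sumV A_def B_def x_def y_def sum_negf)
  moreover have "(\<Sum>j\<in>J. c j * x j) \<le> (\<Sum>i\<in>I. b i * y i)"
  proof -
    have "(\<Sum>j\<in>J. c j * x j) \<le> (\<Sum>j\<in>J. (\<Sum>i\<in>I. y i * a i j) * x j)"
      by (intro sum_mono mult_right_mono yA x)
    also have "\<dots> = (\<Sum>i\<in>I. (\<Sum>j\<in>J. a i j * x j) * y i)"
      by (simp add: sum_distrib_right, subst sum.swap) (simp add: mult_ac)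
    also have "\<dots> \<le> (\<Sum>i\<in>I. b i * y i)"
      by (intro sum_mono mult_right_mono Ax y)
    finally show ?thesis .
  qed
  ultimately show ?thesis using x y Ax yA by (intro exI[of _ x] exI[of _ y] conjI ballI) auto
qed

section \<open>Matchings from fractional matchings\<close>

definition bernoulli_weight :: "('i \<Rightarrow> real) \<Rightarrow> 'i set \<Rightarrow> 'i set \<Rightarrow> real" where
  "bernoulli_weight p I A = (\<Prod>i\<in>A. p i) * (\<Prod>i\<in>I - A. 1 - p i)"

definition expect :: "('i \<Rightarrow> real) \<Rightarrow> 'i set \<Rightarrow> ('i set \<Rightarrow> real) \<Rightarrow> real" where
  "expect p I g = (\<Sum>A\<in>Pow I. bernoulli_weight p I A * g A)"

text \<open>In the product of the factors \<open>p i + (1 - p i)\<close>, replacing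
  \<open>p i\<close> by 0 for \<open>i \<in> J\<close> makes the expanded terms vanish for all sets
  meeting \<open>J\<close> and leaves the other terms unchanged.\<close>

lemma expect_avoid:
  assumes "finite I" "J \<subseteq> I"
  shows "expect p I (\<lambda>A. of_bool (A \<inter> J = {})) = (\<Prod>i\<in>J. 1 - p i)"
proof -
  have "(\<Prod>i\<in>J. 1 - p i) = (\<Prod>i\<in>I. if i \<in> J then 1 - p i else 1)"
    using assms by (simp add: prod.inter_restrict[symmetric] Int_absorb1)
  also have "\<dots> = (\<Prod>i\<in>I. (if i \<in> J then 0 else p i) + (1 - p i))"
    by (intro prod.cong) auto
  also have "\<dots> = (\<Sum>A\<in>Pow I. (\<Prod>i\<in>A. if i \<in> J then 0 else p i) * (\<Prod>i\<in>I - A. 1 - p i))"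
    using assms(1) by (rule prod_add)
  also have "\<dots> = expect p I (\<lambda>A. of_bool (A \<inter> J = {}))"
    unfolding expect_def bernoulli_weight_def
  proof (intro sum.cong refl)
    fix A assume "A \<in> Pow I"
    with assms(1) have "finite A" by (auto intro: finite_subset)
    have "(\<Prod>i\<in>A. if i \<in> J then 0 else p i) = (\<Prod>i\<in>A. p i) * of_bool (A \<inter> J = {})"
    proof (cases "A \<inter> J = {}")
      case True
      then show ?thesis by (auto intro!: prod.cong)
    next
      case False
      with \<open>finite A\<close> show ?thesis by (auto intro!: prod_zero)
    qed
    then show "(\<Prod>i\<in>A. if i \<in> J then 0 else p i) * (\<Prod>i\<in>I - A. 1 - p i)
      = (\<Prod>i\<in>A. p i) * (\<Prod>i\<in>I - A. 1 - p i) * of_bool (A \<inter> J = {})" by simp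
  qed
  finally show ?thesis by simp
qed

lemma expect_contain:
  assumes "finite I" "J \<subseteq> I"
  shows "expect p I (\<lambda>A. of_bool (J \<subseteq> A)) = (\<Prod>i\<in>J. p i)"
proof -
  have "(\<Prod>i\<in>J. p i) = (\<Prod>i\<in>I. if i \<in> J then p i else 1)"
    using assms by (simp add: prod.inter_restrict[symmetric] Int_absorb1)
  also have "\<dots> = (\<Prod>i\<in>I. p i + (if i \<in> J then 0 else 1 - p i))"
    by (intro prod.cong) auto
  also have "\<dots> = (\<Sum>A\<in>Pow I. (\<Prod>i\<in>A. p i) * (\<Prod>i\<in>I - A. if i \<in> J then 0 else 1 - p i))"
    using assms(1) by (rule prod_add)
  also have "\<dots> = expect p I (\<lambda>A. of_bool (J \<subseteq> A))"
    unfolding expect_def bernoulli_weight_def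
  proof (intro sum.cong refl)
    fix A assume "A \<in> Pow I"
    have "(\<Prod>i\<in>I - A. if i \<in> J then 0 else 1 - p i) = (\<Prod>i\<in>I - A. 1 - p i) * of_bool (J \<subseteq> A)"
    proof (cases "J \<subseteq> A")
      case True
      then show ?thesis by (auto intro!: prod.cong)
    next
      case False
      with assms show ?thesis by (auto intro!: prod_zero)
    qed
    then show "(\<Prod>i\<in>A. p i) * (\<Prod>i\<in>I - A. if i \<in> J then 0 else 1 - p i)
      = (\<Prod>i\<in>A. p i) * (\<Prod>i\<in>I - A. 1 - p i) * of_bool (J \<subseteq> A)" by simp
  qed
  finally show ?thesis by simp
qed

lemma expect_const: "finite I \<Longrightarrow> expect p I (\<lambda>A. c) = c"
proof -
  assume "finite I"
  then have "expect p I (\<lambda>A. 1) = 1" using expect_avoid[of I "{}" p] by simp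
  then show "expect p I (\<lambda>A. c) = c" by (simp add: expect_def sum_distrib_right[symmetric])
qed

lemma expect_add: "expect p I (\<lambda>A. g A + h A) = expect p I g + expect p I h"
  by (simp add: expect_def distrib_left sum.distrib)

lemma expect_diff: "expect p I (\<lambda>A. g A - h A) = expect p I g - expect p I h"
  by (simp add: expect_def right_diff_distrib sum_subtractf)

lemma expect_cmult: "expect p I (\<lambda>A. c * g A) = c * expect p I g"
  by (simp add: expect_def sum_distrib_left mult_ac)

lemma expect_sum: "expect p I (\<lambda>A. \<Sum>x\<in>X. g x A) = (\<Sum>x\<in>X. expect p I (g x))"
  unfolding expect_def by (simp add: sum_distrib_left) (rule sum.swap)

lemma expect_mono:
  assumes "\<And>i. i \<in> I \<Longrightarrow> 0 \<le> p i \<and> p i \<le> 1" "\<And>A. A \<subseteq> I \<Longrightarrow> g A \<le> h A"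
  shows "expect p I g \<le> expect p I h"
  unfolding expect_def bernoulli_weight_def
  by (intro sum_mono mult_left_mono mult_nonneg_nonneg prod_nonneg) (use assms in auto)

lemma expect_attained:
  assumes "finite I" "\<And>i. i \<in> I \<Longrightarrow> 0 \<le> p i \<and> p i \<le> 1"
  obtains A where "A \<subseteq> I" "g A \<ge> expect p I g"
proof -
  have "Max (g ` Pow I) \<in> g ` Pow I" using assms(1) by (intro Max_in) auto
  then obtain A where A: "A \<subseteq> I" "g A = Max (g ` Pow I)" by auto
  have "expect p I g \<le> expect p I (\<lambda>_. g A)"
    using assms A by (intro expect_mono) auto
  with assms(1) A that show ?thesis by (simp add: expect_const)
qed

lemma weierstrass_prod_ineq:
  fixes x :: "'i \<Rightarrow> real"
  assumes "finite I" "\<And>i. i \<in> I \<Longrightarrow> 0 \<le> x i \<and> x i \<le> 1"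
  shows "1 - (\<Sum>i\<in>I. x i) \<le> (\<Prod>i\<in>I. 1 - x i)"
  using assms
proof (induction rule: finite_induct)
  case (insert i I)
  have "0 \<le> (\<Prod>i\<in>I. 1 - x i)" "(\<Prod>i\<in>I. 1 - x i) \<le> 1"
    using insert by (auto intro!: prod_nonneg prod_le_1)
  with insert have "x i * (\<Prod>i\<in>I. 1 - x i) \<le> x i" by (simp add: mult_left_le)
  with insert show ?case by (simp add: algebra_simps)
qed simp

text \<open>The vertices will be arcs and the edges triangles. Linearity holds since two arcs of a
  directed triangle determine it; it keeps the survival events of different vertices almost
  independent.\<close>

locale fractional_matching =
  fixes E :: "'e set" and H :: "'e set set" and f :: "'e set \<Rightarrow> real" and \<epsilon> :: real
  assumes finite_E: "finite E"
    and edge_subset: "T \<in> H \<Longrightarrow> T \<subseteq> E"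
    and edge_card: "T \<in> H \<Longrightarrow> card T = 3"
    and linear: "S \<in> H \<Longrightarrow> T \<in> H \<Longrightarrow> S \<noteq> T \<Longrightarrow> card (S \<inter> T) \<le> 1"
    and f_nonneg: "T \<in> H \<Longrightarrow> f T \<ge> 0"
    and f_le: "T \<in> H \<Longrightarrow> f T \<le> \<epsilon>"
    and load_le_1: "e \<in> E \<Longrightarrow> (\<Sum>T\<in>{T\<in>H. e \<in> T}. f T) \<le> 1"
begin

lemma finite_H: "finite H"
  using finite_E edge_subset by (intro finite_subset[of H "Pow E"]) auto

lemma finite_edge: "T \<in> H \<Longrightarrow> finite T"
  using edge_card card.infinite by fastforce

lemma edge_nonempty: "T \<in> H \<Longrightarrow> T \<noteq> {}"
  using edge_card by fastforce

lemma sum_edges_swap: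
  "(\<Sum>T\<in>H. \<Sum>e\<in>T. g T e) = (\<Sum>e\<in>E. \<Sum>T\<in>{T\<in>H. e \<in> T}. g T e)" for g :: "'e set \<Rightarrow> 'e \<Rightarrow> real"
proof -
  have "(\<Sum>T\<in>H. \<Sum>e\<in>T. g T e) = (\<Sum>T\<in>H. \<Sum>e\<in>E. if e \<in> T then g T e else 0)"
    using edge_subset finite_E
    by (intro sum.cong[OF refl]) (simp add: sum.inter_restrict[symmetric] Int_absorb1)
  also have "\<dots> = (\<Sum>e\<in>E. \<Sum>T\<in>H. if e \<in> T then g T e else 0)" by (rule sum.swap)
  also have "\<dots> = (\<Sum>e\<in>E. \<Sum>T\<in>{T\<in>H. e \<in> T}. g T e)"
    using finite_H by (intro sum.cong[OF refl]) (simp add: sum.inter_filter[symmetric])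
  finally show ?thesis .
qed

lemma total_le: "(\<Sum>T\<in>H. f T) \<le> card E"
proof -
  have "(\<Sum>T\<in>H. f T) \<le> (\<Sum>T\<in>H. \<Sum>e\<in>T. f T)"
    using f_nonneg by (intro sum_mono) (simp add: edge_card)
  also have "\<dots> \<le> (\<Sum>e\<in>E. 1)" unfolding sum_edges_swap by (intro sum_mono load_le_1)
  finally show ?thesis by simp
qed

text \<open>Every edge is divided by the largest overload among its vertices, and its loss is
  charged to a vertex attaining the maximum. At a vertex of load \<open>l e\<close> the charges sum
  to at most \<open>l e * (1 - 1 / c e)\<close>, which is exactly the excess of the load over
  1.\<close>

lemma truncation:
  fixes g :: "'e set \<Rightarrow> real"
  assumes g: "\<And>T. T \<in> H \<Longrightarrow> g T \<ge> 0"
  shows "\<exists>g'. (\<forall>T\<in>H. 0 \<le> g' T \<and> g' T \<le> g T) \<and> (\<forall>e\<in>E. (\<Sum>T\<in>{T\<in>H. e \<in> T}. g' T) \<le> 1) \<and>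
    (\<Sum>T\<in>H. g' T) \<ge> (\<Sum>T\<in>H. g T) - (\<Sum>e\<in>E. max 0 ((\<Sum>T\<in>{T\<in>H. e \<in> T}. g T) - 1))"
proof -
  define l where "l = (\<lambda>e. \<Sum>T\<in>{T\<in>H. e \<in> T}. g T)"
  define c where "c = (\<lambda>e. max 1 (l e))"
  define g' where "g' = (\<lambda>T. g T / Max (c ` T))"
  have c: "c e \<ge> 1" "c e \<ge> l e" for e by (auto simp: c_def)
  have Max_ge: "Max (c ` T) \<ge> c e" if "T \<in> H" "e \<in> T" for T e
    using that finite_edge by auto
  have Max_in: "\<exists>e\<in>T. Max (c ` T) = c e" if "T \<in> H" for T
  proof -
    have "Max (c ` T) \<in> c ` T" using that finite_edge edge_nonempty by (intro Max_in) auto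
    then show ?thesis by blast
  qed
  have Max1: "Max (c ` T) \<ge> 1" if "T \<in> H" for T using Max_in[OF that] c by auto
  show ?thesis
  proof (intro exI[of _ g'] conjI ballI)
    show "0 \<le> g' T" "g' T \<le> g T" if "T \<in> H" for T
      using g[OF that] Max1[OF that] mult_left_mono[OF Max1[OF that] g[OF that]]
      by (auto simp: g'_def divide_simps)
    show "(\<Sum>T\<in>{T\<in>H. e \<in> T}. g' T) \<le> 1" if "e \<in> E" for e
    proof -
      have "(\<Sum>T\<in>{T\<in>H. e \<in> T}. g' T) \<le> (\<Sum>T\<in>{T\<in>H. e \<in> T}. g T / c e)"
        unfolding g'_def
      proof (intro sum_mono divide_left_mono)
        fix T assume T: "T \<in> {T\<in>H. e \<in> T}"
        then show "c e \<le> Max (c ` T)" "0 \<le> g T" using Max_ge g by auto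
        show "0 < Max (c ` T) * c e" using Max1[of T] c(1)[of e] T by auto
      qed
      also have "\<dots> = l e / c e" by (simp add: l_def sum_divide_distrib)
      also have "\<dots> \<le> 1" using c[of e] by (simp add: divide_le_eq)
      finally show ?thesis .
    qed
    have "(\<Sum>T\<in>H. g T) - (\<Sum>T\<in>H. g' T) = (\<Sum>T\<in>H. g T - g' T)" by (simp add: sum_subtractf)
    also have "\<dots> \<le> (\<Sum>T\<in>H. \<Sum>e\<in>T. g T * (1 - 1 / c e))"
    proof (rule sum_mono)
      fix T assume T: "T \<in> H"
      obtain e where e: "e \<in> T" "Max (c ` T) = c e" using Max_in[OF T] by blast
      have "g T - g' T = g T * (1 - 1 / c e)" by (simp add: g'_def e right_diff_distrib)
      also have "\<dots> \<le> (\<Sum>e\<in>T. g T * (1 - 1 / c e))"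
        using T e g[OF T] c(1) finite_edge
        by (intro member_le_sum mult_nonneg_nonneg) (auto intro: divide_le_eq_1_pos[THEN iffD2] less_le_trans[OF zero_less_one])
      finally show "g T - g' T \<le> (\<Sum>e\<in>T. g T * (1 - 1 / c e))" .
    qed
    also have "\<dots> = (\<Sum>e\<in>E. l e * (1 - 1 / c e))"
      by (simp add: sum_edges_swap l_def sum_distrib_right)
    also have "\<dots> \<le> (\<Sum>e\<in>E. max 0 (l e - 1))"
    proof (rule sum_mono)
      fix e show "l e * (1 - 1 / c e) \<le> max 0 (l e - 1)"
        by (cases "l e \<le> 1") (auto simp: c_def max_def right_diff_distrib)
    qed
    finally show "(\<Sum>T\<in>H. g' T) \<ge> (\<Sum>T\<in>H. g T) - (\<Sum>e\<in>E. max 0 ((\<Sum>T\<in>{T\<in>H. e \<in> T}. g T) - 1))"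
      by (simp add: l_def)
  qed
qed

end

text \<open>
  Every edge \<open>T\<close> is selected with probability \<open>\<theta> * f T\<close>. A vertex survives if no selected edge
  contains it and an extra coin \<open>Inr e\<close> does not kill it; the coins make all survival probabilities
  equal to \<open>1 - \<theta>\<close>.
\<close>

locale nibble = fractional_matching E H f \<epsilon>
  for E :: "'e set" and H and f and \<epsilon> +
  fixes \<theta> :: real
  assumes \<theta>: "0 < \<theta>" "\<theta> \<le> 1/4" and \<epsilon>: "0 < \<epsilon>" "\<epsilon> \<le> 1"
begin

definition events :: "('e set + 'e) set" where "events = H <+> E"

definition prob :: "'e set + 'e \<Rightarrow> real" where
  "prob i = (case i of Inl T \<Rightarrow> \<theta> * f T
     | Inr e \<Rightarrow> 1 - (1 - \<theta>) / (\<Prod>T\<in>{T\<in>H. e \<in> T}. 1 - \<theta> * f T))"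

text \<open>Survival of \<open>X\<close> is the absence of all these independent events, so its
  probability is a plain product over \<open>killers X\<close>.\<close>

definition killers :: "'e set \<Rightarrow> ('e set + 'e) set" where
  "killers X = Inl ` {T\<in>H. T \<inter> X \<noteq> {}} \<union> Inr ` X"

definition surv :: "('e set + 'e) set \<Rightarrow> 'e set \<Rightarrow> real" where
  "surv A X = of_bool (A \<inter> killers X = {})"

abbreviation ex :: "(('e set + 'e) set \<Rightarrow> real) \<Rightarrow> real" where "ex \<equiv> expect prob events"

lemma finite_events: "finite events"
  using finite_H finite_E by (simp add: events_def)

lemma killers_subset: "X \<subseteq> E \<Longrightarrow> killers X \<subseteq> events"
  by (auto simp: killers_def events_def)

lemma killers_Un: "killers (X \<union> Y) = killers X \<union> killers Y"
proof -
  have "{T\<in>H. T \<inter> (X \<union> Y) \<noteq> {}} = {T\<in>H. T \<inter> X \<noteq> {}} \<union> {T\<in>H. T \<inter> Y \<noteq> {}}" by blast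
  then show ?thesis unfolding killers_def by (simp add: image_Un Un_ac)
qed

lemma killers_insert: "killers (insert e X) = killers X \<union> killers {e}"
  using killers_Un[of X "{e}"] by simp

lemma f_le_1: assumes "T \<in> H" shows "f T \<le> 1"
proof -
  obtain e where e: "e \<in> T" using edge_nonempty[OF assms] by blast
  have "f T \<le> (\<Sum>T\<in>{T\<in>H. e \<in> T}. f T)"
    using assms e finite_H f_nonneg by (intro member_le_sum) auto
  also have "\<dots> \<le> 1" using e edge_subset[OF assms] by (intro load_le_1) auto
  finally show ?thesis .
qed

lemma \<theta>f: assumes "T \<in> H" shows "0 \<le> \<theta> * f T" "\<theta> * f T \<le> \<theta>" "\<theta> * f T \<le> \<theta> * \<epsilon>" "\<theta> * f T < 1"
proof -
  show "0 \<le> \<theta> * f T" "\<theta> * f T \<le> \<theta> * \<epsilon>" using f_nonneg[OF assms] f_le[OF assms] \<theta> by auto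
  show "\<theta> * f T \<le> \<theta>" using f_le_1[OF assms] \<theta> by simp
  then show "\<theta> * f T < 1" using \<theta> by linarith
qed

text \<open>The selected edges alone kill \<open>e\<close> with probability at most \<theta>, so a
  coin can make up the difference; this makes \<open>prob (Inr e)\<close> nonnegative.\<close>

lemma prod_edges_at:
  assumes "e \<in> E"
  shows "1 - \<theta> \<le> (\<Prod>T\<in>{T\<in>H. e \<in> T}. 1 - \<theta> * f T)"
proof -
  have "1 - \<theta> \<le> 1 - (\<Sum>T\<in>{T\<in>H. e \<in> T}. \<theta> * f T)"
    using load_le_1[OF assms] \<theta> by (simp add: sum_distrib_left[symmetric])
  also have "\<dots> \<le> (\<Prod>T\<in>{T\<in>H. e \<in> T}. 1 - \<theta> * f T)"
    using \<theta>f finite_H by (intro weierstrass_prod_ineq) (auto simp: less_imp_le)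
  finally show ?thesis .
qed

lemma prob_bounds: assumes "i \<in> events" shows "0 \<le> prob i \<and> prob i \<le> 1"
proof (cases i)
  case (Inl T)
  with assms \<theta>f[of T] show ?thesis by (auto simp: events_def prob_def)
next
  case (Inr e)
  with assms have "e \<in> E" by (auto simp: events_def)
  from prod_edges_at[OF this] \<theta> Inr show ?thesis
    by (simp add: prob_def divide_le_eq_1)
qed

definition P :: "'e set \<Rightarrow> real" where "P X = (\<Prod>i\<in>killers X. 1 - prob i)"

lemma ex_surv: "X \<subseteq> E \<Longrightarrow> ex (\<lambda>A. surv A X) = P X"
  unfolding surv_def P_def by (intro expect_avoid finite_events killers_subset)

lemma finite_killers: "X \<subseteq> E \<Longrightarrow> finite (killers X)"
  by (rule finite_subset[OF killers_subset finite_events])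

lemma P_bounds: assumes "X \<subseteq> E" shows "0 \<le> P X \<and> P X \<le> 1"
proof -
  have "0 \<le> 1 - prob i \<and> 1 - prob i \<le> 1" if "i \<in> killers X" for i
    using prob_bounds[of i] killers_subset[OF assms] that by auto
  then show ?thesis unfolding P_def by (intro conjI prod_nonneg prod_le_1) blast+
qed

lemma P_singleton: assumes "e \<in> E" shows "P {e} = 1 - \<theta>"
proof -
  have "killers {e} = Inl ` {T\<in>H. e \<in> T} \<union> {Inr e}" by (auto simp: killers_def)
  then have "P {e} = (\<Prod>i\<in>Inl ` {T\<in>H. e \<in> T}. 1 - prob i) * (1 - prob (Inr e))"
    unfolding P_def using finite_H by (simp add: prod.insert image_iff mult.commute)
  also have "(\<Prod>i\<in>Inl ` {T\<in>H. e \<in> T}. 1 - prob i) = (\<Prod>T\<in>{T\<in>H. e \<in> T}. 1 - \<theta> * f T)"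
    by (subst prod.reindex) (auto simp: inj_on_def prob_def)
  finally show ?thesis using prod_edges_at[OF assms] \<theta> by (simp add: prob_def)
qed

text \<open>\<open>P (insert e X)\<close> contains the factors of common killers of \<open>X\<close>
  and \<open>e\<close> once, \<open>P X * P {e}\<close> contains them twice. A common killer is an
  edge through \<open>e\<close> and a vertex of \<open>X\<close>. Linearity allows at most
  \<open>card X\<close> of them, each of probability at most
  \<open>\<theta> * \<epsilon>\<close>.\<close>

lemma P_insert:
  assumes "insert e X \<subseteq> E" "e \<notin> X"
  shows "P X * (1 - \<theta>) \<le> P (insert e X)"
    and "P (insert e X) * (1 - \<theta> * \<epsilon>) ^ card X \<le> P X * (1 - \<theta>)"
proof -
  let ?C = "killers X \<inter> killers {e}"
  have fin: "finite (killers X)" "finite (killers {e})" using assms by (auto intro: finite_killers)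
  have finX: "finite X" using assms finite_E finite_subset by auto
  have eq: "P (insert e X) * (\<Prod>i\<in>?C. 1 - prob i) = P X * (1 - \<theta>)"
    using prod.union_inter[OF fin, of "\<lambda>i. 1 - prob i"] P_singleton[of e] assms(1)
    unfolding P_def killers_insert[of e X] by simp
  have pb: "0 \<le> 1 - prob i" "1 - prob i \<le> 1" if "i \<in> ?C" for i
    using prob_bounds[of i] killers_subset[of X] assms(1) that by auto
  have "(\<Prod>i\<in>?C. 1 - prob i) \<le> 1" using pb by (intro prod_le_1) auto
  then have "P (insert e X) * (\<Prod>i\<in>?C. 1 - prob i) \<le> P (insert e X)"
    using P_bounds[OF assms(1)] by (simp add: mult_left_le)
  with eq show "P X * (1 - \<theta>) \<le> P (insert e X)" by simp
  have sub: "?C \<subseteq> (\<Union>x\<in>X. Inl ` {T\<in>H. e \<in> T \<and> x \<in> T})"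
    using assms(2) by (auto simp: killers_def)
  have one: "card (Inl ` {T\<in>H. e \<in> T \<and> x \<in> T} :: ('e set + 'e) set) \<le> 1" if "x \<in> X" for x
  proof -
    have "S = T" if "S \<in> {T\<in>H. e \<in> T \<and> x \<in> T}" "T \<in> {T\<in>H. e \<in> T \<and> x \<in> T}" for S T
    proof (rule ccontr)
      assume "S \<noteq> T"
      then have "card (S \<inter> T) \<le> 1" using that linear by auto
      moreover have "card {e, x} \<le> card (S \<inter> T)"
        using that finite_edge by (intro card_mono) auto
      moreover have "e \<noteq> x" using assms(2) \<open>x \<in> X\<close> by auto
      ultimately show False by simp
    qed
    then have "card {T\<in>H. e \<in> T \<and> x \<in> T} \<le> Suc 0"
      using finite_H by (subst card_le_Suc0_iff_eq) auto
    moreover have "card (Inl ` {T\<in>H. e \<in> T \<and> x \<in> T} :: ('e set + 'e) set) \<le> card {T\<in>H. e \<in> T \<and> x \<in> T}"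
      using finite_H by (intro card_image_le) auto
    ultimately show ?thesis by simp
  qed
  have "card ?C \<le> card (\<Union>x\<in>X. Inl ` {T\<in>H. e \<in> T \<and> x \<in> T} :: ('e set + 'e) set)"
    using sub finX finite_H by (intro card_mono) auto
  also have "\<dots> \<le> (\<Sum>x\<in>X. card (Inl ` {T\<in>H. e \<in> T \<and> x \<in> T} :: ('e set + 'e) set))"
    using finX by (rule card_UN_le)
  also have "\<dots> \<le> (\<Sum>x\<in>X. 1)" by (intro sum_mono one)
  finally have cC: "card ?C \<le> card X" by simp
  have \<theta>\<epsilon>: "0 \<le> 1 - \<theta> * \<epsilon>" "1 - \<theta> * \<epsilon> \<le> 1"
    using \<theta> \<epsilon> mult_mono[of \<theta> 1 \<epsilon> 1] by auto
  have "(1 - \<theta> * \<epsilon>) ^ card X \<le> (1 - \<theta> * \<epsilon>) ^ card ?C"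
    using cC \<theta>\<epsilon> by (intro power_decreasing) auto
  also have "\<dots> = (\<Prod>i\<in>?C. 1 - \<theta> * \<epsilon>)" by simp
  also have "\<dots> \<le> (\<Prod>i\<in>?C. 1 - prob i)"
  proof (intro prod_mono conjI)
    fix i assume "i \<in> ?C"
    with sub obtain T where "T \<in> H" "i = Inl T" by auto
    then show "1 - \<theta> * \<epsilon> \<le> 1 - prob i" using \<theta>f(3) by (simp add: prob_def)
  qed (use \<theta>\<epsilon> in auto)
  finally have "P (insert e X) * (1 - \<theta> * \<epsilon>) ^ card X \<le> P (insert e X) * (\<Prod>i\<in>?C. 1 - prob i)"
    using P_bounds[OF assms(1)] by (intro mult_left_mono) auto
  with eq show "P (insert e X) * (1 - \<theta> * \<epsilon>) ^ card X \<le> P X * (1 - \<theta>)" by simp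
qed

lemma P_ge: assumes "X \<subseteq> E" shows "(1 - \<theta>) ^ card X \<le> P X"
  using finite_subset[OF assms finite_E] assms
proof (induction rule: finite_induct)
  case empty
  then show ?case by (simp add: P_def killers_def)
next
  case (insert e X)
  then have "(1 - \<theta>) ^ card X * (1 - \<theta>) \<le> P X * (1 - \<theta>)" using \<theta> by (intro mult_right_mono) auto
  also have "\<dots> \<le> P (insert e X)" using insert by (intro P_insert)
  finally show ?case using insert.hyps by (simp add: mult.commute)
qed

lemma P_le: assumes "X \<subseteq> E" shows "P X * (1 - \<theta> * \<epsilon>) ^ (\<Sum>i<card X. i) \<le> (1 - \<theta>) ^ card X"
  using finite_subset[OF assms finite_E] assms
proof (induction rule: finite_induct)
  case empty
  then show ?case by (simp add: P_def killers_def)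
next
  case (insert e X)
  have "0 \<le> 1 - \<theta> * \<epsilon>" using \<theta> \<epsilon> mult_mono[of \<theta> 1 \<epsilon> 1] by auto
  then have "P (insert e X) * (1 - \<theta> * \<epsilon>) ^ card X * (1 - \<theta> * \<epsilon>) ^ (\<Sum>i<card X. i)
      \<le> P X * (1 - \<theta>) * (1 - \<theta> * \<epsilon>) ^ (\<Sum>i<card X. i)"
    using insert by (intro mult_right_mono P_insert) auto
  also have "\<dots> = P X * (1 - \<theta> * \<epsilon>) ^ (\<Sum>i<card X. i) * (1 - \<theta>)" by simp
  also have "\<dots> \<le> (1 - \<theta>) ^ card X * (1 - \<theta>)"
    using insert \<theta> by (intro mult_right_mono) auto
  finally show ?case using insert.hyps by (simp add: power_add mult_ac)
qed

text \<open>By linearity the union has exactly five vertices. Adding them one at a time in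
  \<open>P_le\<close> costs the exponents 0 + 1 + 2 + 3 + 4 = 10, and Bernoulli's inequality makes
  the error additive.\<close>

lemma P_union_le:
  assumes "S \<in> H" "T \<in> H" "S \<noteq> T" "e \<in> S" "e \<in> T"
  shows "P (S \<union> T) \<le> (1 - \<theta>) ^ 5 + 10 * \<epsilon>"
proof -
  have "card (S \<inter> T) \<ge> 1"
    using assms finite_edge by (metis Int_iff One_nat_def Suc_leI card_gt_0_iff empty_iff finite_Int)
  with linear[OF assms(1-3)] have "card (S \<inter> T) = 1" by simp
  then have card: "card (S \<union> T) = 5"
    using card_Un_Int[of S T] finite_edge edge_card assms by simp
  have sub: "S \<union> T \<subseteq> E" using edge_subset assms by auto
  have \<theta>\<epsilon>: "0 \<le> \<theta> * \<epsilon>" "\<theta> * \<epsilon> \<le> \<epsilon>" "\<theta> * \<epsilon> \<le> 1" using \<theta> \<epsilon> mult_mono[of \<theta> 1 \<epsilon> 1] by auto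
  have "(\<Sum>i<5. i) = (10::nat)" by (simp add: eval_nat_numeral)
  then have "P (S \<union> T) * (1 - \<theta> * \<epsilon>) ^ 10 \<le> (1 - \<theta>) ^ 5" using P_le[OF sub] card by simp
  moreover have "1 + real 10 * (- (\<theta> * \<epsilon>)) \<le> (1 + - (\<theta> * \<epsilon>)) ^ 10"
    using \<theta>\<epsilon> by (intro Bernoulli_inequality) auto
  then have "P (S \<union> T) * (1 - 10 * (\<theta> * \<epsilon>)) \<le> P (S \<union> T) * (1 - \<theta> * \<epsilon>) ^ 10"
    using P_bounds[OF sub] by (intro mult_left_mono) auto
  moreover have "P (S \<union> T) * (\<theta> * \<epsilon>) \<le> 1 * \<epsilon>"
    using P_bounds[OF sub] \<theta>\<epsilon> by (intro mult_mono) auto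
  ultimately show ?thesis by (simp add: algebra_simps)
qed

text \<open>Given that \<open>e\<close> survives, an edge through \<open>e\<close> survives with
  probability close to \<open>(1 - \<theta>)\<^sup>2\<close>, by survival of its two other vertices.
  This is the error of the surviving weight at \<open>e\<close> against that prediction; it vanishes
  when \<open>e\<close> dies.\<close>

definition deviation :: "('e set + 'e) set \<Rightarrow> 'e \<Rightarrow> real" where
  "deviation A e = (\<Sum>T\<in>{T\<in>H. e \<in> T}. f T * (surv A T - (1 - \<theta>)\<^sup>2 * surv A {e}))"

lemma surv_mult: "surv A X * surv A Y = surv A (X \<union> Y)"
  unfolding surv_def killers_Un by (auto simp: Int_Un_distrib)

text \<open>Second moment. For distinct edges the main terms are q^5 - q^5 - q^5 + q^5 with q = 1 -
  \<theta>, so only the error \<open>10 * \<epsilon>\<close> of \<open>P_union_le\<close> remains.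
  The diagonal is small because \<open>f S * f S \<le> f S * \<epsilon>\<close>. As the load is at
  most 1, the total is at most \<open>10 * \<epsilon> + \<epsilon>\<close>.\<close>

lemma ex_deviation_square: assumes e: "e \<in> E" shows "ex (\<lambda>A. (deviation A e)\<^sup>2) \<le> 11 * \<epsilon>"
proof -
  let ?q = "1 - \<theta>" and ?D = "{T\<in>H. e \<in> T}"
  define F where "F = (\<Sum>T\<in>?D. f T)"
  have F: "0 \<le> F" "F \<le> 1" using load_le_1[OF e] f_nonneg by (auto simp: F_def intro!: sum_nonneg)
  have finD: "finite ?D" using finite_H by simp
  have q: "0 \<le> ?q" "?q \<le> 1" using \<theta> by auto
  have sub: "T \<subseteq> E" if "T \<in> ?D" for T using edge_subset that by auto
  have expand: "(deviation A e)\<^sup>2 = (\<Sum>S\<in>?D. \<Sum>T\<in>?D. f S * f T *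
      (surv A (S \<union> T) - ?q\<^sup>2 * surv A S - ?q\<^sup>2 * surv A T + ?q^4 * surv A {e}))" for A
  proof -
    have "(deviation A e)\<^sup>2 = (\<Sum>S\<in>?D. \<Sum>T\<in>?D.
        (f S * (surv A S - ?q\<^sup>2 * surv A {e})) * (f T * (surv A T - ?q\<^sup>2 * surv A {e})))"
      unfolding deviation_def power2_eq_square[of "sum _ _"] sum_product ..
    also have "\<dots> = (\<Sum>S\<in>?D. \<Sum>T\<in>?D. f S * f T *
      (surv A (S \<union> T) - ?q\<^sup>2 * surv A S - ?q\<^sup>2 * surv A T + ?q^4 * surv A {e}))"
    proof (intro sum.cong refl)
      fix S T assume ST: "S \<in> ?D" "T \<in> ?D"
      then have u: "S \<union> {e} = S" "{e} \<union> T = T" by auto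
      have "(surv A S - ?q\<^sup>2 * surv A {e}) * (surv A T - ?q\<^sup>2 * surv A {e}) =
        surv A S * surv A T - ?q\<^sup>2 * (surv A S * surv A {e}) - ?q\<^sup>2 * (surv A {e} * surv A T)
          + ?q^4 * (surv A {e} * surv A {e})"
        by (simp add: algebra_simps power2_eq_square power4_eq_xxxx)
      also have "\<dots> = surv A (S \<union> T) - ?q\<^sup>2 * surv A S - ?q\<^sup>2 * surv A T + ?q^4 * surv A {e}"
        unfolding surv_mult u by simp
      finally show "(f S * (surv A S - ?q\<^sup>2 * surv A {e})) * (f T * (surv A T - ?q\<^sup>2 * surv A {e})) =
        f S * f T * (surv A (S \<union> T) - ?q\<^sup>2 * surv A S - ?q\<^sup>2 * surv A T + ?q^4 * surv A {e})"
        by (simp add: mult_ac)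
    qed
    finally show ?thesis .
  qed
  have "ex (\<lambda>A. (deviation A e)\<^sup>2) = (\<Sum>S\<in>?D. \<Sum>T\<in>?D. f S * f T *
      (P (S \<union> T) - ?q\<^sup>2 * P S - ?q\<^sup>2 * P T + ?q^4 * ?q))"
    unfolding expand expect_sum expect_cmult expect_add expect_diff
    using e sub by (intro sum.cong refl) (simp add: ex_surv P_singleton)
  also have "\<dots> \<le> (\<Sum>S\<in>?D. \<Sum>T\<in>?D. f S * f T * (10 * \<epsilon>) + (if S = T then f S * \<epsilon> else 0))"
  proof (intro sum_mono)
    fix S T assume ST: "S \<in> ?D" "T \<in> ?D"
    have q5: "?q ^ 5 = ?q\<^sup>2 * ?q ^ 3" "?q ^ 5 = ?q ^ 4 * ?q" by (simp_all add: eval_nat_numeral)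
    have mono: "?q ^ 5 \<le> ?q\<^sup>2 * P U" if "U \<in> ?D" for U
      unfolding q5(1) using P_ge[OF sub[OF that]] edge_card that by (intro mult_left_mono) auto
    note PS = mono[OF ST(1)] and PT = mono[OF ST(2)]
    have ff: "0 \<le> f S * f T" using ST f_nonneg by auto
    show "f S * f T * (P (S \<union> T) - ?q\<^sup>2 * P S - ?q\<^sup>2 * P T + ?q^4 * ?q)
      \<le> f S * f T * (10 * \<epsilon>) + (if S = T then f S * \<epsilon> else 0)"
    proof (cases "S = T")
      case False
      then have "P (S \<union> T) \<le> ?q ^ 5 + 10 * \<epsilon>" using ST by (intro P_union_le) auto
      with PS PT q5(2) have "P (S \<union> T) - ?q\<^sup>2 * P S - ?q\<^sup>2 * P T + ?q^4 * ?q \<le> 10 * \<epsilon>" by linarith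
      with ff False show ?thesis by (auto intro: mult_left_mono)
    next
      case True
      have "P (S \<union> T) \<le> 1" using True P_bounds sub ST by auto
      moreover have "0 \<le> ?q ^ 5" using q by simp
      ultimately have "P (S \<union> T) - ?q\<^sup>2 * P S - ?q\<^sup>2 * P T + ?q^4 * ?q \<le> 1"
        using PS PT q5(2) by linarith
      then have "f S * f T * (P (S \<union> T) - ?q\<^sup>2 * P S - ?q\<^sup>2 * P T + ?q^4 * ?q) \<le> f S * f T * 1"
        using ff by (rule mult_left_mono)
      also have "\<dots> \<le> f S * \<epsilon>" using ST f_nonneg f_le by (auto intro: mult_left_mono)
      also have "\<dots> \<le> f S * f T * (10 * \<epsilon>) + f S * \<epsilon>" using ff \<epsilon> by simp
      finally show ?thesis using True by simp
    qed
  qed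
  also have "\<dots> = F * F * (10 * \<epsilon>) + F * \<epsilon>"
  proof -
    have "(\<Sum>S\<in>?D. \<Sum>T\<in>?D. f S * f T * (10 * \<epsilon>)) = F * F * (10 * \<epsilon>)"
    proof -
      have "F * F = (\<Sum>S\<in>?D. \<Sum>T\<in>?D. f S * f T)" by (simp only: F_def sum_product)
      then show ?thesis by (simp only: sum_distrib_right)
    qed
    moreover have "(\<Sum>S\<in>?D. \<Sum>T\<in>?D. if S = T then f S * \<epsilon> else 0) = F * \<epsilon>"
      using finD by (simp add: sum.delta F_def sum_distrib_right)
    ultimately show ?thesis by (simp only: sum.distrib)
  qed
  also have "\<dots> \<le> 1 * (10 * \<epsilon>) + 1 * \<epsilon>"
    using F \<epsilon> by (intro add_mono mult_right_mono) (auto intro: mult_le_one)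
  finally show ?thesis by simp
qed

text \<open>The inequality 2 \<kappa> |d| \<le> d^2 + \<kappa>^2 takes the place of Cauchy-Schwarz;
  6 is 11/2 + 1/2.\<close>

lemma ex_abs_deviation:
  assumes "e \<in> E" "\<kappa> > 0" "\<epsilon> \<le> \<kappa>\<^sup>2"
  shows "ex (\<lambda>A. \<bar>deviation A e\<bar>) \<le> 6 * \<kappa>"
proof -
  have "ex (\<lambda>A. \<bar>deviation A e\<bar>) \<le> ex (\<lambda>A. 1 / (2 * \<kappa>) * (deviation A e)\<^sup>2 + \<kappa> / 2)"
  proof (intro expect_mono prob_bounds)
    fix A
    have "0 \<le> (\<bar>deviation A e\<bar> - \<kappa>)\<^sup>2" by simp
    then have "2 * \<kappa> * \<bar>deviation A e\<bar> \<le> (deviation A e)\<^sup>2 + \<kappa>\<^sup>2" by (simp add: power2_diff mult_ac)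
    with assms(2) show "\<bar>deviation A e\<bar> \<le> 1 / (2 * \<kappa>) * (deviation A e)\<^sup>2 + \<kappa> / 2"
      by (simp add: field_simps power2_eq_square)
  qed
  also have "\<dots> = 1 / (2 * \<kappa>) * ex (\<lambda>A. (deviation A e)\<^sup>2) + \<kappa> / 2"
    by (simp only: expect_add expect_cmult expect_const[OF finite_events])
  also have "\<dots> \<le> 1 / (2 * \<kappa>) * (11 * \<kappa>\<^sup>2) + \<kappa> / 2"
    using ex_deviation_square[OF assms(1)] assms by (intro add_mono mult_left_mono) auto
  also have "\<dots> = 6 * \<kappa>" using assms(2) by (simp add: power2_eq_square)
  finally show ?thesis .
qed

definition chosen :: "('e set + 'e) set \<Rightarrow> 'e set set" where
  "chosen A = {T\<in>H. Inl T \<in> A \<and> (\<forall>S\<in>H. Inl S \<in> A \<and> S \<noteq> T \<longrightarrow> S \<inter> T = {})}"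

text \<open>Bonferroni: the chosen edges are at least the selected ones minus the ordered pairs of
  distinct intersecting selected ones. The edges meeting \<open>T\<close> have total weight at most
  3, one for each vertex of \<open>T\<close>, whence the loss
  \<open>3 * \<theta>\<^sup>2\<close>.\<close>

lemma ex_card_chosen:
  "ex (\<lambda>A. real (card (chosen A))) \<ge> (\<theta> - 3 * \<theta>\<^sup>2) * (\<Sum>T\<in>H. f T)"
proof -
  let ?N = "\<lambda>T. {S\<in>H. S \<noteq> T \<and> S \<inter> T \<noteq> {}}"
  have finN: "finite (?N T)" for T using finite_H by simp
  have "(\<theta> - 3 * \<theta>\<^sup>2) * (\<Sum>T\<in>H. f T) = (\<Sum>T\<in>H. \<theta> * f T - \<theta> * f T * (\<theta> * 3))"
    unfolding sum_distrib_left by (intro sum.cong refl) (simp add: algebra_simps power2_eq_square)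
  also have "\<dots> \<le> (\<Sum>T\<in>H. \<theta> * f T - (\<Sum>S\<in>?N T. \<theta> * f T * (\<theta> * f S)))"
  proof (intro sum_mono diff_left_mono)
    fix T assume T: "T \<in> H"
    have "(\<Sum>S\<in>?N T. f S) \<le> (\<Sum>S\<in>?N T. \<Sum>e\<in>T. if e \<in> S then f S else 0)"
    proof (rule sum_mono)
      fix S assume S: "S \<in> ?N T"
      then obtain e where e: "e \<in> T" "e \<in> S" by blast
      have "(if e \<in> S then f S else 0) \<le> (\<Sum>e\<in>T. if e \<in> S then f S else 0)"
        using S e f_nonneg finite_edge[OF T] by (intro member_le_sum) auto
      with e show "f S \<le> (\<Sum>e\<in>T. if e \<in> S then f S else 0)" by simp
    qed
    also have "\<dots> \<le> (\<Sum>S\<in>H. \<Sum>e\<in>T. if e \<in> S then f S else 0)"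
      using finite_H f_nonneg by (intro sum_mono2 sum_nonneg) auto
    also have "\<dots> = (\<Sum>e\<in>T. \<Sum>S\<in>H. if e \<in> S then f S else 0)" by (rule sum.swap)
    also have "\<dots> = (\<Sum>e\<in>T. \<Sum>S\<in>{S\<in>H. e \<in> S}. f S)"
      using finite_H by (intro sum.cong[OF refl]) (simp add: sum.inter_filter[symmetric])
    also have "\<dots> \<le> (\<Sum>e\<in>T. 1)" using edge_subset[OF T] by (intro sum_mono load_le_1) auto
    also have "\<dots> = 3" using edge_card[OF T] by simp
    finally show "(\<Sum>S\<in>?N T. \<theta> * f T * (\<theta> * f S)) \<le> \<theta> * f T * (\<theta> * 3)"
      using f_nonneg[OF T] \<theta> by (auto simp: sum_distrib_left[symmetric] intro!: mult_left_mono)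
  qed
  also have "\<dots> = ex (\<lambda>A. \<Sum>T\<in>H. of_bool ({Inl T} \<subseteq> A) - (\<Sum>S\<in>?N T. of_bool ({Inl T, Inl S} \<subseteq> A)))"
    unfolding expect_sum expect_diff
  proof (intro sum.cong refl arg_cong2[where f = "(-)"])
    fix T assume T: "T \<in> H"
    then have "ex (\<lambda>A. of_bool ({Inl T} \<subseteq> A)) = (\<Prod>i\<in>{Inl T}. prob i)"
      by (intro expect_contain finite_events) (auto simp: events_def)
    then show "\<theta> * f T = ex (\<lambda>A. of_bool ({Inl T} \<subseteq> A))" by (simp add: prob_def)
    fix S assume S: "S \<in> ?N T"
    then have "ex (\<lambda>A. of_bool ({Inl T, Inl S} \<subseteq> A)) = (\<Prod>i\<in>{Inl T, Inl S}. prob i)"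
      using T by (intro expect_contain finite_events) (auto simp: events_def)
    moreover have "T \<noteq> S" using S by auto
    ultimately show "\<theta> * f T * (\<theta> * f S) = ex (\<lambda>A. of_bool ({Inl T, Inl S} \<subseteq> A))"
      by (simp add: prob_def)
  qed
  also have "\<dots> \<le> ex (\<lambda>A. real (card (chosen A)))"
  proof (intro expect_mono prob_bounds)
    fix A
    have "(\<Sum>T\<in>H. of_bool ({Inl T} \<subseteq> A) - (\<Sum>S\<in>?N T. of_bool ({Inl T, Inl S} \<subseteq> A)))
      \<le> (\<Sum>T\<in>H. (if T \<in> chosen A then 1 else 0 :: real))"
    proof (intro sum_mono)
      fix T assume T: "T \<in> H"
      have nn: "(\<Sum>S\<in>?N T. of_bool ({Inl T, Inl S} \<subseteq> A) :: real) \<ge> 0" by (intro sum_nonneg) auto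
      show "of_bool ({Inl T} \<subseteq> A) - (\<Sum>S\<in>?N T. of_bool ({Inl T, Inl S} \<subseteq> A))
        \<le> (if T \<in> chosen A then 1 else 0 :: real)"
      proof (cases "Inl T \<in> A \<and> T \<notin> chosen A")
        case True
        with T obtain S where S: "S \<in> ?N T" "Inl S \<in> A" by (auto simp: chosen_def)
        have "(of_bool ({Inl T, Inl S} \<subseteq> A) :: real) \<le> (\<Sum>S\<in>?N T. of_bool ({Inl T, Inl S} \<subseteq> A))"
          using S finN by (intro member_le_sum) auto
        with True S show ?thesis by simp
      next
        case False
        with nn T show ?thesis by (auto simp: chosen_def)
      qed
    qed
    also have "\<dots> = real (card (chosen A))"
      using finite_H by (simp add: sum.inter_filter[symmetric])
        (auto intro!: arg_cong[where f = card] simp: chosen_def)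
    finally show "(\<Sum>T\<in>H. of_bool ({Inl T} \<subseteq> A) - (\<Sum>S\<in>?N T. of_bool ({Inl T, Inl S} \<subseteq> A)))
      \<le> real (card (chosen A))" .
  qed
  finally show ?thesis .
qed

text \<open>Packed edges count 1, remaining weight counts \<open>1 - 4 * \<theta>\<close>. In
  expectation this has the coefficient (\<theta> - 3 \<theta>^2) + (1 - 4 \<theta>)(1 - \<theta>) =
  1 - 4 \<theta> + \<theta>^2. Valuing the remainder slightly below the efficiency 1 - 3 \<theta>
  that the step achieves leaves the surplus \<theta>^2, which will pay for the deviations.\<close>

lemma nibble_step:
  assumes \<kappa>: "\<kappa> > 0" "\<epsilon> \<le> \<kappa>\<^sup>2"
  shows "\<exists>M H' g. M \<subseteq> H \<and> pairwise disjnt M \<and> H' \<subseteq> H \<and> (\<forall>S\<in>M. \<forall>T\<in>H'. S \<inter> T = {}) \<and>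
    fractional_matching E H' g (4 * \<epsilon>) \<and>
    real (card M) + (1 - 4 * \<theta>) * (\<Sum>T\<in>H'. g T)
       \<ge> (1 - 4 * \<theta> + \<theta>\<^sup>2) * (\<Sum>T\<in>H. f T) - 24 * \<kappa> * card E"
proof -
  let ?q = "1 - \<theta>"
  define F where "F = (\<Sum>T\<in>H. f T)"
  have q: "?q > 0" "1 / ?q\<^sup>2 \<le> 4" "1 / ?q\<^sup>2 > 0"
  proof -
    show "?q > 0" using \<theta> by simp
    have "(1/2)\<^sup>2 \<le> ?q\<^sup>2" using \<theta> by (intro power_mono) auto
    then show "1 / ?q\<^sup>2 \<le> 4" using \<theta> by (simp add: power2_eq_square field_simps)
    show "1 / ?q\<^sup>2 > 0" using \<theta> by simp
  qed
  have F: "F \<ge> 0" unfolding F_def using f_nonneg by (intro sum_nonneg)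
  \<comment> \<open>Division by \<open>?q\<^sup>2\<close>, the approximate survival probability of
    an edge at a surviving vertex, restores the loads. Since \<open>1 / ?q\<^sup>2 \<le> 4\<close>,
    the cap grows at most to \<open>4 * \<epsilon>\<close>.\<close>
  define f1 where "f1 = (\<lambda>A T. f T * surv A T / ?q\<^sup>2)"
  \<comment> \<open>One random variable collects the packed edges, the remaining weight and a bound
    on the truncation loss, so a single outcome that reaches its mean suffices.\<close>
  define G where "G = (\<lambda>A. real (card (chosen A)) + (1 - 4 * \<theta>) *
     ((\<Sum>T\<in>H. f1 A T) - (\<Sum>e\<in>E. 1 / ?q\<^sup>2 * \<bar>deviation A e\<bar>)))"
  have "ex (\<lambda>A. \<Sum>T\<in>H. f1 A T) = (\<Sum>T\<in>H. f T / ?q\<^sup>2 * ex (\<lambda>A. surv A T))"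
    unfolding f1_def by (simp add: expect_sum expect_cmult[symmetric] mult.commute)
  also have "\<dots> \<ge> (\<Sum>T\<in>H. f T / ?q\<^sup>2 * ?q ^ 3)"
    using f_nonneg q(1) P_ge edge_subset edge_card
    by (intro sum_mono mult_left_mono) (force simp: ex_surv)+
  also have "(\<Sum>T\<in>H. f T / ?q\<^sup>2 * ?q ^ 3) = ?q * F"
    using q(1) by (simp add: F_def sum_distrib_left power3_eq_cube power2_eq_square mult.commute)
  finally have ex_f1: "ex (\<lambda>A. \<Sum>T\<in>H. f1 A T) \<ge> ?q * F" .
  have "ex (\<lambda>A. \<Sum>e\<in>E. 1 / ?q\<^sup>2 * \<bar>deviation A e\<bar>) = (\<Sum>e\<in>E. 1 / ?q\<^sup>2 * ex (\<lambda>A. \<bar>deviation A e\<bar>))"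
    by (simp only: expect_sum expect_cmult)
  also have "\<dots> \<le> (\<Sum>e\<in>E. 4 * (6 * \<kappa>))"
  proof (intro sum_mono mult_mono ex_abs_deviation)
    fix e
    have "ex (\<lambda>A. 0) \<le> ex (\<lambda>A. \<bar>deviation A e\<bar>)" by (intro expect_mono prob_bounds) auto
    then show "0 \<le> ex (\<lambda>A. \<bar>deviation A e\<bar>)" by (simp add: expect_const finite_events)
  qed (use q \<kappa> in auto)
  also have "\<dots> = 24 * \<kappa> * card E" by simp
  finally have ex_deviation: "ex (\<lambda>A. \<Sum>e\<in>E. 1 / ?q\<^sup>2 * \<bar>deviation A e\<bar>) \<le> 24 * \<kappa> * card E" .
  have "(1 - 4 * \<theta> + \<theta>\<^sup>2) * F - 24 * \<kappa> * card E \<le>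
     (\<theta> - 3 * \<theta>\<^sup>2) * F + (1 - 4 * \<theta>) * (?q * F - 24 * \<kappa> * card E)"
  proof -
    have "(1 - 4 * \<theta>) * (24 * \<kappa> * card E) \<le> 1 * (24 * \<kappa> * card E)"
      using \<theta> \<kappa> by (intro mult_right_mono) auto
    moreover have "(1 - 4 * \<theta> + \<theta>\<^sup>2) * F = (\<theta> - 3 * \<theta>\<^sup>2) * F + (1 - 4 * \<theta>) * (?q * F)"
      by (simp add: algebra_simps power2_eq_square)
    ultimately show ?thesis by (simp add: right_diff_distrib)
  qed
  also have "\<dots> \<le> ex G"
    unfolding G_def expect_add expect_cmult expect_diff
    using ex_card_chosen ex_f1 ex_deviation \<theta> by (intro add_mono mult_left_mono) (auto simp: F_def)
  finally have exG: "(1 - 4 * \<theta> + \<theta>\<^sup>2) * F - 24 * \<kappa> * card E \<le> ex G" .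
  obtain A where A: "A \<subseteq> events" "G A \<ge> ex G"
    by (rule expect_attained[OF finite_events prob_bounds])
  define H' where "H' = {T\<in>H. surv A T = 1}"
  have surv01: "surv A X = 0 \<or> surv A X = 1" for X by (simp add: surv_def)
  have f1_nonneg: "f1 A T \<ge> 0" if "T \<in> H" for T
    using f_nonneg[OF that] surv01[of T] by (auto simp: f1_def)
  have f1_le: "f1 A T \<le> 4 * \<epsilon>" if "T \<in> H" for T
  proof -
    have "f1 A T \<le> f T * (1 / ?q\<^sup>2)"
      using f_nonneg[OF that] surv01[of T] by (auto simp: f1_def)
    also have "\<dots> \<le> \<epsilon> * 4" using f_nonneg[OF that] f_le[OF that] q \<epsilon> by (intro mult_mono) auto
    finally show ?thesis by simp
  qed
  obtain g where g: "\<And>T. T \<in> H \<Longrightarrow> 0 \<le> g T \<and> g T \<le> f1 A T"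
    "\<And>e. e \<in> E \<Longrightarrow> (\<Sum>T\<in>{T\<in>H. e \<in> T}. g T) \<le> 1"
    "(\<Sum>T\<in>H. g T) \<ge> (\<Sum>T\<in>H. f1 A T) - (\<Sum>e\<in>E. max 0 ((\<Sum>T\<in>{T\<in>H. e \<in> T}. f1 A T) - 1))"
    using truncation[of "f1 A", OF f1_nonneg] by blast
  \<comment> \<open>The new load at \<open>e\<close> is the scaled deviation plus
    \<open>surv A {e}\<close> times the old load, and the latter is at most 1.\<close>
  have excess: "max 0 ((\<Sum>T\<in>{T\<in>H. e \<in> T}. f1 A T) - 1) \<le> 1 / ?q\<^sup>2 * \<bar>deviation A e\<bar>" if e: "e \<in> E" for e
  proof -
    have "deviation A e = (\<Sum>T\<in>{T\<in>H. e \<in> T}. f T * surv A T) - ?q\<^sup>2 * surv A {e} * (\<Sum>T\<in>{T\<in>H. e \<in> T}. f T)"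
      unfolding deviation_def by (simp add: right_diff_distrib sum_subtractf sum_distrib_left mult_ac)
    moreover have "(\<Sum>T\<in>{T\<in>H. e \<in> T}. f1 A T) = 1 / ?q\<^sup>2 * (\<Sum>T\<in>{T\<in>H. e \<in> T}. f T * surv A T)"
      unfolding f1_def by (simp add: sum_distrib_left sum_divide_distrib)
    ultimately have "(\<Sum>T\<in>{T\<in>H. e \<in> T}. f1 A T) =
        1 / ?q\<^sup>2 * deviation A e + surv A {e} * (\<Sum>T\<in>{T\<in>H. e \<in> T}. f T)"
      using q(1) by (simp add: field_simps)
    moreover have "surv A {e} * (\<Sum>T\<in>{T\<in>H. e \<in> T}. f T) \<le> 1"
      using load_le_1[OF e] surv01[of "{e}"] by auto
    moreover have "1 / ?q\<^sup>2 * deviation A e \<le> 1 / ?q\<^sup>2 * \<bar>deviation A e\<bar>"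
      using q by (intro mult_left_mono) auto
    moreover have "0 \<le> 1 / ?q\<^sup>2 * \<bar>deviation A e\<bar>" by simp
    ultimately show ?thesis by linarith
  qed
  have "(\<Sum>T\<in>H. f1 A T) - (\<Sum>e\<in>E. 1 / ?q\<^sup>2 * \<bar>deviation A e\<bar>) \<le> (\<Sum>T\<in>H. g T)"
    using g(3) sum_mono[OF excess, of E "\<lambda>e. e"] by simp
  also have "(\<Sum>T\<in>H. g T) = (\<Sum>T\<in>H'. g T)"
  proof (rule sum.mono_neutral_right[OF finite_H])
    show "\<forall>T\<in>H - H'. g T = 0"
    proof
      fix T assume T: "T \<in> H - H'"
      then have "surv A T = 0" using surv01[of T] by (auto simp: H'_def)
      then have "f1 A T = 0" by (simp add: f1_def)
      with g(1)[of T] T show "g T = 0" by auto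
    qed
  qed (auto simp: H'_def)
  finally have sum_g: "(\<Sum>T\<in>H. f1 A T) - (\<Sum>e\<in>E. 1 / ?q\<^sup>2 * \<bar>deviation A e\<bar>) \<le> (\<Sum>T\<in>H'. g T)" .
  show ?thesis
  proof (rule exI[of _ "chosen A"], rule exI[of _ H'], rule exI[of _ g], intro conjI ballI)
    show "chosen A \<subseteq> H" by (auto simp: chosen_def)
    show "pairwise disjnt (chosen A)" by (auto simp: pairwise_def chosen_def disjnt_def)
    show "H' \<subseteq> H" by (auto simp: H'_def)
    show "S \<inter> T = {}" if "S \<in> chosen A" "T \<in> H'" for S T
    proof (rule ccontr)
      assume "S \<inter> T \<noteq> {}"
      with that have "Inl S \<in> A \<inter> killers T" by (auto simp: chosen_def killers_def)
      with that show False by (auto simp: H'_def surv_def)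
    qed
    show "fractional_matching E H' g (4 * \<epsilon>)"
    proof
      show "g T \<ge> 0" "g T \<le> 4 * \<epsilon>" if "T \<in> H'" for T
        using g(1)[of T] f1_le[of T] that by (auto simp: H'_def)
      show "(\<Sum>T\<in>{T\<in>H'. e \<in> T}. g T) \<le> 1" if "e \<in> E" for e
      proof -
        have "(\<Sum>T\<in>{T\<in>H'. e \<in> T}. g T) \<le> (\<Sum>T\<in>{T\<in>H. e \<in> T}. g T)"
          using finite_H g(1) by (intro sum_mono2) (auto simp: H'_def)
        with g(2)[OF that] show ?thesis by simp
      qed
    qed (use finite_E edge_subset edge_card linear in \<open>auto simp: H'_def\<close>)
    have "G A \<le> real (card (chosen A)) + (1 - 4 * \<theta>) * (\<Sum>T\<in>H'. g T)"
      unfolding G_def using sum_g \<theta> by (intro add_left_mono mult_left_mono) auto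
    with exG A(2) show "real (card (chosen A)) + (1 - 4 * \<theta>) * (\<Sum>T\<in>H'. g T)
       \<ge> (1 - 4 * \<theta> + \<theta>\<^sup>2) * (\<Sum>T\<in>H. f T) - 24 * \<kappa> * card E" by (simp add: F_def)
  qed
qed

end

section \<open>Iterating the nibble\<close>

lemma fractional_matching_mono:
  "fractional_matching E H f \<epsilon> \<Longrightarrow> \<epsilon> \<le> \<epsilon>' \<Longrightarrow> fractional_matching E H f \<epsilon>'"
  unfolding fractional_matching_def by force

text \<open>Each round lowers the error coefficient by
  \<open>\<theta>\<^sup>2 * \<delta> / 2\<close> until it reaches \<delta>. If the total weight is
  at most \<open>\<delta> * card E\<close>, the empty matching suffices. Otherwise the surplus
  \<open>\<theta>\<^sup>2 * F\<close> of a step exceeds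
  \<open>\<theta>\<^sup>2 * \<delta> * card E\<close>, of which the deviations consume half.\<close>

lemma nibble_iterate:
  fixes \<theta> \<delta> :: real
  assumes \<theta>: "0 < \<theta>" "\<theta> \<le> 1/4" and \<delta>: "0 < \<delta>"
  shows "\<exists>\<epsilon>>0. \<forall>(E :: 'e set) H f. fractional_matching E H f \<epsilon> \<longrightarrow>
    (\<exists>M\<subseteq>H. pairwise disjnt M \<and> real (card M) \<ge>
       (1 - 4 * \<theta>) * (\<Sum>T\<in>H. f T) - max \<delta> (1 - real k * (\<theta>\<^sup>2 * \<delta> / 2)) * card E)"
proof (induction k)
  case 0
  show ?case
  proof (intro exI[of _ 1] conjI allI impI)
    fix E :: "'e set" and H f assume "fractional_matching E H f 1"
    then interpret fractional_matching E H f 1 .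
    have "(1 - 4 * \<theta>) * (\<Sum>T\<in>H. f T) \<le> 1 * (\<Sum>T\<in>H. f T)"
      using \<theta> f_nonneg by (intro mult_right_mono sum_nonneg) auto
    also have "\<dots> \<le> 1 * real (card E)" using total_le by simp
    also have "\<dots> \<le> max \<delta> (1 - real 0 * (\<theta>\<^sup>2 * \<delta> / 2)) * card E" by (intro mult_right_mono) auto
    finally show "\<exists>M\<subseteq>H. pairwise disjnt M \<and> real (card M) \<ge>
       (1 - 4 * \<theta>) * (\<Sum>T\<in>H. f T) - max \<delta> (1 - real 0 * (\<theta>\<^sup>2 * \<delta> / 2)) * card E"
      by (intro exI[of _ "{}"]) auto
  qed auto
next
  case (Suc k)
  let ?a = "\<lambda>k. max \<delta> (1 - real k * (\<theta>\<^sup>2 * \<delta> / 2))"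
  obtain \<epsilon>' where \<epsilon>': "\<epsilon>' > 0" "\<And>(E :: 'e set) H f. fractional_matching E H f \<epsilon>' \<Longrightarrow>
    (\<exists>M\<subseteq>H. pairwise disjnt M \<and> real (card M) \<ge> (1 - 4 * \<theta>) * (\<Sum>T\<in>H. f T) - ?a k * card E)"
    using Suc by blast
  \<comment> \<open>Chosen so that the deviation error \<open>24 * \<kappa>\<close> of
    \<open>nibble_step\<close> equals \<open>\<theta>\<^sup>2 * \<delta> / 2\<close>.\<close>
  define \<kappa> where "\<kappa> = \<theta>\<^sup>2 * \<delta> / 48"
  have \<kappa>: "\<kappa> > 0" using \<theta> \<delta> by (simp add: \<kappa>_def)
  \<comment> \<open>A step may multiply the cap by 4, and the result must stay within the cap
    \<epsilon>' of the remaining rounds.\<close>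
  define \<epsilon> where "\<epsilon> = min (\<epsilon>' / 4) (min 1 (\<kappa>\<^sup>2))"
  have eps: "0 < \<epsilon>" "\<epsilon> \<le> 1" "4 * \<epsilon> \<le> \<epsilon>'" "\<epsilon> \<le> \<kappa>\<^sup>2" using \<epsilon>'(1) \<kappa> by (auto simp: \<epsilon>_def)
  show ?case
  proof (intro exI[of _ \<epsilon>] conjI allI impI eps)
    fix E :: "'e set" and H f assume fm: "fractional_matching E H f \<epsilon>"
    then interpret nibble E H f \<epsilon> \<theta>
      using \<theta> eps by (simp add: nibble_def nibble_axioms_def)
    define F where "F = (\<Sum>T\<in>H. f T)"
    have F: "F \<ge> 0" unfolding F_def using f_nonneg by (intro sum_nonneg)
    show "\<exists>M\<subseteq>H. pairwise disjnt M \<and> real (card M) \<ge> (1 - 4 * \<theta>) * (\<Sum>T\<in>H. f T) - ?a (Suc k) * card E"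
    proof (cases "F \<le> \<delta> * card E")
      case True
      have "(1 - 4 * \<theta>) * F \<le> 1 * F" using \<theta> F by (intro mult_right_mono) auto
      also have "\<dots> \<le> \<delta> * card E" using True by simp
      also have "\<dots> \<le> ?a (Suc k) * card E" by (intro mult_right_mono) auto
      finally show ?thesis by (intro exI[of _ "{}"]) (auto simp: F_def)
    next
      case False
      obtain M H' g where all: "M \<subseteq> H \<and> pairwise disjnt M \<and> H' \<subseteq> H \<and>
        (\<forall>S\<in>M. \<forall>T\<in>H'. S \<inter> T = {}) \<and> fractional_matching E H' g (4 * \<epsilon>) \<and>
        real (card M) + (1 - 4 * \<theta>) * (\<Sum>T\<in>H'. g T) \<ge> (1 - 4 * \<theta> + \<theta>\<^sup>2) * F - 24 * \<kappa> * card E"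
        using nibble_step[OF \<kappa> eps(4), folded F_def] by (elim exE) (rule that)
      then have M: "M \<subseteq> H" "pairwise disjnt M" "H' \<subseteq> H" "\<forall>S\<in>M. \<forall>T\<in>H'. S \<inter> T = {}"
        and fm': "fractional_matching E H' g (4 * \<epsilon>)"
        and ge: "real (card M) + (1 - 4 * \<theta>) * (\<Sum>T\<in>H'. g T) \<ge> (1 - 4 * \<theta> + \<theta>\<^sup>2) * F - 24 * \<kappa> * card E"
        by simp_all
      obtain M' where M': "M' \<subseteq> H'" "pairwise disjnt M'"
        "real (card M') \<ge> (1 - 4 * \<theta>) * (\<Sum>T\<in>H'. g T) - ?a k * card E"
        using \<epsilon>'(2)[OF fractional_matching_mono[OF fm' eps(3)]] by blast
      have cross: "S \<inter> T = {}" if "S \<in> M" "T \<in> M'" for S T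
        using M(4) M'(1) that by auto
      have "M \<inter> M' = {}"
      proof (rule ccontr)
        assume "M \<inter> M' \<noteq> {}"
        then obtain T where T: "T \<in> M" "T \<in> M'" by auto
        with cross[OF T] M(1) edge_nonempty[of T] show False by auto
      qed
      then have "card (M \<union> M') = card M + card M'"
        using finite_subset[OF M(1) finite_H] finite_subset[OF M'(1) finite_subset[OF M(3) finite_H]]
        by (intro card_Un_disjoint)
      moreover have "\<theta>\<^sup>2 * F \<ge> \<theta>\<^sup>2 * (\<delta> * card E)" using False by (intro mult_left_mono) auto
      moreover have "?a (Suc k) * card E \<ge> (?a k - \<theta>\<^sup>2 * \<delta> / 2) * card E"
      proof (intro mult_right_mono)
        have "max \<delta> (1 - real k * t) - t \<le> max \<delta> (1 - real (Suc k) * t)" if "0 \<le> t" for t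
        proof -
          have "real (Suc k) * t = real k * t + t" by (simp add: distrib_right)
          with that show ?thesis by linarith
        qed
        from this[of "\<theta>\<^sup>2 * \<delta> / 2"] \<delta> show "?a k - \<theta>\<^sup>2 * \<delta> / 2 \<le> ?a (Suc k)" by simp
      qed auto
      ultimately have "real (card (M \<union> M')) \<ge> (1 - 4 * \<theta>) * F - ?a (Suc k) * card E"
        using ge M'(3) by (simp add: \<kappa>_def algebra_simps)
      moreover have "pairwise disjnt (M \<union> M')"
        unfolding pairwise_def
      proof (intro ballI impI)
        fix S T assume "S \<in> M \<union> M'" "T \<in> M \<union> M'" "S \<noteq> T"
        then consider "S \<in> M" "T \<in> M" | "S \<in> M'" "T \<in> M'" | "S \<in> M" "T \<in> M'" | "T \<in> M" "S \<in> M'"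
          by auto
        then show "disjnt S T"
          by cases (use M(2) M'(2) cross[of S T] cross[of T S] \<open>S \<noteq> T\<close>
            in \<open>simp_all add: pairwise_def disjnt_def Int_commute\<close>)
      qed
      ultimately show ?thesis
        using M(1,3) M'(1) by (intro exI[of _ "M \<union> M'"]) (auto simp: F_def)
    qed
  qed
qed

theorem matching_from_fractional:
  fixes \<delta> :: real
  assumes "\<delta> > 0"
  shows "\<exists>\<epsilon>>0. \<forall>(E :: 'e set) H f. fractional_matching E H f \<epsilon> \<longrightarrow>
    (\<exists>M\<subseteq>H. pairwise disjnt M \<and> real (card M) \<ge> (\<Sum>T\<in>H. f T) - \<delta> * card E)"
proof -
  \<comment> \<open>Half of \<delta> is spent on the lost share \<open>4 * \<theta>\<close> of the
    weight, half on the error coefficient, which is down to \<open>\<delta> / 2\<close> after more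
    than \<open>1 / \<rho>\<close> rounds.\<close>
  define \<theta> where "\<theta> = min (1/4) (\<delta> / 8)"
  have \<theta>: "0 < \<theta>" "\<theta> \<le> 1/4" "4 * \<theta> \<le> \<delta> / 2" using assms by (auto simp: \<theta>_def)
  define \<rho> where "\<rho> = \<theta>\<^sup>2 * (\<delta> / 2) / 2"
  have \<rho>: "\<rho> > 0" using \<theta> assms by (simp add: \<rho>_def)
  obtain k :: nat where k: "1 / \<rho> < real k" using reals_Archimedean2 by blast
  then have k: "1 - real k * \<rho> \<le> \<delta> / 2" using \<rho> assms by (simp add: field_simps)
  obtain \<epsilon> where \<epsilon>: "\<epsilon> > 0" "\<And>(E :: 'e set) H f. fractional_matching E H f \<epsilon> \<Longrightarrow>
    (\<exists>M\<subseteq>H. pairwise disjnt M \<and> real (card M) \<ge>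
       (1 - 4 * \<theta>) * (\<Sum>T\<in>H. f T) - max (\<delta> / 2) (1 - real k * \<rho>) * card E)"
    using nibble_iterate[OF \<theta>(1,2), of "\<delta> / 2" k] assms unfolding \<rho>_def by auto
  have "\<exists>M\<subseteq>H. pairwise disjnt M \<and> real (card M) \<ge> (\<Sum>T\<in>H. f T) - \<delta> * card E"
    if fm: "fractional_matching E H f \<epsilon>" for E :: "'e set" and H f
  proof -
    interpret fractional_matching E H f \<epsilon> by (rule fm)
    obtain M where M: "M \<subseteq> H" "pairwise disjnt M"
      "real (card M) \<ge> (1 - 4 * \<theta>) * (\<Sum>T\<in>H. f T) - max (\<delta> / 2) (1 - real k * \<rho>) * card E"
      using \<epsilon>(2)[OF fm] by blast
    have "4 * \<theta> * (\<Sum>T\<in>H. f T) \<le> \<delta> / 2 * card E"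
      using \<theta> total_le f_nonneg assms by (intro mult_mono sum_nonneg) auto
    moreover have "max (\<delta> / 2) (1 - real k * \<rho>) = \<delta> / 2" using k by (rule max_absorb1)
    ultimately have "real (card M) \<ge> (\<Sum>T\<in>H. f T) - \<delta> * card E"
      using M(3) by (simp only:) (simp add: left_diff_distrib)
    with M show ?thesis by blast
  qed
  with \<epsilon>(1) show ?thesis by blast
qed

section \<open>Regularity and triangle removal\<close>

definition edge_count :: "('a \<times> 'a) set \<Rightarrow> 'a set \<Rightarrow> 'a set \<Rightarrow> real" where
  "edge_count R U W = real (card (R \<inter> U \<times> W))"

definition density :: "('a \<times> 'a) set \<Rightarrow> 'a set \<Rightarrow> 'a set \<Rightarrow> real" where
  "density R U W = edge_count R U W / (real (card U) * real (card W))"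

text \<open>The densities of subpairs are multiplied out, so an empty \<open>U'\<close> or
  \<open>W'\<close> is never a witness: both sides are then 0 and the inequality is strict.\<close>

definition irregular :: "real \<Rightarrow> ('a \<times> 'a) set \<Rightarrow> 'a set \<Rightarrow> 'a set \<Rightarrow> bool" where
  "irregular \<epsilon> R U W \<longleftrightarrow> (\<exists>U'\<subseteq>U. \<exists>W'\<subseteq>W. real (card U') \<ge> \<epsilon> * card U \<and> real (card W') \<ge> \<epsilon> * card W \<and>
     \<bar>edge_count R U' W' - density R U W * (real (card U') * real (card W'))\<bar>
       > \<epsilon> * (real (card U') * real (card W')))"

lemma regularD:
  assumes "\<not> irregular \<epsilon> R U W" "U' \<subseteq> U" "W' \<subseteq> W" "real (card U') \<ge> \<epsilon> * card U" "real (card W') \<ge> \<epsilon> * card W"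
  shows "\<bar>edge_count R U' W' - density R U W * (real (card U') * real (card W'))\<bar>
    \<le> \<epsilon> * (real (card U') * real (card W'))"
  using assms unfolding irregular_def not_less[symmetric] by blast

lemma edge_count_converse: "edge_count (R\<inverse>) W U = edge_count R U W"
proof -
  have "R\<inverse> \<inter> W \<times> U = prod.swap ` (R \<inter> U \<times> W)" by force
  then show ?thesis unfolding edge_count_def by (simp add: card_image)
qed

lemma irregular_converse: "irregular \<epsilon> (R\<inverse>) W U \<Longrightarrow> irregular \<epsilon> R U W"
  unfolding irregular_def density_def edge_count_converse by (metis mult.commute)

lemma edge_count_sum:
  assumes "finite U" "finite W"
  shows "edge_count R U W = (\<Sum>u\<in>U. real (card {w\<in>W. (u, w) \<in> R}))"
proof -
  have "R \<inter> U \<times> W = (SIGMA u:U. {w\<in>W. (u, w) \<in> R})" by auto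
  then show ?thesis using assms by (simp add: edge_count_def)
qed

lemma density_bounds:
  assumes "finite U" "finite W"
  shows "0 \<le> density R U W" "density R U W \<le> 1"
proof -
  show "0 \<le> density R U W" by (simp add: density_def edge_count_def)
  have "card (R \<inter> U \<times> W) \<le> card (U \<times> W)" using assms by (intro card_mono) auto
  then have "edge_count R U W \<le> real (card U) * real (card W)"
    unfolding edge_count_def card_cartesian_product by (metis of_nat_le_iff of_nat_mult)
  then show "density R U W \<le> 1" unfolding density_def by (intro divide_le_eq_1[THEN iffD2]) auto
qed

lemma sum_squared_le_card:
  fixes d :: "'b \<Rightarrow> real"
  shows "(\<Sum>x\<in>S. d x)\<^sup>2 \<le> (\<Sum>x\<in>S. (d x)\<^sup>2) * card S"
proof (cases "card S = 0")
  case True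
  then show ?thesis by (metis card_0_eq mult_zero_right of_nat_0 order_refl power_zero_numeral sum.empty sum.infinite)
next
  case False
  define m where "m = (\<Sum>x\<in>S. d x) / card S"
  have "0 \<le> (\<Sum>x\<in>S. (d x - m)\<^sup>2)" by (simp add: sum_nonneg)
  also have "\<dots> = (\<Sum>x\<in>S. (d x)\<^sup>2) - 2 * m * (\<Sum>x\<in>S. d x) + card S * m\<^sup>2"
  proof -
    have "(\<Sum>x\<in>S. 2 * d x * m) = 2 * m * (\<Sum>x\<in>S. d x)"
      unfolding sum_distrib_left by (intro sum.cong) auto
    then show ?thesis by (simp add: power2_diff sum.distrib sum_subtractf)
  qed
  also have "\<dots> = (\<Sum>x\<in>S. (d x)\<^sup>2) - (\<Sum>x\<in>S. d x)\<^sup>2 / card S"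
    using False by (simp add: m_def power2_eq_square)
  finally show ?thesis using False by (simp add: field_simps)
qed

text \<open>Otherwise the vertices of low degree form, together with all of \<open>W\<close>, a
  subpair of density below \<epsilon>, too far from a density of at least
  \<open>2 * \<epsilon>\<close>.\<close>

lemma regular_low_degree:
  assumes fin: "finite U" "finite W" and reg: "\<not> irregular \<epsilon> R U W"
    and dens: "density R U W \<ge> 2 * \<epsilon>" and \<epsilon>: "0 < \<epsilon>" "\<epsilon> < 1" and ne: "U \<noteq> {}" "W \<noteq> {}"
  shows "real (card {u\<in>U. real (card {w\<in>W. (u, w) \<in> R}) < \<epsilon> * card W}) < \<epsilon> * card U"
proof (rule ccontr)
  let ?L = "{u\<in>U. real (card {w\<in>W. (u, w) \<in> R}) < \<epsilon> * card W}"
  assume "\<not> ?thesis"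
  then have L: "real (card ?L) \<ge> \<epsilon> * card U" by simp
  have "real (card U) > 0" using fin ne by (simp add: card_gt_0_iff)
  then have "0 < \<epsilon> * card U" using \<epsilon> by simp
  with L have "real (card ?L) > 0" by linarith
  then have Lne: "?L \<noteq> {}" by force
  have "real (card W) \<ge> \<epsilon> * card W" using \<epsilon> by (simp add: mult_left_le_one_le)
  then have "\<bar>edge_count R ?L W - density R U W * (real (card ?L) * real (card W))\<bar>
       \<le> \<epsilon> * (real (card ?L) * real (card W))"
    by (intro regularD[OF reg] L) auto
  moreover have "density R U W * (real (card ?L) * real (card W)) \<ge> 2 * \<epsilon> * (real (card ?L) * real (card W))"
    using dens by (intro mult_right_mono) auto
  ultimately have "edge_count R ?L W \<ge> \<epsilon> * (real (card ?L) * real (card W))" by linarith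
  moreover have "edge_count R ?L W = (\<Sum>u\<in>?L. real (card {w\<in>W. (u, w) \<in> R}))"
    using fin by (intro edge_count_sum) auto
  moreover have "\<dots> < (\<Sum>u\<in>?L. \<epsilon> * card W)"
    using fin Lne by (intro sum_strict_mono) auto
  ultimately show False by (simp add: mult_ac)
qed

text \<open>All but \<open>2 * \<epsilon> * card U3\<close> vertices \<open>w\<close> have an
  \<epsilon> share of \<open>U1\<close> as out-neighbours and of \<open>U2\<close> as in-neighbours.
  Regularity of \<open>U1\<close> and \<open>U2\<close> guarantees density at least \<epsilon>
  between these neighbourhoods, which gives the third factor \<epsilon>.\<close>

lemma triangle_counting:
  fixes U1 U2 U3 :: "'a set"
  assumes fin: "finite U1" "finite U2" "finite U3" and ne: "U1 \<noteq> {}" "U2 \<noteq> {}" "U3 \<noteq> {}"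
    and reg: "\<not> irregular \<epsilon> X U1 U2" "\<not> irregular \<epsilon> Y U2 U3" "\<not> irregular \<epsilon> Z U3 U1"
    and dens: "density X U1 U2 \<ge> 2 * \<epsilon>" "density Y U2 U3 \<ge> 2 * \<epsilon>" "density Z U3 U1 \<ge> 2 * \<epsilon>"
    and \<epsilon>: "0 < \<epsilon>" "\<epsilon> < 1"
  shows "real (card {(u, v, w). u \<in> U1 \<and> v \<in> U2 \<and> w \<in> U3 \<and> (u, v) \<in> X \<and> (v, w) \<in> Y \<and> (w, u) \<in> Z})
    \<ge> (1 - 2 * \<epsilon>) * \<epsilon> ^ 3 * (real (card U1) * real (card U2) * real (card U3))"
proof -
  define A B where "A = (\<lambda>w. {u\<in>U1. (w, u) \<in> Z})" and "B = (\<lambda>w. {v\<in>U2. (v, w) \<in> Y})"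
  define LA LB where "LA = {w\<in>U3. real (card (A w)) < \<epsilon> * card U1}"
    and "LB = {w\<in>U3. real (card (B w)) < \<epsilon> * card U2}"
  define G where "G = U3 - (LA \<union> LB)"
  have "real (card LA) < \<epsilon> * card U3"
    unfolding LA_def A_def by (intro regular_low_degree assms)
  moreover have "real (card LB) < \<epsilon> * card U3"
  proof -
    \<comment> \<open>\<open>Y\<close> runs from \<open>U2\<close> into \<open>U3\<close>; its
      converse makes \<open>U3\<close> the side whose degrees are bounded.\<close>
    have "real (card {w\<in>U3. real (card {v\<in>U2. (w, v) \<in> Y\<inverse>}) < \<epsilon> * card U2}) < \<epsilon> * card U3"
    proof (intro regular_low_degree assms)
      show "\<not> irregular \<epsilon> (Y\<inverse>) U3 U2" using reg(2) irregular_converse by blast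
      show "2 * \<epsilon> \<le> density (Y\<inverse>) U3 U2"
        using dens(2) by (simp add: density_def edge_count_converse mult.commute)
    qed
    then show ?thesis by (simp add: LB_def B_def)
  qed
  moreover have "card U3 \<le> card G + (card LA + card LB)"
  proof -
    have "card U3 \<le> card (G \<union> (LA \<union> LB))" using fin by (intro card_mono) (auto simp: G_def LA_def LB_def)
    also have "\<dots> \<le> card G + (card LA + card LB)"
      by (meson add_left_mono card_Un_le order_trans)
    finally show ?thesis .
  qed
  ultimately have G: "real (card G) \<ge> (1 - 2 * \<epsilon>) * card U3" by (simp add: left_diff_distrib)
  have each: "real (card (X \<inter> A w \<times> B w)) \<ge> \<epsilon> ^ 3 * (real (card U1) * real (card U2))" if "w \<in> G" for w
  proof -
    have big: "real (card (A w)) \<ge> \<epsilon> * card U1" "real (card (B w)) \<ge> \<epsilon> * card U2"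
      using that by (auto simp: G_def LA_def LB_def)
    have sub: "A w \<subseteq> U1" "B w \<subseteq> U2" by (auto simp: A_def B_def)
    have "\<bar>edge_count X (A w) (B w) - density X U1 U2 * (real (card (A w)) * real (card (B w)))\<bar>
       \<le> \<epsilon> * (real (card (A w)) * real (card (B w)))"
      by (rule regularD[OF reg(1) sub big])
    moreover have "density X U1 U2 * (real (card (A w)) * real (card (B w)))
        \<ge> 2 * \<epsilon> * (real (card (A w)) * real (card (B w)))"
      using dens by (intro mult_right_mono) auto
    ultimately have "edge_count X (A w) (B w) \<ge> \<epsilon> * (real (card (A w)) * real (card (B w)))" by linarith
    moreover have "\<epsilon> * (real (card (A w)) * real (card (B w))) \<ge> \<epsilon> * ((\<epsilon> * card U1) * (\<epsilon> * card U2))"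
      using big \<epsilon> by (intro mult_left_mono mult_mono) auto
    ultimately show ?thesis by (simp add: edge_count_def power3_eq_cube mult_ac)
  qed
  let ?T = "{(u, v, w). u \<in> U1 \<and> v \<in> U2 \<and> w \<in> U3 \<and> (u, v) \<in> X \<and> (v, w) \<in> Y \<and> (w, u) \<in> Z}"
  have finG: "finite G" using fin by (simp add: G_def)
  have finAB: "finite (X \<inter> A w \<times> B w)" for w using fin by (auto simp: A_def B_def)
  have "(1 - 2 * \<epsilon>) * \<epsilon> ^ 3 * (real (card U1) * real (card U2) * real (card U3))
     = (1 - 2 * \<epsilon>) * card U3 * (\<epsilon> ^ 3 * (real (card U1) * real (card U2)))" by (simp add: mult_ac)
  also have "\<dots> \<le> card G * (\<epsilon> ^ 3 * (real (card U1) * real (card U2)))"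
    using G \<epsilon> by (intro mult_right_mono) auto
  also have "\<dots> \<le> (\<Sum>w\<in>G. real (card (X \<inter> A w \<times> B w)))"
    using sum_mono[OF each, of G "\<lambda>w. w"] by simp
  also have "\<dots> = real (card (SIGMA w:G. X \<inter> A w \<times> B w))"
    using finG finAB by simp
  also have "\<dots> \<le> real (card ?T)"
  proof (intro of_nat_mono card_inj_on_le)
    show "inj_on (\<lambda>(w, u, v). (u, v, w)) (SIGMA w:G. X \<inter> A w \<times> B w)" by (auto simp: inj_on_def)
    show "(\<lambda>(w, u, v). (u, v, w)) ` (SIGMA w:G. X \<inter> A w \<times> B w) \<subseteq> ?T"
      by (auto simp: A_def B_def G_def)
    have "?T \<subseteq> U1 \<times> U2 \<times> U3" by auto
    then show "finite ?T" using fin finite_subset by blast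
  qed
  finally show ?thesis .
qed

section \<open>Vertex partitions, energy and refinement\<close>

locale finite_vertices =
  fixes V :: "'a set"
  assumes finite_V: "finite V"
begin

text \<open>The part of \<open>u\<close> in the partition generated by the family \<open>F\<close>.
  With families in place of partitions, a refinement is simply a superset, and there are at most
  \<open>2 ^ card F\<close> parts.\<close>

definition atom :: "'a set set \<Rightarrow> 'a \<Rightarrow> 'a set" where
  "atom F u = {x\<in>V. \<forall>S\<in>F. x \<in> S \<longleftrightarrow> u \<in> S}"

definition block_density :: "('a \<times> 'a) set \<Rightarrow> 'a set set \<Rightarrow> 'a \<times> 'a \<Rightarrow> real" where
  "block_density R F p = density R (atom F (fst p)) (atom F (snd p))"

text \<open>Summation over pairs of vertices weights the squared density of a block by the number of
  its pairs.\<close>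

definition energy :: "('a \<times> 'a) set \<Rightarrow> 'a set set \<Rightarrow> real" where
  "energy R F = (\<Sum>p\<in>V \<times> V. (block_density R F p)\<^sup>2)"

definition irregular_pairs :: "real \<Rightarrow> ('a \<times> 'a) set \<Rightarrow> 'a set set \<Rightarrow> ('a \<times> 'a) set" where
  "irregular_pairs \<epsilon> R F = {p\<in>V \<times> V. irregular \<epsilon> R (atom F (fst p)) (atom F (snd p))}"

lemma finite_atom: "finite (atom F u)"
  using finite_V by (simp add: atom_def)

lemma atom_subset: "atom F u \<subseteq> V"
  by (auto simp: atom_def)

lemma atom_self: "u \<in> V \<Longrightarrow> u \<in> atom F u"
  by (simp add: atom_def)

lemma atom_eq: "x \<in> atom F u \<Longrightarrow> atom F x = atom F u"
  by (auto simp: atom_def)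

lemma atom_sym: "u \<in> V \<Longrightarrow> x \<in> atom F u \<Longrightarrow> u \<in> atom F x"
  by (auto simp: atom_def)

lemma atom_antimono: "F \<subseteq> G \<Longrightarrow> atom G u \<subseteq> atom F u"
  by (auto simp: atom_def)

lemma atom_member: "S \<in> F \<Longrightarrow> x \<in> atom F u \<Longrightarrow> x \<in> S \<longleftrightarrow> u \<in> S"
  by (auto simp: atom_def)

lemma card_atom_pos: "u \<in> V \<Longrightarrow> card (atom F u) > 0"
  using atom_self finite_atom by (metis card_gt_0_iff empty_iff)

lemma card_atoms: assumes "finite F" shows "card (atom F ` V) \<le> 2 ^ card F"
proof -
  have "atom F ` V \<subseteq> (\<lambda>C. {x\<in>V. \<forall>S\<in>F. x \<in> S \<longleftrightarrow> S \<in> C}) ` Pow F"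
  proof
    fix U assume "U \<in> atom F ` V"
    then obtain u where "u \<in> V" "U = atom F u" by auto
    then have "U = (\<lambda>C. {x\<in>V. \<forall>S\<in>F. x \<in> S \<longleftrightarrow> S \<in> C}) {S\<in>F. u \<in> S}" by (auto simp: atom_def)
    then show "U \<in> (\<lambda>C. {x\<in>V. \<forall>S\<in>F. x \<in> S \<longleftrightarrow> S \<in> C}) ` Pow F" by blast
  qed
  then have "card (atom F ` V) \<le> card (Pow F)"
    using assms by (meson card_image_le card_mono finite_Pow_iff finite_imageI order_trans)
  then show ?thesis using assms by (simp add: card_Pow)
qed

lemma sum_blocks:
  fixes h :: "'a \<times> 'a \<Rightarrow> real"
  shows "(\<Sum>p\<in>V \<times> V. h p) = (\<Sum>(U, W)\<in>atom F ` V \<times> atom F ` V. \<Sum>p\<in>U \<times> W. h p)"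
proof -
  let ?g = "\<lambda>p. (atom F (fst p), atom F (snd p))"
  have "(\<Sum>p\<in>V \<times> V. h p) = (\<Sum>y\<in>atom F ` V \<times> atom F ` V. \<Sum>p\<in>{p\<in>V \<times> V. ?g p = y}. h p)"
    using finite_V by (intro sum.group[symmetric]) auto
  also have "\<dots> = (\<Sum>(U, W)\<in>atom F ` V \<times> atom F ` V. \<Sum>p\<in>U \<times> W. h p)"
  proof (intro sum.cong refl, clarify)
    fix u w assume uw: "u \<in> V" "w \<in> V"
    have "p \<in> V \<times> V \<and> ?g p = (atom F u, atom F w) \<longleftrightarrow> p \<in> atom F u \<times> atom F w" for p
      using atom_subset[of F u] atom_subset[of F w] atom_eq[of "fst p" F u] atom_eq[of "snd p" F w]
        atom_self[of "fst p" F] atom_self[of "snd p" F]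
      by (cases p) auto
    then have "{p\<in>V \<times> V. ?g p = (atom F u, atom F w)} = atom F u \<times> atom F w" by blast
    then show "(\<Sum>p\<in>{p\<in>V \<times> V. ?g p = (atom F u, atom F w)}. h p) = (\<Sum>p\<in>atom F u \<times> atom F w. h p)"
      by simp
  qed
  finally show ?thesis .
qed

text \<open>The block density is the conditional expectation of the indicator function of \<open>R\<close>.\<close>

lemma sum_block_density:
  fixes h :: "'a \<times> 'a \<Rightarrow> real"
  assumes R: "R \<subseteq> V \<times> V"
    and h: "\<And>u v u' v'. u \<in> V \<Longrightarrow> v \<in> V \<Longrightarrow> u' \<in> atom F u \<Longrightarrow> v' \<in> atom F v \<Longrightarrow> h (u', v') = h (u, v)"
  shows "(\<Sum>p\<in>V \<times> V. h p * block_density R F p) = (\<Sum>p\<in>R. h p)"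
proof -
  let ?c = "\<lambda>u. real (card (atom F u))"
  have finR: "finite R" using R finite_V by (meson finite_SigmaI finite_subset)
  have "block_density R F p = (\<Sum>q\<in>R. if fst q \<in> atom F (fst p) \<and> snd q \<in> atom F (snd p)
     then 1 / (?c (fst p) * ?c (snd p)) else 0)" for p
  proof -
    have "R \<inter> atom F (fst p) \<times> atom F (snd p) = {q\<in>R. fst q \<in> atom F (fst p) \<and> snd q \<in> atom F (snd p)}"
      by auto
    then show ?thesis
      unfolding block_density_def density_def edge_count_def using finR
      by (simp add: sum.inter_filter[symmetric])
  qed
  then have "(\<Sum>p\<in>V \<times> V. h p * block_density R F p) =
    (\<Sum>p\<in>V \<times> V. \<Sum>q\<in>R. if fst q \<in> atom F (fst p) \<and> snd q \<in> atom F (snd p)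
     then h p / (?c (fst p) * ?c (snd p)) else 0)"
    by (simp add: sum_distrib_left if_distrib[of "(*) _"] cong: if_cong)
  also have "\<dots> = (\<Sum>q\<in>R. \<Sum>p\<in>V \<times> V. if fst q \<in> atom F (fst p) \<and> snd q \<in> atom F (snd p)
     then h p / (?c (fst p) * ?c (snd p)) else 0)" by (rule sum.swap)
  also have "\<dots> = (\<Sum>q\<in>R. h q)"
  proof (rule sum.cong[OF refl])
    fix q assume "q \<in> R"
    then obtain x y where q: "q = (x, y)" "x \<in> V" "y \<in> V" using R by auto
    have "(\<Sum>p\<in>V \<times> V. if fst q \<in> atom F (fst p) \<and> snd q \<in> atom F (snd p)
        then h p / (?c (fst p) * ?c (snd p)) else 0)
      = (\<Sum>p\<in>{p\<in>V \<times> V. fst q \<in> atom F (fst p) \<and> snd q \<in> atom F (snd p)}.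
           h p / (?c (fst p) * ?c (snd p)))"
      using finite_V by (simp add: sum.inter_filter)
    also have "\<dots> = (\<Sum>p\<in>atom F x \<times> atom F y. h (x, y) / (?c x * ?c y))"
    proof (rule sum.cong)
      show "{p\<in>V \<times> V. fst q \<in> atom F (fst p) \<and> snd q \<in> atom F (snd p)} = atom F x \<times> atom F y"
        using q atom_subset by (auto intro: atom_sym)
      fix p assume "p \<in> atom F x \<times> atom F y"
      then obtain u v where p: "p = (u, v)" "u \<in> atom F x" "v \<in> atom F y" by auto
      then show "h p / (?c (fst p) * ?c (snd p)) = h (x, y) / (?c x * ?c y)"
        using h[OF q(2,3) p(2,3)] atom_eq by simp
    qed
    also have "\<dots> = h q"
      using card_atom_pos[OF q(2), of F] card_atom_pos[OF q(3), of F] q(1)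
      by (simp add: card_cartesian_product)
    finally show "(\<Sum>p\<in>V \<times> V. if fst q \<in> atom F (fst p) \<and> snd q \<in> atom F (snd p)
        then h p / (?c (fst p) * ?c (snd p)) else 0) = h q" .
  qed
  finally show ?thesis .
qed

lemma block_density_const:
  assumes "F \<subseteq> G" "u' \<in> atom G u" "v' \<in> atom G v"
  shows "block_density R F (u', v') = block_density R F (u, v)"
proof -
  have "u' \<in> atom F u" "v' \<in> atom F v" using assms atom_antimono by blast+
  then have "atom F u' = atom F u" "atom F v' = atom F v" using atom_eq by auto
  then show ?thesis by (simp add: block_density_def)
qed

text \<open>Pythagoras: by \<open>sum_block_density\<close> the coarser density has the same inner
  product with the finer density as with itself, so it is orthogonal to their difference.\<close>

lemma energy_increment_eq:
  assumes "R \<subseteq> V \<times> V" "F \<subseteq> G"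
  shows "(\<Sum>p\<in>V \<times> V. (block_density R G p - block_density R F p)\<^sup>2) = energy R G - energy R F"
proof -
  have "(\<Sum>p\<in>V \<times> V. block_density R F p * block_density R G p) = (\<Sum>p\<in>R. block_density R F p)"
    using assms by (intro sum_block_density block_density_const)
  also have "\<dots> = (\<Sum>p\<in>V \<times> V. block_density R F p * block_density R F p)"
    using assms by (intro sum_block_density[symmetric] block_density_const[OF order_refl])
  finally have cross: "(\<Sum>p\<in>V \<times> V. block_density R F p * block_density R G p) = energy R F"
    by (simp add: energy_def power2_eq_square)
  have "(\<Sum>p\<in>V \<times> V. (block_density R G p - block_density R F p)\<^sup>2) =
     (\<Sum>p\<in>V \<times> V. (block_density R G p)\<^sup>2 + (block_density R F p)\<^sup>2
        - 2 * (block_density R F p * block_density R G p))"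
    by (intro sum.cong) (auto simp: power2_eq_square algebra_simps)
  also have "\<dots> = energy R G + energy R F - 2 * (\<Sum>p\<in>V \<times> V. block_density R F p * block_density R G p)"
    by (simp add: energy_def sum.distrib sum_subtractf sum_distrib_left)
  finally show ?thesis by (simp add: cross)
qed

lemma block_density_bounds: "0 \<le> block_density R F p" "block_density R F p \<le> 1"
  using density_bounds[OF finite_atom finite_atom] by (auto simp: block_density_def)

lemma energy_bounds: "0 \<le> energy R F" "energy R F \<le> (real (card V))\<^sup>2"
proof -
  show "0 \<le> energy R F" by (simp add: energy_def sum_nonneg)
  have "energy R F \<le> (\<Sum>p\<in>V \<times> V. 1)"
    unfolding energy_def using block_density_bounds by (intro sum_mono power_le_one) auto
  then show "energy R F \<le> (real (card V))\<^sup>2" by (simp add: power2_eq_square card_cartesian_product)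
qed

text \<open>\<open>U'\<close> and \<open>W'\<close> are unions of parts of \<open>G\<close>, so over
  \<open>U' \<times> W'\<close> the finer densities sum to the true edge count and the coarser ones
  to its prediction. By Cauchy-Schwarz the gain on an irregular block is at least \<epsilon>^2 |U'|
  |W'|, hence at least \<epsilon>^4 |U| |W|.\<close>

lemma energy_increment:
  assumes R: "R \<subseteq> V \<times> V" and FG: "F \<subseteq> G" and \<epsilon>: "\<epsilon> > 0"
    and wit: "\<And>U W. U \<in> atom F ` V \<Longrightarrow> W \<in> atom F ` V \<Longrightarrow> irregular \<epsilon> R U W \<Longrightarrow>
      \<exists>U'\<in>G. \<exists>W'\<in>G. U' \<subseteq> U \<and> W' \<subseteq> W \<and> real (card U') \<ge> \<epsilon> * card U \<and> real (card W') \<ge> \<epsilon> * card W \<and>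
       \<bar>edge_count R U' W' - density R U W * (real (card U') * real (card W'))\<bar>
         > \<epsilon> * (real (card U') * real (card W'))"
  shows "energy R G \<ge> energy R F + \<epsilon> ^ 4 * card (irregular_pairs \<epsilon> R F)"
proof -
  let ?d = "\<lambda>p. block_density R G p - block_density R F p"
  let ?i = "\<lambda>p. irregular \<epsilon> R (atom F (fst p)) (atom F (snd p))"
  have "\<epsilon> ^ 4 * card (irregular_pairs \<epsilon> R F) = (\<Sum>p\<in>V \<times> V. if ?i p then \<epsilon> ^ 4 else 0)"
    using finite_V by (simp add: irregular_pairs_def sum.inter_filter[symmetric])
  also have "\<dots> = (\<Sum>(U, W)\<in>atom F ` V \<times> atom F ` V. \<Sum>p\<in>U \<times> W. if ?i p then \<epsilon> ^ 4 else 0)"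
    by (rule sum_blocks)
  also have "\<dots> \<le> (\<Sum>(U, W)\<in>atom F ` V \<times> atom F ` V. \<Sum>p\<in>U \<times> W. (?d p)\<^sup>2)"
  proof (intro sum_mono, clarify)
    fix u w assume uw: "u \<in> V" "w \<in> V"
    define U W where "U = atom F u" and "W = atom F w"
    have fin: "finite U" "finite W" by (auto simp: U_def W_def finite_atom)
    have at: "atom F (fst p) = U" "atom F (snd p) = W" if "p \<in> U \<times> W" for p
      using that atom_eq by (auto simp: U_def W_def)
    show "(\<Sum>p\<in>U \<times> W. if ?i p then \<epsilon> ^ 4 else 0) \<le> (\<Sum>p\<in>U \<times> W. (?d p)\<^sup>2)"
    proof (cases "irregular \<epsilon> R U W")
      case False
      then have "(\<Sum>p\<in>U \<times> W. if ?i p then \<epsilon> ^ 4 else 0) = 0"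
        using at by (intro sum.neutral) simp
      then show ?thesis by (simp add: sum_nonneg)
    next
      case True
      then obtain U' W' where w: "U' \<in> G" "W' \<in> G" "U' \<subseteq> U" "W' \<subseteq> W"
        "real (card U') \<ge> \<epsilon> * card U" "real (card W') \<ge> \<epsilon> * card W"
        "\<bar>edge_count R U' W' - density R U W * (real (card U') * real (card W'))\<bar>
         > \<epsilon> * (real (card U') * real (card W'))"
        using wit[of U W] uw by (auto simp: U_def W_def)
      define N where "N = real (card U') * real (card W')"
      have sub: "U' \<times> W' \<subseteq> V \<times> V" using w(3,4) atom_subset by (fastforce simp: U_def W_def)
      have fin': "finite (U' \<times> W')" using w(3,4) fin finite_subset by blast
      have "(\<Sum>p\<in>U' \<times> W'. block_density R G p) = (\<Sum>p\<in>V \<times> V. (if p \<in> U' \<times> W' then 1 else 0) * block_density R G p)"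
      proof -
        have "(\<Sum>p\<in>V \<times> V. (if p \<in> U' \<times> W' then 1 else 0) * block_density R G p)
          = (\<Sum>p\<in>V \<times> V. if p \<in> U' \<times> W' then block_density R G p else 0)"
          by (intro sum.cong) auto
        also have "\<dots> = (\<Sum>p\<in>(V \<times> V) \<inter> (U' \<times> W'). block_density R G p)"
          using finite_V by (intro sum.inter_restrict[symmetric]) auto
        finally show ?thesis by (simp only: Int_absorb1[OF sub])
      qed
      also have "\<dots> = (\<Sum>p\<in>R. if p \<in> U' \<times> W' then 1 else 0)"
        using atom_member[OF w(1)] atom_member[OF w(2)] by (intro sum_block_density[OF R]) simp
      also have "\<dots> = edge_count R U' W'"
      proof -
        have "finite R" using R finite_V by (meson finite_SigmaI finite_subset)
        then show ?thesis by (simp add: edge_count_def sum.inter_restrict[symmetric])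
      qed
      finally have sG: "(\<Sum>p\<in>U' \<times> W'. block_density R G p) = edge_count R U' W'" .
      have "(\<Sum>p\<in>U' \<times> W'. block_density R F p) = (\<Sum>p\<in>U' \<times> W'. density R U W)"
        using at w(3,4) by (intro sum.cong refl) (simp add: block_density_def subset_iff mem_Times_iff)
      then have sF: "(\<Sum>p\<in>U' \<times> W'. block_density R F p) = density R U W * N"
        by (simp add: N_def card_cartesian_product)
      have gt: "\<bar>\<Sum>p\<in>U' \<times> W'. ?d p\<bar> > \<epsilon> * N" using w(7) sG sF by (simp add: sum_subtractf N_def)
      have N: "N > 0"
      proof (rule ccontr)
        assume "\<not> N > 0"
        moreover have "N \<ge> 0" by (simp add: N_def)
        ultimately have "N = 0" by linarith
        then have "card (U' \<times> W') = 0" by (simp add: N_def card_cartesian_product)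
        then have "(\<Sum>p\<in>U' \<times> W'. ?d p) = 0" using fin' by (metis card_0_eq sum.empty)
        with gt \<open>N = 0\<close> show False by simp
      qed
      have "(\<epsilon> * N)\<^sup>2 \<le> \<bar>\<Sum>p\<in>U' \<times> W'. ?d p\<bar>\<^sup>2" using gt \<epsilon> N by (intro power_mono) auto
      also have "\<dots> \<le> (\<Sum>p\<in>U' \<times> W'. (?d p)\<^sup>2) * N"
        using sum_squared_le_card[of ?d "U' \<times> W'"] by (simp add: N_def card_cartesian_product)
      finally have "\<epsilon>\<^sup>2 * N * N \<le> (\<Sum>p\<in>U' \<times> W'. (?d p)\<^sup>2) * N"
        by (simp add: power2_eq_square mult_ac)
      then have lower: "\<epsilon>\<^sup>2 * N \<le> (\<Sum>p\<in>U' \<times> W'. (?d p)\<^sup>2)" using N by simp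
      have "(\<Sum>p\<in>U \<times> W. if ?i p then \<epsilon> ^ 4 else 0) \<le> (\<Sum>p\<in>U \<times> W. \<epsilon> ^ 4)"
        by (intro sum_mono) simp
      also have "\<dots> = \<epsilon>\<^sup>2 * ((\<epsilon> * card U) * (\<epsilon> * card W))"
        by (simp add: card_cartesian_product power2_eq_square power4_eq_xxxx)
      also have "\<dots> \<le> \<epsilon>\<^sup>2 * N"
        unfolding N_def using w(5,6) \<epsilon> by (intro mult_left_mono mult_mono) auto
      also note lower
      also have "(\<Sum>p\<in>U' \<times> W'. (?d p)\<^sup>2) \<le> (\<Sum>p\<in>U \<times> W. (?d p)\<^sup>2)"
        using fin w(3,4) by (intro sum_mono2) auto
      finally show ?thesis .
    qed
  qed
  also have "\<dots> = (\<Sum>p\<in>V \<times> V. (?d p)\<^sup>2)" by (rule sum_blocks[symmetric])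
  also have "\<dots> = energy R G - energy R F" by (rule energy_increment_eq[OF R FG])
  finally show ?thesis by simp
qed

text \<open>Two witness sets are added for every relation and every pair of parts, so that one
  refinement serves all relations at once.\<close>

lemma refine:
  assumes Rs: "finite Rs" "\<And>R. R \<in> Rs \<Longrightarrow> R \<subseteq> V \<times> V" and F: "finite F" and \<epsilon>: "\<epsilon> > 0"
  obtains G where "finite G" "F \<subseteq> G" "card G \<le> card F + 2 * card Rs * (2 ^ card F * 2 ^ card F)"
    "\<And>R. R \<in> Rs \<Longrightarrow> energy R G \<ge> energy R F + \<epsilon> ^ 4 * card (irregular_pairs \<epsilon> R F)"
proof -
  let ?P = "\<lambda>R U W U' W'. U' \<subseteq> U \<and> W' \<subseteq> W \<and> real (card U') \<ge> \<epsilon> * card U \<and> real (card W') \<ge> \<epsilon> * card W \<and>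
       \<bar>edge_count R U' W' - density R U W * (real (card U') * real (card W'))\<bar>
         > \<epsilon> * (real (card U') * real (card W'))"
  define Q where "Q = Rs \<times> (atom F ` V \<times> atom F ` V)"
  have "\<forall>q :: ('a \<times> 'a) set \<times> 'a set \<times> 'a set. \<exists>s :: 'a set \<times> 'a set. irregular \<epsilon> (fst q) (fst (snd q)) (snd (snd q)) \<longrightarrow>
      ?P (fst q) (fst (snd q)) (snd (snd q)) (fst s) (snd s)"
    by (auto simp: irregular_def)
  from choice[OF this] obtain s where s: "\<forall>q :: ('a \<times> 'a) set \<times> 'a set \<times> 'a set.
      irregular \<epsilon> (fst q) (fst (snd q)) (snd (snd q)) \<longrightarrow>
      ?P (fst q) (fst (snd q)) (snd (snd q)) (fst (s q)) (snd (s q))" by (rule exE)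
  \<comment> \<open>Where a pair is regular, \<open>s\<close> is unspecified; such sets only refine
    the partition further.\<close>
  define G where "G = F \<union> ((\<lambda>q. fst (s q)) ` Q \<union> (\<lambda>q. snd (s q)) ` Q)"
  have finQ: "finite Q" using Rs(1) finite_V by (simp add: Q_def)
  have "card Q = card Rs * (card (atom F ` V) * card (atom F ` V))"
    by (simp add: Q_def card_cartesian_product)
  also have "\<dots> \<le> card Rs * (2 ^ card F * 2 ^ card F)"
    using card_atoms[OF F] by (intro mult_le_mono) auto
  finally have cQ: "card Q \<le> card Rs * (2 ^ card F * 2 ^ card F)" .
  have "card G \<le> card F + (card ((\<lambda>q. fst (s q)) ` Q) + card ((\<lambda>q. snd (s q)) ` Q))"
    unfolding G_def by (meson add_left_mono card_Un_le order_trans)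
  also have "\<dots> \<le> card F + (card Q + card Q)"
    using finQ by (intro add_left_mono add_mono card_image_le)
  finally have cG: "card G \<le> card F + 2 * card Rs * (2 ^ card F * 2 ^ card F)" using cQ by simp
  show thesis
  proof
    show "finite G" using F finQ by (simp add: G_def)
    show "F \<subseteq> G" by (simp add: G_def)
    show "energy R G \<ge> energy R F + \<epsilon> ^ 4 * card (irregular_pairs \<epsilon> R F)" if R: "R \<in> Rs" for R
    proof (intro energy_increment Rs(2) R \<open>F \<subseteq> G\<close> \<epsilon>)
      fix U W assume UW: "U \<in> atom F ` V" "W \<in> atom F ` V" "irregular \<epsilon> R U W"
      let ?q = "(R, U, W)"
      have "?q \<in> Q" using R UW by (simp add: Q_def)
      then have "fst (s ?q) \<in> G" "snd (s ?q) \<in> G" by (auto simp: G_def)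
      with spec[OF s, of ?q] UW(3) show "\<exists>U'\<in>G. \<exists>W'\<in>G. ?P R U W U' W'" by auto
    qed
  qed (rule cG)
qed

end

text \<open>Energy increment with the energies of all relations added up: as long as some relation
  has more than \<epsilon> |V|^2 irregular pairs, a refinement raises its energy by \<epsilon>^4
  times their number, and no other energy drops. The bound \<open>M\<close> is fixed before
  \<open>V\<close>, since each round enlarges the family by an amount that depends on
  \<open>r\<close> and \<open>M\<close> only.\<close>

lemma regular_family_or_energy:
  fixes \<epsilon> :: real
  assumes \<epsilon>: "\<epsilon> > 0"
  shows "\<exists>M. \<forall>(V :: 'a set) Rs. finite V \<and> finite Rs \<and> card Rs \<le> r \<and> (\<forall>R\<in>Rs. R \<subseteq> V \<times> V) \<longrightarrow>
    (\<exists>F. finite F \<and> card F \<le> M \<and>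
      ((\<forall>R\<in>Rs. real (card (finite_vertices.irregular_pairs V \<epsilon> R F)) \<le> \<epsilon> * (real (card V))\<^sup>2) \<or>
       (\<Sum>R\<in>Rs. finite_vertices.energy V R F) \<ge> real k * (\<epsilon> ^ 5 * (real (card V))\<^sup>2)))"
proof (induction k)
  case 0
  show ?case
  proof (intro exI[of _ 0] allI impI)
    fix V :: "'a set" and Rs assume "finite V \<and> finite Rs \<and> card Rs \<le> r \<and> (\<forall>R\<in>Rs. R \<subseteq> V \<times> V)"
    then interpret finite_vertices V by unfold_locales simp
    show "\<exists>F. finite F \<and> card F \<le> 0 \<and>
      ((\<forall>R\<in>Rs. real (card (irregular_pairs \<epsilon> R F)) \<le> \<epsilon> * (real (card V))\<^sup>2) \<or>
       (\<Sum>R\<in>Rs. energy R F) \<ge> real 0 * (\<epsilon> ^ 5 * (real (card V))\<^sup>2))"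
      using energy_bounds(1) by (intro exI[of _ "{}"]) (auto intro!: sum_nonneg)
  qed
next
  case (Suc k)
  then obtain M where M: "\<And>(V :: 'a set) Rs. finite V \<and> finite Rs \<and> card Rs \<le> r \<and> (\<forall>R\<in>Rs. R \<subseteq> V \<times> V) \<Longrightarrow>
    (\<exists>F. finite F \<and> card F \<le> M \<and>
      ((\<forall>R\<in>Rs. real (card (finite_vertices.irregular_pairs V \<epsilon> R F)) \<le> \<epsilon> * (real (card V))\<^sup>2) \<or>
       (\<Sum>R\<in>Rs. finite_vertices.energy V R F) \<ge> real k * (\<epsilon> ^ 5 * (real (card V))\<^sup>2)))"
    by blast
  let ?M = "M + 2 * r * (2 ^ M * 2 ^ M)"
  show ?case
  proof (intro exI[of _ ?M] allI impI)
    fix V :: "'a set" and Rs assume prem: "finite V \<and> finite Rs \<and> card Rs \<le> r \<and> (\<forall>R\<in>Rs. R \<subseteq> V \<times> V)"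
    then interpret finite_vertices V by unfold_locales simp
    obtain F where F: "finite F" "card F \<le> M"
      "(\<forall>R\<in>Rs. real (card (irregular_pairs \<epsilon> R F)) \<le> \<epsilon> * (real (card V))\<^sup>2) \<or>
       (\<Sum>R\<in>Rs. energy R F) \<ge> real k * (\<epsilon> ^ 5 * (real (card V))\<^sup>2)"
      using M[OF prem] by blast
    show "\<exists>F. finite F \<and> card F \<le> ?M \<and>
      ((\<forall>R\<in>Rs. real (card (irregular_pairs \<epsilon> R F)) \<le> \<epsilon> * (real (card V))\<^sup>2) \<or>
       (\<Sum>R\<in>Rs. energy R F) \<ge> real (Suc k) * (\<epsilon> ^ 5 * (real (card V))\<^sup>2))"
    proof (cases "\<forall>R\<in>Rs. real (card (irregular_pairs \<epsilon> R F)) \<le> \<epsilon> * (real (card V))\<^sup>2")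
      case True
      with F show ?thesis by (intro exI[of _ F]) auto
    next
      case False
      then obtain R0 where R0: "R0 \<in> Rs" "real (card (irregular_pairs \<epsilon> R0 F)) > \<epsilon> * (real (card V))\<^sup>2"
        by auto
      obtain G where G: "finite G" "F \<subseteq> G" "card G \<le> card F + 2 * card Rs * (2 ^ card F * 2 ^ card F)"
        "\<And>R. R \<in> Rs \<Longrightarrow> energy R G \<ge> energy R F + \<epsilon> ^ 4 * card (irregular_pairs \<epsilon> R F)"
        by (rule refine[of Rs F \<epsilon>]) (use prem F \<epsilon> in auto)
      have "card G \<le> ?M"
        using F(2) prem G(3) by (elim order_trans) (intro add_mono mult_mono power_increasing; simp)
      moreover have "(\<Sum>R\<in>Rs. energy R G) \<ge> real (Suc k) * (\<epsilon> ^ 5 * (real (card V))\<^sup>2)"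
      proof -
        have "\<epsilon> ^ 5 * (real (card V))\<^sup>2 = \<epsilon> ^ 4 * (\<epsilon> * (real (card V))\<^sup>2)" by (simp add: eval_nat_numeral)
        also have "\<dots> \<le> \<epsilon> ^ 4 * card (irregular_pairs \<epsilon> R0 F)"
          using R0(2) \<epsilon> by (intro mult_left_mono) auto
        also have "\<dots> \<le> (\<Sum>R\<in>Rs. \<epsilon> ^ 4 * card (irregular_pairs \<epsilon> R F))"
          using R0(1) prem \<epsilon> by (intro member_le_sum) auto
        finally have "\<epsilon> ^ 5 * (real (card V))\<^sup>2 \<le> (\<Sum>R\<in>Rs. \<epsilon> ^ 4 * card (irregular_pairs \<epsilon> R F))" .
        moreover have "(\<Sum>R\<in>Rs. energy R G) \<ge> (\<Sum>R\<in>Rs. energy R F + \<epsilon> ^ 4 * card (irregular_pairs \<epsilon> R F))"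
          by (intro sum_mono G(4))
        moreover have "(\<Sum>R\<in>Rs. energy R F) \<ge> real k * (\<epsilon> ^ 5 * (real (card V))\<^sup>2)"
          using F(3) False by blast
        ultimately show ?thesis by (simp add: sum.distrib distrib_right)
      qed
      ultimately show ?thesis using G(1) by (intro exI[of _ G]) auto
    qed
  qed
qed

text \<open>Every energy is at most |V|^2, so for k > r / \<epsilon>^5 the second alternative of
  \<open>regular_family_or_energy\<close> is impossible. Empty \<open>V\<close> is treated apart
  because this comparison has to be strict.\<close>

theorem regularity:
  fixes \<epsilon> :: real
  assumes \<epsilon>: "\<epsilon> > 0"
  obtains M where "\<And>(V :: 'a set) Rs. finite V \<Longrightarrow> finite Rs \<Longrightarrow> card Rs \<le> r \<Longrightarrow> (\<And>R. R \<in> Rs \<Longrightarrow> R \<subseteq> V \<times> V) \<Longrightarrow>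
    \<exists>F. finite F \<and> card F \<le> M \<and>
      (\<forall>R\<in>Rs. real (card (finite_vertices.irregular_pairs V \<epsilon> R F)) \<le> \<epsilon> * (real (card V))\<^sup>2)"
proof -
  obtain k :: nat where "real r / \<epsilon> ^ 5 < real k" using reals_Archimedean2 by blast
  then have k: "real r < real k * \<epsilon> ^ 5" using \<epsilon> by (simp add: divide_less_eq)
  obtain M where M: "\<And>(V :: 'a set) Rs. finite V \<and> finite Rs \<and> card Rs \<le> r \<and> (\<forall>R\<in>Rs. R \<subseteq> V \<times> V) \<Longrightarrow>
    (\<exists>F. finite F \<and> card F \<le> M \<and>
      ((\<forall>R\<in>Rs. real (card (finite_vertices.irregular_pairs V \<epsilon> R F)) \<le> \<epsilon> * (real (card V))\<^sup>2) \<or>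
       (\<Sum>R\<in>Rs. finite_vertices.energy V R F) \<ge> real k * (\<epsilon> ^ 5 * (real (card V))\<^sup>2)))"
    using regular_family_or_energy[OF \<epsilon>, of r k] by blast
  show thesis
  proof (rule that[of M])
    fix V :: "'a set" and Rs
    assume prem: "finite V" "finite Rs" "card Rs \<le> r" "\<And>R. R \<in> Rs \<Longrightarrow> R \<subseteq> V \<times> V"
    then interpret finite_vertices V by unfold_locales
    obtain F where F: "finite F" "card F \<le> M"
      "(\<forall>R\<in>Rs. real (card (irregular_pairs \<epsilon> R F)) \<le> \<epsilon> * (real (card V))\<^sup>2) \<or>
       (\<Sum>R\<in>Rs. energy R F) \<ge> real k * (\<epsilon> ^ 5 * (real (card V))\<^sup>2)"
      using M[of V Rs] prem by blast
    have "\<forall>R\<in>Rs. real (card (irregular_pairs \<epsilon> R F)) \<le> \<epsilon> * (real (card V))\<^sup>2"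
    proof (cases "V = {}")
      case True
      have "irregular_pairs \<epsilon> R F = {}" for R unfolding irregular_pairs_def using True by auto
      with \<epsilon> show ?thesis by simp
    next
      case False
      then have V: "(real (card V))\<^sup>2 > 0" using prem(1) by (simp add: card_gt_0_iff)
      have "(\<Sum>R\<in>Rs. energy R F) \<le> (\<Sum>R\<in>Rs. (real (card V))\<^sup>2)" by (intro sum_mono energy_bounds)
      also have "\<dots> \<le> real r * (real (card V))\<^sup>2" using prem(3) by (simp add: mult_right_mono)
      also have "\<dots> < real k * \<epsilon> ^ 5 * (real (card V))\<^sup>2" using k V by (intro mult_strict_right_mono)
      finally show ?thesis using F(3) by (simp add: mult_ac)
    qed
    with F show "\<exists>F. finite F \<and> card F \<le> M \<and>
      (\<forall>R\<in>Rs. real (card (irregular_pairs \<epsilon> R F)) \<le> \<epsilon> * (real (card V))\<^sup>2)" by blast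
  qed
qed

section \<open>The triangle removal lemma\<close>

definition rel_triangles :: "('a \<times> 'a) set \<Rightarrow> ('a \<times> 'a) set \<Rightarrow> ('a \<times> 'a) set \<Rightarrow> ('a \<times> 'a \<times> 'a) set" where
  "rel_triangles X Y Z = {(u, v, w). (u, v) \<in> X \<and> (v, w) \<in> Y \<and> (w, u) \<in> Z}"

context finite_vertices
begin

definition small :: "real \<Rightarrow> 'a set set \<Rightarrow> 'a set" where
  "small s F = {u\<in>V. real (card (atom F u)) < s}"

definition cleaned :: "real \<Rightarrow> real \<Rightarrow> 'a set set \<Rightarrow> ('a \<times> 'a) set \<Rightarrow> ('a \<times> 'a) set" where
  "cleaned \<epsilon> s F R = R \<inter> (irregular_pairs \<epsilon> R F \<union> {p. block_density R F p < 2 * \<epsilon>}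
     \<union> (small s F \<times> V \<union> V \<times> small s F))"

text \<open>5 is 1 + 2 + 2: irregular pairs; arcs in sparse blocks, whose number is a sum of small
  densities by \<open>sum_block_density\<close>; pairs with their first or their second vertex in a
  small part. At most \<open>2 ^ card F\<close> small parts have fewer than \<open>s\<close>
  vertices each.\<close>

lemma card_cleaned:
  assumes R: "R \<subseteq> V \<times> V" and reg: "real (card (irregular_pairs \<epsilon> R F)) \<le> \<epsilon> * (real (card V))\<^sup>2"
    and F: "finite F" "2 ^ card F * s \<le> \<epsilon> * card V" and \<epsilon>: "0 < \<epsilon>" "0 \<le> s"
  shows "real (card (cleaned \<epsilon> s F R)) \<le> 5 * \<epsilon> * (real (card V))\<^sup>2"
proof -
  have finR: "finite R" using R finite_V by (meson finite_SigmaI finite_subset)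
  let ?D = "{p\<in>R. block_density R F p < 2 * \<epsilon>}"
  let ?h = "\<lambda>p. if block_density R F p < 2 * \<epsilon> then 1 else 0 :: real"
  have "real (card ?D) = (\<Sum>p\<in>R. ?h p)" using finR by (simp add: sum.inter_filter[symmetric])
  also have "\<dots> = (\<Sum>p\<in>V \<times> V. ?h p * block_density R F p)"
    using block_density_const[OF order_refl, of _ F]
    by (intro sum_block_density[OF R, symmetric]) simp
  also have "\<dots> \<le> (\<Sum>p\<in>V \<times> V. 2 * \<epsilon>)" using \<epsilon> by (intro sum_mono) auto
  also have "\<dots> = 2 * \<epsilon> * (real (card V))\<^sup>2" by (simp add: card_cartesian_product power2_eq_square)
  finally have D: "real (card ?D) \<le> 2 * \<epsilon> * (real (card V))\<^sup>2" .
  have "small s F \<subseteq> \<Union>{U\<in>atom F ` V. real (card U) < s}"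
    using atom_self by (auto simp: small_def)
  then have "card (small s F) \<le> card (\<Union>{U\<in>atom F ` V. real (card U) < s})"
    using finite_V finite_atom by (intro card_mono) auto
  also have "\<dots> \<le> (\<Sum>U\<in>{U\<in>atom F ` V. real (card U) < s}. card U)"
    by (rule card_Union_le_sum_card)
  finally have "real (card (small s F)) \<le> real (\<Sum>U\<in>{U\<in>atom F ` V. real (card U) < s}. card U)"
    by (rule of_nat_mono)
  also have "\<dots> = (\<Sum>U\<in>{U\<in>atom F ` V. real (card U) < s}. real (card U))" by simp
  also have "\<dots> \<le> (\<Sum>U\<in>{U\<in>atom F ` V. real (card U) < s}. s)" by (intro sum_mono) auto
  also have "\<dots> = real (card {U\<in>atom F ` V. real (card U) < s}) * s" by simp
  also have "\<dots> \<le> real (2 ^ card F) * s"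
  proof (intro mult_right_mono of_nat_mono)
    have "card {U\<in>atom F ` V. real (card U) < s} \<le> card (atom F ` V)"
      using finite_V by (intro card_mono) auto
    with card_atoms[OF F(1)] show "card {U\<in>atom F ` V. real (card U) < s} \<le> 2 ^ card F" by linarith
  qed (rule \<epsilon>)
  finally have small: "real (card (small s F)) \<le> \<epsilon> * card V" using F(2) by simp
  have fins: "finite (small s F)" using finite_V by (simp add: small_def)
  have finI: "finite (irregular_pairs \<epsilon> R F)" using finite_V by (simp add: irregular_pairs_def)
  have "card (cleaned \<epsilon> s F R) \<le> card ((irregular_pairs \<epsilon> R F \<union> ?D) \<union> (small s F \<times> V \<union> V \<times> small s F))"
    using finI finR fins finite_V by (intro card_mono) (auto simp: cleaned_def)
  also have "\<dots> \<le> (card (irregular_pairs \<epsilon> R F) + card ?D) + (card (small s F \<times> V) + card (V \<times> small s F))"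
    using card_Un_le[of "irregular_pairs \<epsilon> R F \<union> ?D" "small s F \<times> V \<union> V \<times> small s F"]
      card_Un_le[of "irregular_pairs \<epsilon> R F" ?D] card_Un_le[of "small s F \<times> V" "V \<times> small s F"] by linarith
  finally have "real (card (cleaned \<epsilon> s F R)) \<le> real (card (irregular_pairs \<epsilon> R F)) + real (card ?D)
     + 2 * (real (card (small s F)) * real (card V))"
    by (simp add: card_cartesian_product mult.commute flip: of_nat_add of_nat_mult)
  moreover have "real (card (small s F)) * real (card V) \<le> \<epsilon> * card V * real (card V)"
    using small by (intro mult_right_mono) auto
  ultimately show ?thesis using reg D by (simp add: power2_eq_square)
qed

lemma not_cleanedD:
  assumes "(u, v) \<in> R - cleaned \<epsilon> s F R" "R \<subseteq> V \<times> V"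
  shows "u \<in> V" "v \<in> V" "\<not> irregular \<epsilon> R (atom F u) (atom F v)"
    "density R (atom F u) (atom F v) \<ge> 2 * \<epsilon>" "real (card (atom F u)) \<ge> s"
  using assms by (auto simp: cleaned_def irregular_pairs_def block_density_def small_def)

end

theorem triangle_removal:
  fixes \<delta> :: real
  assumes "\<delta> > 0"
  obtains \<gamma> where "\<gamma> > 0"
    "\<And>(V :: 'a set) X Y Z. finite V \<Longrightarrow> X \<subseteq> V \<times> V \<Longrightarrow> Y \<subseteq> V \<times> V \<Longrightarrow> Z \<subseteq> V \<times> V \<Longrightarrow>
      real (card (rel_triangles X Y Z)) \<le> \<gamma> * (real (card V)) ^ 3 \<Longrightarrow>
      \<exists>S. real (card S) \<le> \<delta> * (real (card V))\<^sup>2 \<and> S \<subseteq> V \<times> V \<and> rel_triangles (X - S) (Y - S) (Z - S) = {}"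
proof -
  \<comment> \<open>15 is three relations times the 5 of \<open>card_cleaned\<close>; the bound 1/4
    keeps \<open>1 - 2 * \<epsilon>\<close> at least 1/2.\<close>
  define \<epsilon> where "\<epsilon> = min (1/4) (\<delta> / 15)"
  have \<epsilon>: "0 < \<epsilon>" "\<epsilon> \<le> 1/4" "15 * \<epsilon> \<le> \<delta>" using assms by (auto simp: \<epsilon>_def)
  obtain M where M: "\<And>(V :: 'a set) Rs. finite V \<Longrightarrow> finite Rs \<Longrightarrow> card Rs \<le> 3 \<Longrightarrow> (\<And>R. R \<in> Rs \<Longrightarrow> R \<subseteq> V \<times> V) \<Longrightarrow>
    \<exists>F. finite F \<and> card F \<le> M \<and>
      (\<forall>R\<in>Rs. real (card (finite_vertices.irregular_pairs V \<epsilon> R F)) \<le> \<epsilon> * (real (card V))\<^sup>2)"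
    using regularity[OF \<epsilon>(1), of 3] by blast
  define \<sigma> where "\<sigma> = \<epsilon> / 2 ^ M"
  have \<sigma>: "\<sigma> > 0" using \<epsilon> by (simp add: \<sigma>_def)
  \<comment> \<open>\<open>triangle_counting\<close> will yield the coefficient
    \<open>\<epsilon> ^ 3 * \<sigma> ^ 3 / 2\<close>; half of it makes the contradiction
    strict.\<close>
  define \<gamma> where "\<gamma> = \<epsilon> ^ 3 * \<sigma> ^ 3 / 4"
  have \<gamma>: "\<gamma> > 0" using \<epsilon> \<sigma> by (simp add: \<gamma>_def)
  show thesis
  proof (rule that[OF \<gamma>])
    fix V :: "'a set" and X Y Z
    assume V: "finite V" and XYZ: "X \<subseteq> V \<times> V" "Y \<subseteq> V \<times> V" "Z \<subseteq> V \<times> V"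
      and few: "real (card (rel_triangles X Y Z)) \<le> \<gamma> * (real (card V)) ^ 3"
    interpret finite_vertices V using V by unfold_locales
    have c3: "card {X, Y, Z} \<le> 3" by (simp add: card_insert_if)
    have "\<exists>F. finite F \<and> card F \<le> M \<and>
        (\<forall>R\<in>{X, Y, Z}. real (card (irregular_pairs \<epsilon> R F)) \<le> \<epsilon> * (real (card V))\<^sup>2)"
      by (rule M[OF V _ c3]) (use XYZ in auto)
    then obtain F where F: "finite F" "card F \<le> M"
      "\<forall>R\<in>{X, Y, Z}. real (card (irregular_pairs \<epsilon> R F)) \<le> \<epsilon> * (real (card V))\<^sup>2"
      by (elim exE conjE) (rule that)
    define s where "s = \<sigma> * card V"
    have s0: "0 \<le> s" using \<sigma> by (simp add: s_def)
    have "2 ^ card F * s \<le> 2 ^ M * s" using F(2) s0 by (intro mult_right_mono power_increasing) auto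
    also have "\<dots> = \<epsilon> * card V" by (simp add: s_def \<sigma>_def)
    finally have Fs: "2 ^ card F * s \<le> \<epsilon> * card V" .
    define S where "S = cleaned \<epsilon> s F X \<union> cleaned \<epsilon> s F Y \<union> cleaned \<epsilon> s F Z"
    have "card S \<le> card (cleaned \<epsilon> s F X) + card (cleaned \<epsilon> s F Y) + card (cleaned \<epsilon> s F Z)"
      using card_Un_le[of "cleaned \<epsilon> s F X \<union> cleaned \<epsilon> s F Y" "cleaned \<epsilon> s F Z"]
        card_Un_le[of "cleaned \<epsilon> s F X" "cleaned \<epsilon> s F Y"] unfolding S_def by linarith
    then have cS: "real (card S) \<le> real (card (cleaned \<epsilon> s F X)) + real (card (cleaned \<epsilon> s F Y)) + real (card (cleaned \<epsilon> s F Z))"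
      by linarith
    have cl: "real (card (cleaned \<epsilon> s F R)) \<le> 5 * \<epsilon> * (real (card V))\<^sup>2" if "R \<in> {X, Y, Z}" for R
      using that XYZ F(3) by (intro card_cleaned F(1) Fs \<epsilon>(1) s0) auto
    have "real (card S) \<le> 15 * \<epsilon> * (real (card V))\<^sup>2"
      using cS cl[OF insertI1] cl[OF insertI2[OF insertI1]] cl[OF insertI2[OF insertI2[OF singletonI]]] by linarith
    also have "\<dots> \<le> \<delta> * (real (card V))\<^sup>2" using \<epsilon>(3) by (intro mult_right_mono) auto
    finally have cS: "real (card S) \<le> \<delta> * (real (card V))\<^sup>2" .
    have "rel_triangles (X - S) (Y - S) (Z - S) = {}"
    proof (rule ccontr)
      assume "rel_triangles (X - S) (Y - S) (Z - S) \<noteq> {}"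
      then obtain u v w where "(u, v) \<in> X - S" "(v, w) \<in> Y - S" "(w, u) \<in> Z - S"
        by (auto simp: rel_triangles_def)
      then have uvw: "(u, v) \<in> X - cleaned \<epsilon> s F X" "(v, w) \<in> Y - cleaned \<epsilon> s F Y" "(w, u) \<in> Z - cleaned \<epsilon> s F Z"
        by (auto simp: S_def)
      note D = not_cleanedD[OF uvw(1) XYZ(1)] not_cleanedD[OF uvw(2) XYZ(2)] not_cleanedD[OF uvw(3) XYZ(3)]
      have ne: "atom F x \<noteq> {}" if "x \<in> V" for x using atom_self[OF that] by blast
      let ?T = "{(x, y, z). x \<in> atom F u \<and> y \<in> atom F v \<and> z \<in> atom F w \<and> (x, y) \<in> X \<and> (y, z) \<in> Y \<and> (z, x) \<in> Z}"
      have V0: "real (card V) > 0" using D(1) V by (auto simp: card_gt_0_iff)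
      have fin: "finite (rel_triangles X Y Z)"
      proof (rule finite_subset)
        show "rel_triangles X Y Z \<subseteq> V \<times> V \<times> V" using XYZ by (auto simp: rel_triangles_def)
      qed (use V in simp)
      have "\<epsilon> ^ 3 * \<sigma> ^ 3 / 4 * real (card V) ^ 3 < (1/2) * \<epsilon> ^ 3 * (s * s * s)"
        using \<epsilon> \<sigma> V0 by (simp add: s_def power3_eq_cube)
      also have "\<dots> \<le> (1 - 2 * \<epsilon>) * \<epsilon> ^ 3 * (real (card (atom F u)) * real (card (atom F v)) * real (card (atom F w)))"
        using D \<epsilon> s0 by (intro mult_mono) auto
      also have "\<dots> \<le> real (card ?T)"
        using D \<epsilon> ne by (intro triangle_counting finite_atom) auto
      also have "\<dots> \<le> real (card (rel_triangles X Y Z))"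
        using fin by (intro of_nat_mono card_mono) (auto simp: rel_triangles_def)
      finally show False using few by (simp add: \<gamma>_def)
    qed
    moreover have "S \<subseteq> V \<times> V" using XYZ by (auto simp: S_def cleaned_def)
    ultimately show "\<exists>S. real (card S) \<le> \<delta> * (real (card V))\<^sup>2 \<and> S \<subseteq> V \<times> V \<and> rel_triangles (X - S) (Y - S) (Z - S) = {}"
      using cS by blast
  qed
qed

section \<open>Rounding fractional covers\<close>

definition arc_triangles :: "('a \<times> 'a) set \<Rightarrow> ('a \<times> 'a) set set" where
  "arc_triangles E =
     {{(u, v), (v, w), (w, u)} | u v w. distinct [u, v, w] \<and> {(u, v), (v, w), (w, u)} \<subseteq> E}"

lemma arc_trianglesE:
  assumes "T \<in> arc_triangles E"
  obtains u v w where "T = {(u, v), (v, w), (w, u)}" "u \<noteq> v" "v \<noteq> w" "w \<noteq> u"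
    "(u, v) \<in> E" "(v, w) \<in> E" "(w, u) \<in> E"
  using assms unfolding arc_triangles_def by auto

lemma arc_trianglesI:
  assumes "u \<noteq> v" "v \<noteq> w" "w \<noteq> u" "(u, v) \<in> E" "(v, w) \<in> E" "(w, u) \<in> E"
  shows "{(u, v), (v, w), (w, u)} \<in> arc_triangles E"
  unfolding arc_triangles_def using assms
  by (intro CollectI exI[of _ u] exI[of _ v] exI[of _ w]) simp

lemma arc_triangles_Diff: "arc_triangles (E - S) = {T \<in> arc_triangles E. T \<inter> S = {}}"
proof (intro subset_antisym subsetI)
  fix T assume "T \<in> arc_triangles (E - S)"
  then show "T \<in> {T \<in> arc_triangles E. T \<inter> S = {}}"
    by (rule arc_trianglesE) (simp add: arc_trianglesI)
next
  fix T assume "T \<in> {T \<in> arc_triangles E. T \<inter> S = {}}"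
  then have T: "T \<in> arc_triangles E" "T \<inter> S = {}" by auto
  from T(1) show "T \<in> arc_triangles (E - S)"
    by (rule arc_trianglesE) (use T(2) in \<open>simp add: arc_trianglesI\<close>)
qed

lemma arc_triangle_subset: "T \<in> arc_triangles E \<Longrightarrow> T \<subseteq> E"
  by (auto elim: arc_trianglesE)

lemma finite_arc_triangles: "finite E \<Longrightarrow> finite (arc_triangles E)"
  by (rule finite_subset[of _ "Pow E"]) (auto dest: arc_triangle_subset)

lemma card_arc_triangle: "T \<in> arc_triangles E \<Longrightarrow> card T = 3"
  by (auto elim!: arc_trianglesE)

text \<open>Any two arcs of a directed triangle are consecutive, so they fix its vertices and its
  orientation. Hence triangles sharing two arcs coincide.\<close>

lemma arc_triangle_two_arcs:
  assumes "T \<in> arc_triangles E" "e \<in> T" "e' \<in> T" "e \<noteq> e'"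
  shows "snd e = fst e' \<and> snd e' \<noteq> fst e \<and> T = {e, e', (snd e', fst e)} \<or>
    snd e' = fst e \<and> snd e \<noteq> fst e' \<and> T = {e', e, (snd e, fst e')}"
proof -
  obtain u v w where T: "T = {(u, v), (v, w), (w, u)}" "u \<noteq> v" "v \<noteq> w" "w \<noteq> u"
    using assms(1) by (rule arc_trianglesE)
  have rot: "T = {(v, w), (w, u), (u, v)}" "T = {(w, u), (u, v), (v, w)}"
    unfolding T by blast+
  consider "e = (u, v)" "e' = (v, w)" | "e = (v, w)" "e' = (w, u)" | "e = (w, u)" "e' = (u, v)"
    | "e' = (u, v)" "e = (v, w)" | "e' = (v, w)" "e = (w, u)" | "e' = (w, u)" "e = (u, v)"
    using assms(2-4) unfolding T(1) by blast
  then show ?thesis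
    by cases (use T rot in simp_all)
qed

lemma arc_triangles_linear:
  assumes "S \<in> arc_triangles E" "T \<in> arc_triangles E" "S \<noteq> T"
  shows "card (S \<inter> T) \<le> 1"
proof -
  have "e = e'" if "e \<in> S \<inter> T" "e' \<in> S \<inter> T" for e e'
    using arc_triangle_two_arcs[OF assms(1), of e e'] arc_triangle_two_arcs[OF assms(2), of e e']
      that assms(3) by (metis IntD1 IntD2)
  moreover have "finite (S \<inter> T)"
    using card_arc_triangle[OF assms(1)] by (metis card.infinite finite_Int zero_neq_numeral)
  ultimately show ?thesis by (simp add: card_le_Suc0_iff_eq)
qed

text \<open>
  The vertices of \<open>A\<close> are those with bit 1; the linear order is the one induced by the ranking \<open>r\<close>.
\<close>

definition threshold :: "real \<Rightarrow> 'a set \<Rightarrow> ('a \<Rightarrow> int) \<Rightarrow> 'a \<Rightarrow> 'a \<Rightarrow> real" where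
  "threshold a A r u v =
     (if u \<in> A \<and> v \<notin> A then 1 - a
      else if u \<notin> A \<and> v \<in> A then 0
      else if r u < r v then a else 1 - 2 * a)"

lemma threshold_nonneg: "1/3 \<le> a \<Longrightarrow> a \<le> 1/2 \<Longrightarrow> threshold a A r u v \<ge> 0"
  by (simp add: threshold_def)

text \<open>If the bits differ, one arc leaves \<open>A\<close>, one enters it and the third joins
  equal bits: at most \<open>(1 - a) + 0 + a\<close>. If they agree, at most two arcs ascend in
  \<open>r\<close>, which gives at most \<open>2 * a + (1 - 2 * a)\<close>. Both use
  \<open>1 - 2 * a \<le> a\<close>.\<close>

lemma threshold_triangle:
  assumes "1/3 \<le> a" "a \<le> 1/2"
  shows "threshold a A r u v + threshold a A r v w + threshold a A r w u \<le> 1"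
  using assms unfolding threshold_def by (cases "u \<in> A"; cases "v \<in> A"; cases "w \<in> A") auto

definition hit :: "real \<Rightarrow> real \<Rightarrow> real" where
  "hit t x = (if t \<le> x then 1 else 0)"

text \<open>The condition \<open>w (u, v) > 0\<close> matters since thresholds may be 0: an arc of
  weight 0 need not be saturated, so its deletion could not be charged to the triangles through
  it.\<close>

definition deleted :: "('a \<times> 'a) set \<Rightarrow> ('a \<times> 'a \<Rightarrow> real) \<Rightarrow> real \<Rightarrow> 'a set \<Rightarrow> ('a \<Rightarrow> int) \<Rightarrow> ('a \<times> 'a) set" where
  "deleted E w a A r = {(u, v) \<in> E. w (u, v) > 0 \<and> threshold a A r u v \<le> w (u, v)}"

text \<open>A surviving triangle would have weight at least 1 below thresholds of sum at most 1.
  Arcs of weight 0 give only a weak inequality, but one of the three weights is positive and makes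
  the sum strict.\<close>

lemma deleted_covers:
  assumes a: "1/3 \<le> a" "a \<le> 1/2"
    and w: "\<And>e. w e \<ge> 0" "\<And>T. T \<in> arc_triangles E \<Longrightarrow> (\<Sum>e\<in>T. w e) \<ge> 1"
  shows "arc_triangles (E - deleted E w a A r) = {}"
proof (rule ccontr)
  assume "arc_triangles (E - deleted E w a A r) \<noteq> {}"
  then obtain T where T: "T \<in> arc_triangles (E - deleted E w a A r)" by blast
  then obtain x y z where xyz: "T = {(x, y), (y, z), (z, x)}" "x \<noteq> y" "y \<noteq> z" "z \<noteq> x"
    "(x, y) \<in> E - deleted E w a A r" "(y, z) \<in> E - deleted E w a A r" "(z, x) \<in> E - deleted E w a A r"
    by (rule arc_trianglesE)
  have "T \<in> arc_triangles E" using T by (auto simp: arc_triangles_Diff)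
  with w(2) have "(\<Sum>e\<in>T. w e) \<ge> 1" by blast
  then have sum: "w (x, y) + w (y, z) + w (z, x) \<ge> 1" using xyz by simp
  have lt: "w (u, v) = 0 \<or> w (u, v) < threshold a A r u v" if "(u, v) \<in> E - deleted E w a A r" for u v
    using that w(1)[of "(u, v)"] by (auto simp: deleted_def)
  show False
    using sum lt[OF xyz(5)] lt[OF xyz(6)] lt[OF xyz(7)] threshold_triangle[OF a, of A r x y z]
      threshold_nonneg[OF a, of A r x y] threshold_nonneg[OF a, of A r y z] threshold_nonneg[OF a, of A r z x]
    by linarith
qed

section \<open>The expected number of deleted arcs\<close>

lemma sum_Pow_two_points:
  fixes g :: "bool \<Rightarrow> bool \<Rightarrow> real"
  assumes "finite V" "u \<in> V" "v \<in> V" "u \<noteq> v"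
  shows "(\<Sum>A\<in>Pow V. g (u \<in> A) (v \<in> A)) =
    2 ^ card V / 4 * (g True True + g True False + g False True + g False False)"
proof -
  define W where "W = V - {u, v}"
  have V: "V = insert u (insert v W)" and W: "finite W" "u \<notin> W" "v \<notin> W" "u \<notin> insert v W"
    using assms by (auto simp: W_def)
  have c: "card V = Suc (Suc (card W))" unfolding V using W by simp
  have two: "(\<Sum>A\<in>Pow (insert x U). k A) = (\<Sum>A\<in>Pow U. k A + k (insert x A))"
    if "finite U" "x \<notin> U" for x U and k :: "'a set \<Rightarrow> real"
  proof -
    have "inj_on (insert x) (Pow U)" using that by (auto simp: inj_on_def)
    moreover have "Pow U \<inter> insert x ` Pow U = {}" using that by auto
    ultimately show ?thesis
      using that by (simp add: Pow_insert sum.union_disjoint sum.reindex sum.distrib)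
  qed
  have "(\<Sum>A\<in>Pow V. g (u \<in> A) (v \<in> A)) =
      (\<Sum>A\<in>Pow W. g False False + g False True + (g True False + g True True))"
  proof -
    have "u \<notin> A" "v \<notin> A" if "A \<in> Pow W" for A using that W by auto
    then show ?thesis
      unfolding V using W assms(4) by (simp add: two del: Pow_iff cong: sum.cong)
  qed
  also have "\<dots> = 2 ^ card W * (g True True + g True False + g False True + g False False)"
    using W by (simp add: card_Pow)
  finally show ?thesis by (simp add: c)
qed

text \<open>Four times the probability that an arc of weight \<open>x > 0\<close> is deleted: with
  random bits and a random choice between an order and its reverse, the thresholds 0,
  \<open>1 - 2 * a\<close>, \<open>a\<close> and \<open>1 - a\<close> are equally likely.\<close>

definition hits :: "real \<Rightarrow> real \<Rightarrow> real" where
  "hits a x = 1 + hit (1 - 2 * a) x + hit a x + hit (1 - a) x"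

lemma sum_hit_threshold:
  assumes "finite V" "u \<in> V" "v \<in> V" "u \<noteq> v" "r u \<noteq> r v" "x > 0"
  shows "(\<Sum>A\<in>Pow V. hit (threshold a A r u v) x + hit (threshold a A (\<lambda>y. - r y) u v) x)
    = 2 ^ card V / 2 * hits a x"
proof -
  define g where "g = (\<lambda>p q. if p \<and> \<not> q then 2 * hit (1 - a) x else if \<not> p \<and> q then 2
     else hit a x + hit (1 - 2 * a) x)"
  have "hit (threshold a A r u v) x + hit (threshold a A (\<lambda>y. - r y) u v) x = g (u \<in> A) (v \<in> A)" for A
    using assms by (auto simp: g_def threshold_def hit_def)
  then have "(\<Sum>A\<in>Pow V. hit (threshold a A r u v) x + hit (threshold a A (\<lambda>y. - r y) u v) x)
    = (\<Sum>A\<in>Pow V. g (u \<in> A) (v \<in> A))" by simp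
  also have "\<dots> = 2 ^ card V / 2 * hits a x"
    using assms by (subst sum_Pow_two_points) (auto simp: g_def hits_def algebra_simps)
  finally show ?thesis .
qed

lemma card_deleted:
  assumes "finite E"
  shows "real (card (deleted E w a A r)) =
    (\<Sum>e\<in>{e\<in>E. w e > 0}. hit (threshold a A r (fst e) (snd e)) (w e))"
proof -
  have "(\<Sum>e\<in>{e\<in>E. w e > 0}. hit (threshold a A r (fst e) (snd e)) (w e)) =
    (\<Sum>e\<in>{e\<in>{e\<in>E. w e > 0}. threshold a A r (fst e) (snd e) \<le> w e}. 1)"
    using assms unfolding hit_def by (subst sum.inter_filter) auto
  also have "{e\<in>{e\<in>E. w e > 0}. threshold a A r (fst e) (snd e) \<le> w e} = deleted E w a A r"
    by (auto simp: deleted_def)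
  finally show ?thesis by simp
qed

text \<open>
  The bound \<open>108\<close> in \<open>cost_triangle\<close> arises as \<open>7 * 15 + 3\<close>, where \<open>3\<close> is the rounding error of a grid of
  15 values of \<open>a\<close>; finer grids would improve the factor \<open>108 / (4 * 15) = 1.8\<close> to any number above 7/4.
\<close>

definition grid :: "nat \<Rightarrow> real" where "grid i = 1/3 + real i / 90"

definition cost :: "real \<Rightarrow> real" where "cost x = (\<Sum>i<15. hits (grid i) x)"

lemma card_ge_real_le:
  fixes t :: real
  assumes "t \<le> n"
  shows "real (card {i. i < n \<and> t \<le> real i}) \<le> real n - t"
proof (cases "t \<le> 0")
  case True
  have "real (card {i. i < n \<and> t \<le> real i}) \<le> real (card {..<n})"
    by (intro of_nat_mono card_mono) auto
  with True show ?thesis by simp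
next
  case False
  have "{i. i < n \<and> t \<le> real i} \<subseteq> {nat \<lceil>t\<rceil>..<n}"
    by (auto simp: nat_le_iff ceiling_le_iff)
  then have "card {i. i < n \<and> t \<le> real i} \<le> n - nat \<lceil>t\<rceil>"
    using card_mono[of "{nat \<lceil>t\<rceil>..<n}"] by simp
  moreover have "nat \<lceil>t\<rceil> \<le> n" using assms by (simp add: nat_le_iff ceiling_le_iff)
  moreover have "real (nat \<lceil>t\<rceil>) \<ge> t" by linarith
  ultimately show ?thesis by linarith
qed

text \<open>The index 0 counts as well, whence the extra 1; it is the only rounding loss in
  \<open>cost_bounds\<close>.\<close>

lemma card_le_real_le:
  fixes t :: real
  assumes "t \<ge> 0"
  shows "real (card {i. i < n \<and> real i \<le> t}) \<le> t + 1"
proof -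
  have "{i. i < n \<and> real i \<le> t} \<subseteq> {..nat \<lfloor>t\<rfloor>}"
    using assms by (auto simp: le_nat_iff le_floor_iff)
  then have "card {i. i < n \<and> real i \<le> t} \<le> Suc (nat \<lfloor>t\<rfloor>)"
    using card_mono[of "{..nat \<lfloor>t\<rfloor>}"] by simp
  then show ?thesis using assms by linarith
qed

lemma cost_eq:
  "cost x = 15 + real (card {i. i < 15 \<and> 15 - 45 * x \<le> real i})
     + real (card {i. i < 15 \<and> real i \<le> 90 * x - 30})
     + real (card {i. i < 15 \<and> 60 - 90 * x \<le> real i})"
proof -
  have count: "(\<Sum>i<15. (if P i then 1 else 0) :: real) = real (card {i. i < 15 \<and> P i})" for P :: "nat \<Rightarrow> bool"
    by (subst sum.inter_filter[symmetric]) (auto intro!: arg_cong[where f = card])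
  have "cost x = (\<Sum>i<15. 1 + (if 15 - 45 * x \<le> real i then 1 else 0)
      + (if real i \<le> 90 * x - 30 then 1 else 0) + (if 60 - 90 * x \<le> real i then 1 else 0))"
    unfolding cost_def hits_def hit_def grid_def
    by (intro sum.cong arg_cong2[where f = "(+)"] if_cong refl) (auto simp: field_simps)
  also have "\<dots> = 15 + real (card {i. i < 15 \<and> 15 - 45 * x \<le> real i})
     + real (card {i. i < 15 \<and> real i \<le> 90 * x - 30})
     + real (card {i. i < 15 \<and> 60 - 90 * x \<le> real i})"
    by (simp only: sum.distrib count) simp
  finally show ?thesis .
qed

text \<open>On the grid the thresholds \<open>1 - 2 * a\<close>, \<open>a\<close>,
  \<open>1 - a\<close> stay within (0, 1/3], [1/3, 1/2) and (1/2, 2/3]. So for every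
  \<open>x\<close> at most one of the three counts in \<open>cost_eq\<close> lies strictly between 0
  and 15, and only that one needs an estimate.\<close>

lemma cost_bounds:
  assumes "x > 0"
  shows "x < 1/3 \<Longrightarrow> cost x \<le> 15 + 45 * x"
    and "1/3 \<le> x \<Longrightarrow> x \<le> 2/3 \<Longrightarrow> cost x \<le> 90 * x + 1"
    and "cost x \<le> 60"
proof -
  have trivial: "real (card {i. i < (15::nat) \<and> P i}) \<le> 15" for P
  proof -
    have "card {i. i < (15::nat) \<and> P i} \<le> card {..<15::nat}" by (intro card_mono) auto
    then show ?thesis by simp
  qed
  have ge: "real (card {i. i < 15 \<and> 15 - 45 * x \<le> real i}) \<le> 45 * x"
    using card_ge_real_le[of "15 - 45 * x" 15] assms by simp
  show "cost x \<le> 15 + 45 * x" if "x < 1/3"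
  proof -
    have "{i. i < 15 \<and> real i \<le> 90 * x - 30} = {}" "{i. i < 15 \<and> 60 - 90 * x \<le> real i} = {}"
      using that by auto
    with ge show ?thesis by (simp only: cost_eq) simp
  qed
  show "cost x \<le> 90 * x + 1" if "1/3 \<le> x" "x \<le> 2/3"
  proof (cases "x < 1/2")
    case True
    have e: "{i. i < 15 \<and> 60 - 90 * x \<le> real i} = {}" using True by auto
    have "real (card {i. i < 15 \<and> real i \<le> 90 * x - 30}) \<le> 90 * x - 30 + 1"
      using that by (intro card_le_real_le) simp
    with trivial[of "\<lambda>i. 15 - 45 * x \<le> real i"] e show ?thesis by (simp only: cost_eq) simp
  next
    case False
    have "real (card {i. i < 15 \<and> 60 - 90 * x \<le> real i}) \<le> real 15 - (60 - 90 * x)"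
      using False by (intro card_ge_real_le) simp
    with trivial[of "\<lambda>i. 15 - 45 * x \<le> real i"] trivial[of "\<lambda>i. real i \<le> 90 * x - 30"]
    show ?thesis by (simp only: cost_eq)
  qed
  show "cost x \<le> 60"
    using trivial[of "\<lambda>i. 15 - 45 * x \<le> real i"] trivial[of "\<lambda>i. real i \<le> 90 * x - 30"]
      trivial[of "\<lambda>i. 60 - 90 * x \<le> real i"]
    by (simp only: cost_eq)
qed

lemma cost_triangle:
  assumes "x \<ge> 0" "y \<ge> 0" "z \<ge> 0" "x + y + z = 1"
  shows "(if x > 0 then cost x else 0) + (if y > 0 then cost y else 0) + (if z > 0 then cost z else 0) \<le> 108"
proof -
  define c where "c = (\<lambda>t. if t > 0 then cost t else 0)"
  have b: "t < 1/3 \<and> c t \<le> 15 + 45 * t \<or> 1/3 \<le> t \<and> t \<le> 2/3 \<and> c t \<le> 90 * t + 1 \<or>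
     2/3 < t \<and> c t \<le> 60 \<or> t = 0 \<and> c t = 0" if "t \<ge> 0" for t
    using cost_bounds[of t] that unfolding c_def by (cases "t = 0"; cases "t < 1/3"; cases "t \<le> 2/3") auto
  \<comment> \<open>The bounds are affine on each range, so every combination of ranges is a linear
    problem; three weights below 1/3 contradict the sum 1.\<close>
  have "c x + c y + c z \<le> 108"
    using b[OF assms(1)] b[OF assms(2)] b[OF assms(3)] assms
    by (elim disjE conjE) linarith+
  then show ?thesis by (simp only: c_def)
qed

theorem fractional_cover_rounding:
  fixes f :: "('a \<times> 'a) set \<Rightarrow> real" and w :: "'a \<times> 'a \<Rightarrow> real"
  assumes V: "finite V" "E \<subseteq> V \<times> V" "\<And>v. (v, v) \<notin> E"
    and w: "\<And>e. w e \<ge> 0" "\<And>T. T \<in> arc_triangles E \<Longrightarrow> (\<Sum>e\<in>T. w e) \<ge> 1"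
    and f: "\<And>T. T \<in> arc_triangles E \<Longrightarrow> f T \<ge> 0"
    and slack: "\<And>e. e \<in> E \<Longrightarrow> w e > 0 \<Longrightarrow> (\<Sum>T\<in>{T\<in>arc_triangles E. e \<in> T}. f T) = 1"
      "\<And>T. T \<in> arc_triangles E \<Longrightarrow> f T > 0 \<Longrightarrow> (\<Sum>e\<in>T. w e) = 1"
  obtains S where "S \<subseteq> E" "arc_triangles (E - S) = {}"
    "real (card S) \<le> 1.8 * (\<Sum>T\<in>arc_triangles E. f T)"
proof -
  have finE: "finite E" using V by (meson finite_SigmaI finite_subset)
  note finT = finite_arc_triangles[OF finE]
  obtain r0 :: "'a \<Rightarrow> nat" where r0: "inj_on r0 V"
    using V(1) finite_imp_inj_to_nat_seg by metis
  define r where "r = (\<lambda>v. int (r0 v))"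
  have r: "r u \<noteq> r v" if "u \<in> V" "v \<in> V" "u \<noteq> v" for u v
    using r0 that by (auto simp: r_def inj_on_def)
  define E1 where "E1 = {e\<in>E. w e > 0}"
  let ?F = "\<Sum>T\<in>arc_triangles E. f T"
  let ?d = "\<lambda>i A. deleted E w (grid i) A r" and ?d' = "\<lambda>i A. deleted E w (grid i) A (\<lambda>y. - r y)"
  define tot where "tot = (\<Sum>i<15::nat. \<Sum>A\<in>Pow V. real (card (?d i A)) + real (card (?d' i A)))"
  have "tot = (\<Sum>i<15. \<Sum>e\<in>E1. \<Sum>A\<in>Pow V. hit (threshold (grid i) A r (fst e) (snd e)) (w e)
       + hit (threshold (grid i) A (\<lambda>y. - r y) (fst e) (snd e)) (w e))"
    unfolding tot_def E1_def card_deleted[OF finE] sum.distrib[symmetric]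
    by (intro sum.cong refl sum.swap)
  also have "\<dots> = (\<Sum>i<15. \<Sum>e\<in>E1. 2 ^ card V / 2 * hits (grid i) (w e))"
    using V by (intro sum.cong refl sum_hit_threshold r) (auto simp: E1_def)
  also have "\<dots> = 2 ^ card V / 2 * (\<Sum>e\<in>E1. cost (w e))"
    unfolding cost_def by (subst sum.swap) (simp add: sum_distrib_left)
  \<comment> \<open>Arcs of positive weight are saturated, so a factor 1 may be replaced by the sum
    of \<open>f T\<close> over the triangles through the arc.\<close>
  also have "(\<Sum>e\<in>E1. cost (w e)) = (\<Sum>e\<in>E1. \<Sum>T\<in>{T\<in>arc_triangles E. e \<in> T}. f T * cost (w e))"
    using slack(1) by (intro sum.cong refl) (simp add: E1_def sum_distrib_right[symmetric])
  also have "\<dots> = (\<Sum>e\<in>E1. \<Sum>T\<in>arc_triangles E. if e \<in> T then f T * cost (w e) else 0)"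
    using finT by (simp add: sum.inter_filter)
  also have "\<dots> = (\<Sum>T\<in>arc_triangles E. \<Sum>e\<in>E1. if e \<in> T then f T * cost (w e) else 0)"
    by (rule sum.swap)
  also have "\<dots> \<le> (\<Sum>T\<in>arc_triangles E. 108 * f T)"
  proof (rule sum_mono)
    fix T assume T: "T \<in> arc_triangles E"
    then obtain x y z where xyz: "T = {(x, y), (y, z), (z, x)}" "x \<noteq> y" "y \<noteq> z" "z \<noteq> x"
      "(x, y) \<in> E" "(y, z) \<in> E" "(z, x) \<in> E" by (rule arc_trianglesE)
    have "(\<Sum>e\<in>E1. if e \<in> T then f T * cost (w e) else 0) = (\<Sum>e\<in>{e\<in>E1. e \<in> T}. f T * cost (w e))"
      using finE by (subst sum.inter_filter) (auto simp: E1_def)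
    also have "{e\<in>E1. e \<in> T} = {e\<in>T. w e > 0}"
      using arc_triangle_subset[OF T] by (auto simp: E1_def)
    also have "(\<Sum>e\<in>{e\<in>T. w e > 0}. f T * cost (w e)) = (\<Sum>e\<in>T. if w e > 0 then f T * cost (w e) else 0)"
      using xyz by (subst sum.inter_filter) auto
    also have "\<dots> = f T * (\<Sum>e\<in>T. if w e > 0 then cost (w e) else 0)"
      by (simp add: sum_distrib_left if_distrib cong: if_cong)
    also have "\<dots> \<le> f T * 108"
    proof (cases "f T = 0")
      case False
      with f[OF T] have "f T > 0" by simp
      from slack(2)[OF T this] have "w (x, y) + w (y, z) + w (z, x) = 1" using xyz by simp
      with cost_triangle[OF w(1) w(1) w(1), of "(x, y)" "(y, z)" "(z, x)"] 
      have "(\<Sum>e\<in>T. if w e > 0 then cost (w e) else 0) \<le> 108" using xyz by simp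
      with f[OF T] show ?thesis by (rule mult_left_mono[rotated])
    qed simp
    finally show "(\<Sum>e\<in>E1. if e \<in> T then f T * cost (w e) else 0) \<le> 108 * f T" by simp
  qed
  also have "(\<Sum>T\<in>arc_triangles E. 108 * f T) = 108 * ?F" by (simp add: sum_distrib_left)
  finally have tot: "tot \<le> 2 ^ card V * (54 * ?F)" by (simp add: mult_ac)
  \<comment> \<open>The total is spread over \<open>15 * 2 ^ card V\<close> choices of
    \<open>i\<close> and \<open>A\<close>, and 54 / 15 = 3.6. An order and its reverse share this
    bound, so one of them deletes at most 1.8 times the value of \<open>f\<close>.\<close>
  have "\<exists>i A. i < 15 \<and> A \<subseteq> V \<and> real (card (?d i A)) + real (card (?d' i A)) \<le> 3.6 * ?F"
  proof (rule ccontr)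
    assume "\<not> ?thesis"
    then have "real (card (?d i A)) + real (card (?d' i A)) > 3.6 * ?F" if "i < 15" "A \<subseteq> V" for i A
      using that by (meson not_le)
    then have "(\<Sum>i<15::nat. \<Sum>A\<in>Pow V. 3.6 * ?F) < tot"
      unfolding tot_def using V(1) by (intro sum_strict_mono) (auto simp: lessThan_empty_iff)
    moreover have "(\<Sum>i<15::nat. \<Sum>A\<in>Pow V. 3.6 * ?F) = 2 ^ card V * (54 * ?F)"
      using V(1) by (simp add: card_Pow)
    ultimately show False using tot by linarith
  qed
  then obtain i A where iA: "i < 15" "real (card (?d i A)) + real (card (?d' i A)) \<le> 3.6 * ?F" by blast
  have g: "1/3 \<le> grid i" "grid i \<le> 1/2" using iA(1) by (auto simp: grid_def)
  have sub: "deleted E w (grid i) A \<rho> \<subseteq> E" for \<rho> by (auto simp: deleted_def)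
  consider "real (card (?d i A)) \<le> 1.8 * ?F" | "real (card (?d' i A)) \<le> 1.8 * ?F"
    using iA(2) by linarith
  then show thesis
    by cases (rule that[OF sub deleted_covers[OF g w]]; assumption)+
qed

section \<open>Fractional packings and covers\<close>

text \<open>Complementary slackness: by equality of the two values, the products of each variable
  with the slack of its constraint sum to 0. All of them are nonnegative, so each vanishes.\<close>

lemma fractional_duality:
  fixes E :: "'e set"
  assumes fin: "finite E" and H: "\<And>T. T \<in> H \<Longrightarrow> T \<subseteq> E" "\<And>T. T \<in> H \<Longrightarrow> T \<noteq> {}"
  shows "\<exists>(f :: 'e set \<Rightarrow> real) (w :: 'e \<Rightarrow> real).
    (\<forall>T\<in>H. f T \<ge> 0) \<and> (\<forall>e\<in>E. (\<Sum>T\<in>{T\<in>H. e \<in> T}. f T) \<le> 1) \<and>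
    (\<forall>e. w e \<ge> 0) \<and> (\<forall>T\<in>H. (\<Sum>e\<in>T. w e) \<ge> 1) \<and>
    (\<forall>e\<in>E. w e > 0 \<longrightarrow> (\<Sum>T\<in>{T\<in>H. e \<in> T}. f T) = 1) \<and>
    (\<forall>T\<in>H. f T > 0 \<longrightarrow> (\<Sum>e\<in>T. w e) = 1)"
proof -
  have finH: "finite H" using fin H(1) by (intro finite_subset[of H "Pow E"]) auto
  have finT: "finite T" if "T \<in> H" for T by (rule finite_subset[OF H(1)[OF that] fin])
  let ?a = "\<lambda>e T. if e \<in> T then 1 else 0 :: real"
  have col: "(\<Sum>e\<in>E. y e * ?a e T) = (\<Sum>e\<in>T. y e)" if "T \<in> H" for y :: "_ \<Rightarrow> real" and T
  proof -
    have "(\<Sum>e\<in>E. y e * ?a e T) = (\<Sum>e\<in>E. if e \<in> T then y e else 0)" by (intro sum.cong) auto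
    also have "\<dots> = (\<Sum>e\<in>E \<inter> T. y e)" using fin by (intro sum.inter_restrict[symmetric])
    finally show ?thesis using H(1)[OF that] by (simp only: Int_absorb1)
  qed
  have row: "(\<Sum>T\<in>H. ?a e T * x T) = (\<Sum>T\<in>{T\<in>H. e \<in> T}. x T)" for x :: "_ \<Rightarrow> real" and e
  proof -
    have "(\<Sum>T\<in>H. ?a e T * x T) = (\<Sum>T\<in>H. if e \<in> T then x T else 0)" by (intro sum.cong) auto
    also have "\<dots> = (\<Sum>T\<in>{T\<in>H. e \<in> T}. x T)" using finH by (intro sum.inter_filter[symmetric])
    finally show ?thesis .
  qed
  have one: "(\<Sum>e\<in>E. 1 * ?a e T) \<ge> 1" if "T \<in> H" for T
  proof -
    have "card T \<ge> 1" using H(2)[OF that] finT[OF that] by (simp add: Suc_le_eq card_gt_0_iff)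
    then show ?thesis using col[OF that, of "\<lambda>_. 1"] by simp
  qed
  have "\<exists>x y. (\<forall>T\<in>H. x T \<ge> 0) \<and> (\<forall>e\<in>E. (\<Sum>T\<in>H. ?a e T * x T) \<le> 1) \<and> (\<forall>e\<in>E. y e \<ge> 0) \<and>
     (\<forall>T\<in>H. (\<Sum>e\<in>E. y e * ?a e T) \<ge> 1) \<and> (\<Sum>T\<in>H. 1 * x T) = (\<Sum>e\<in>E. 1 * y e)"
    by (rule lp_strong_duality[OF fin finH, of "\<lambda>_. 1" "\<lambda>_. 1" "\<lambda>_. 1" ?a]) (simp, simp, rule one)
  then obtain x y where xy': "\<forall>T\<in>H. x T \<ge> 0" "\<forall>e\<in>E. (\<Sum>T\<in>H. ?a e T * x T) \<le> 1" "\<forall>e\<in>E. y e \<ge> 0"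
     "\<forall>T\<in>H. (\<Sum>e\<in>E. y e * ?a e T) \<ge> 1" "(\<Sum>T\<in>H. 1 * x T) = (\<Sum>e\<in>E. 1 * y e)"
    by (elim exE conjE) (rule that)
  note xy = xy'(1-4)[rule_format] xy'(5)
  \<comment> \<open>The dual solution is controlled on \<open>E\<close> only; extension by 0 makes
    it nonnegative everywhere.\<close>
  define w where "w = (\<lambda>e. if e \<in> E then y e else 0)"
  have w0: "w e \<ge> 0" for e using xy(3) by (simp add: w_def)
  have wT: "(\<Sum>e\<in>T. w e) = (\<Sum>e\<in>T. y e)" if "T \<in> H" for T
    using H(1)[OF that] by (intro sum.cong) (auto simp: w_def)
  have cover: "(\<Sum>e\<in>T. w e) \<ge> 1" if "T \<in> H" for T
    using xy(4)[OF that] wT[OF that] col[OF that] by simp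
  have load: "(\<Sum>T\<in>{T\<in>H. e \<in> T}. x T) \<le> 1" if "e \<in> E" for e
    using xy(2)[OF that] row by simp
  have total: "(\<Sum>T\<in>H. x T) = (\<Sum>e\<in>E. w e)" using xy(5) by (simp add: w_def)
  have "(\<Sum>T\<in>H. x T * (\<Sum>e\<in>T. w e)) = (\<Sum>T\<in>H. \<Sum>e\<in>E. w e * ?a e T * x T)"
    using col[of _ w] by (intro sum.cong) (auto simp: sum_distrib_right[symmetric])
  also have "\<dots> = (\<Sum>e\<in>E. \<Sum>T\<in>H. w e * ?a e T * x T)" by (rule sum.swap)
  also have "\<dots> = (\<Sum>e\<in>E. w e * (\<Sum>T\<in>{T\<in>H. e \<in> T}. x T))"
    unfolding row[symmetric] by (simp add: sum_distrib_left mult.assoc)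
  finally have swap: "(\<Sum>T\<in>H. x T * (\<Sum>e\<in>T. w e)) = (\<Sum>e\<in>E. w e * (\<Sum>T\<in>{T\<in>H. e \<in> T}. x T))" .
  have nn1: "x T * ((\<Sum>e\<in>T. w e) - 1) \<ge> 0" if "T \<in> H" for T using xy(1) cover that by simp
  have nn2: "w e * (1 - (\<Sum>T\<in>{T\<in>H. e \<in> T}. x T)) \<ge> 0" if "e \<in> E" for e using w0 load that by simp
  have "(\<Sum>T\<in>H. x T * ((\<Sum>e\<in>T. w e) - 1)) + (\<Sum>e\<in>E. w e * (1 - (\<Sum>T\<in>{T\<in>H. e \<in> T}. x T))) = 0"
    using swap total by (simp add: right_diff_distrib sum_subtractf)
  moreover have "(\<Sum>T\<in>H. x T * ((\<Sum>e\<in>T. w e) - 1)) \<ge> 0" "(\<Sum>e\<in>E. w e * (1 - (\<Sum>T\<in>{T\<in>H. e \<in> T}. x T))) \<ge> 0"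
    using nn1 nn2 by (auto intro!: sum_nonneg)
  ultimately have "(\<Sum>T\<in>H. x T * ((\<Sum>e\<in>T. w e) - 1)) = 0" "(\<Sum>e\<in>E. w e * (1 - (\<Sum>T\<in>{T\<in>H. e \<in> T}. x T))) = 0"
    by linarith+
  then have tight: "\<forall>T\<in>H. x T * ((\<Sum>e\<in>T. w e) - 1) = 0" "\<forall>e\<in>E. w e * (1 - (\<Sum>T\<in>{T\<in>H. e \<in> T}. x T)) = 0"
    using sum_nonneg_eq_0_iff[OF finH nn1] sum_nonneg_eq_0_iff[OF fin nn2] by simp_all
  have "(\<Sum>T\<in>{T\<in>H. e \<in> T}. x T) = 1" if "e \<in> E" "w e > 0" for e using tight(2) that by auto
  moreover have "(\<Sum>e\<in>T. w e) = 1" if "T \<in> H" "x T > 0" for T using tight(1) that by auto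
  ultimately show ?thesis
    by (intro exI[of _ x] exI[of _ w] conjI ballI allI impI xy(1) load w0 cover)
qed

text \<open>
  With the additional constraint \<open>f T \<le> \<epsilon>\<close> the dual acquires a slack variable \<open>s T\<close> of cost \<open>\<epsilon>\<close>; as the
  optimum is at most \<open>card E\<close>, only few triangles have large slack.
\<close>

lemma capped_fractional_duality:
  fixes E :: "'e set" and \<epsilon> :: real
  assumes fin: "finite E" and H: "\<And>T. T \<in> H \<Longrightarrow> T \<subseteq> E" "\<And>T. T \<in> H \<Longrightarrow> T \<noteq> {}" and \<epsilon>: "\<epsilon> \<ge> 0"
  shows "\<exists>(f :: 'e set \<Rightarrow> real) (w :: 'e \<Rightarrow> real) (s :: 'e set \<Rightarrow> real).
    (\<forall>T\<in>H. 0 \<le> f T) \<and> (\<forall>T\<in>H. f T \<le> \<epsilon>) \<and> (\<forall>e\<in>E. (\<Sum>T\<in>{T\<in>H. e \<in> T}. f T) \<le> 1) \<and>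
    (\<forall>e\<in>E. w e \<ge> 0) \<and> (\<forall>T\<in>H. s T \<ge> 0) \<and> (\<forall>T\<in>H. (\<Sum>e\<in>T. w e) + s T \<ge> 1) \<and>
    (\<Sum>T\<in>H. f T) = (\<Sum>e\<in>E. w e) + \<epsilon> * (\<Sum>T\<in>H. s T)"
proof -
  have finH: "finite H" using fin H(1) by (intro finite_subset[of H "Pow E"]) auto
  have finT: "finite T" if "T \<in> H" for T by (rule finite_subset[OF H(1)[OF that] fin])
  \<comment> \<open>Row \<open>Inl e\<close> bounds the load of \<open>e\<close> by 1, row
    \<open>Inr S\<close> bounds the variable of \<open>S\<close> by \<epsilon>. Their dual variables
    are the weights \<open>w\<close> and the slacks \<open>s\<close>.\<close>
  define a :: "'e + 'e set \<Rightarrow> 'e set \<Rightarrow> real" where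
    "a = (\<lambda>i T. case i of Inl e \<Rightarrow> if e \<in> T then 1 else 0 | Inr S \<Rightarrow> if S = T then 1 else 0)"
  define b :: "'e + 'e set \<Rightarrow> real" where "b = (\<lambda>i. case i of Inl e \<Rightarrow> 1 | Inr S \<Rightarrow> \<epsilon>)"
  have sumI: "(\<Sum>i\<in>E <+> H. g i) = (\<Sum>e\<in>E. g (Inl e)) + (\<Sum>S\<in>H. g (Inr S))" for g :: "_ \<Rightarrow> real"
    using fin finH by (simp add: sum.Plus)
  have col: "(\<Sum>i\<in>E <+> H. y i * a i T) = (\<Sum>e\<in>T. y (Inl e)) + y (Inr T)" if "T \<in> H" for y :: "_ \<Rightarrow> real" and T
  proof -
    have "(\<Sum>e\<in>E. y (Inl e) * a (Inl e) T) = (\<Sum>e\<in>E. if e \<in> T then y (Inl e) else 0)"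
      by (intro sum.cong) (auto simp: a_def)
    also have "\<dots> = (\<Sum>e\<in>E \<inter> T. y (Inl e))" using fin by (intro sum.inter_restrict[symmetric])
    also have "E \<inter> T = T" using H(1)[OF that] by auto
    finally have "(\<Sum>e\<in>E. y (Inl e) * a (Inl e) T) = (\<Sum>e\<in>T. y (Inl e))" .
    moreover have "(\<Sum>S\<in>H. y (Inr S) * a (Inr S) T) = (\<Sum>S\<in>H. if S = T then y (Inr S) else 0)"
      by (intro sum.cong) (auto simp: a_def)
    ultimately show ?thesis using that finH by (simp add: sumI)
  qed
  have row: "(\<Sum>T\<in>H. a (Inl e) T * x T) = (\<Sum>T\<in>{T\<in>H. e \<in> T}. x T)" for x :: "_ \<Rightarrow> real" and e
  proof -
    have "(\<Sum>T\<in>H. a (Inl e) T * x T) = (\<Sum>T\<in>H. if e \<in> T then x T else 0)" by (intro sum.cong) (auto simp: a_def)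
    also have "\<dots> = (\<Sum>T\<in>{T\<in>H. e \<in> T}. x T)" using finH by (intro sum.inter_filter[symmetric])
    finally show ?thesis .
  qed
  have row': "(\<Sum>T\<in>H. a (Inr S) T * x T) = x S" if "S \<in> H" for x :: "_ \<Rightarrow> real" and S
  proof -
    have "(\<Sum>T\<in>H. a (Inr S) T * x T) = (\<Sum>T\<in>H. if S = T then x T else 0)" by (intro sum.cong) (auto simp: a_def)
    then show ?thesis using finH that by simp
  qed
  define y0 :: "'e + 'e set \<Rightarrow> real" where "y0 = case_sum (\<lambda>_. 1) (\<lambda>_. 0)"
  have one: "(\<Sum>i\<in>E <+> H. y0 i * a i T) \<ge> 1" if "T \<in> H" for T
  proof -
    have "card T \<ge> 1" using H(2)[OF that] finT[OF that] by (simp add: Suc_le_eq card_gt_0_iff)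
    then show ?thesis unfolding col[OF that] by (simp add: y0_def)
  qed
  have b0: "b i \<ge> 0" and y00: "y0 i \<ge> 0" for i using \<epsilon> by (auto simp: b_def y0_def split: sum.split)
  have "\<exists>x y. (\<forall>T\<in>H. x T \<ge> 0) \<and> (\<forall>i\<in>E <+> H. (\<Sum>T\<in>H. a i T * x T) \<le> b i) \<and> (\<forall>i\<in>E <+> H. y i \<ge> 0) \<and>
     (\<forall>T\<in>H. (\<Sum>i\<in>E <+> H. y i * a i T) \<ge> 1) \<and> (\<Sum>T\<in>H. 1 * x T) = (\<Sum>i\<in>E <+> H. b i * y i)"
    by (rule lp_strong_duality[of "E <+> H" H b y0 "\<lambda>_. 1" a]) (use fin finH in simp, rule finH, rule b0, rule y00, rule one)
  then obtain x y where xy': "\<forall>T\<in>H. x T \<ge> 0" "\<forall>i\<in>E <+> H. (\<Sum>T\<in>H. a i T * x T) \<le> b i" "\<forall>i\<in>E <+> H. y i \<ge> 0"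
     "\<forall>T\<in>H. (\<Sum>i\<in>E <+> H. y i * a i T) \<ge> 1" "(\<Sum>T\<in>H. 1 * x T) = (\<Sum>i\<in>E <+> H. b i * y i)"
    by (elim exE conjE) (rule that)
  note xy = xy'(1-4)[rule_format] xy'(5)
  show ?thesis
  proof (rule exI[of _ x], rule exI[of _ "\<lambda>e. y (Inl e)"], rule exI[of _ "\<lambda>T. y (Inr T)"], intro conjI ballI)
    show "x T \<le> \<epsilon>" if "T \<in> H" for T using xy(2)[OF InrI[OF that]] row'[OF that] by (simp add: b_def)
    show "(\<Sum>T\<in>{T\<in>H. e \<in> T}. x T) \<le> 1" if "e \<in> E" for e
      using xy(2)[OF InlI[OF that]] row[of e] by (simp add: b_def)
    show "(\<Sum>e\<in>T. y (Inl e)) + y (Inr T) \<ge> 1" if "T \<in> H" for T using xy(4)[OF that] col[OF that] by simp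
    show "(\<Sum>T\<in>H. x T) = (\<Sum>e\<in>E. y (Inl e)) + \<epsilon> * (\<Sum>T\<in>H. y (Inr T))"
      using xy(5) by (simp add: sumI b_def sum_distrib_left)
  qed (use xy(1,3) in auto)
qed

text \<open>The given weights need not be tight on any triangle, so they are not rounded themselves.
  An optimal pair of the uncapped program of \<open>E\<close> is rounded instead, and weak duality
  against the fractional cover \<open>w / c\<close> bounds its value.\<close>

lemma cover_from_weights:
  assumes V: "finite V" "E \<subseteq> V \<times> V" "\<And>v. (v, v) \<notin> E"
    and w: "\<And>e. e \<in> E \<Longrightarrow> w e \<ge> 0" "\<And>T. T \<in> arc_triangles E \<Longrightarrow> (\<Sum>e\<in>T. w e) \<ge> c" and c: "c > 0"
  obtains S where "S \<subseteq> E" "arc_triangles (E - S) = {}" "c * real (card S) \<le> 1.8 * (\<Sum>e\<in>E. w e)"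
proof -
  have fin: "finite E" using V by (meson finite_SigmaI finite_subset)
  have ne: "T \<noteq> {}" if "T \<in> arc_triangles E" for T using card_arc_triangle[OF that] by auto
  have "\<exists>f z. (\<forall>T\<in>arc_triangles E. f T \<ge> 0) \<and> (\<forall>e\<in>E. (\<Sum>T\<in>{T\<in>arc_triangles E. e \<in> T}. f T) \<le> (1::real)) \<and>
    (\<forall>e. z e \<ge> 0) \<and> (\<forall>T\<in>arc_triangles E. (\<Sum>e\<in>T. z e) \<ge> (1::real)) \<and>
    (\<forall>e\<in>E. z e > 0 \<longrightarrow> (\<Sum>T\<in>{T\<in>arc_triangles E. e \<in> T}. f T) = 1) \<and>
    (\<forall>T\<in>arc_triangles E. f T > 0 \<longrightarrow> (\<Sum>e\<in>T. z e) = 1)"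
    by (rule fractional_duality[OF fin arc_triangle_subset ne])
  then obtain f z :: "_ \<Rightarrow> real" where fz': "\<forall>T\<in>arc_triangles E. f T \<ge> 0"
    "\<forall>e\<in>E. (\<Sum>T\<in>{T\<in>arc_triangles E. e \<in> T}. f T) \<le> 1"
    "\<forall>e. z e \<ge> 0" "\<forall>T\<in>arc_triangles E. (\<Sum>e\<in>T. z e) \<ge> 1"
    "\<forall>e\<in>E. z e > 0 \<longrightarrow> (\<Sum>T\<in>{T\<in>arc_triangles E. e \<in> T}. f T) = 1"
    "\<forall>T\<in>arc_triangles E. f T > 0 \<longrightarrow> (\<Sum>e\<in>T. z e) = 1"
    by (elim exE conjE) (rule that)
  note fz = fz'[rule_format]
  obtain S where S: "S \<subseteq> E" "arc_triangles (E - S) = {}" "real (card S) \<le> 1.8 * (\<Sum>T\<in>arc_triangles E. f T)"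
    by (rule fractional_cover_rounding[OF V fz(3,4,1,5,6)])
  have finH: "finite (arc_triangles E)" using fin by (rule finite_arc_triangles)
  have "c * (\<Sum>T\<in>arc_triangles E. f T) \<le> (\<Sum>T\<in>arc_triangles E. f T * (\<Sum>e\<in>T. w e))"
    unfolding sum_distrib_left[of c]
  proof (rule sum_mono)
    fix T assume "T \<in> arc_triangles E"
    from mult_left_mono[OF w(2)[OF this] fz(1)[OF this]] show "c * f T \<le> f T * (\<Sum>e\<in>T. w e)"
      by (simp add: mult.commute)
  qed
  also have "\<dots> = (\<Sum>T\<in>arc_triangles E. \<Sum>e\<in>E. if e \<in> T then f T * w e else 0)"
  proof (rule sum.cong[OF refl])
    fix T assume "T \<in> arc_triangles E"
    then have "E \<inter> T = T" using arc_triangle_subset by blast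
    then show "f T * (\<Sum>e\<in>T. w e) = (\<Sum>e\<in>E. if e \<in> T then f T * w e else 0)"
      using sum.inter_restrict[OF fin, of "\<lambda>e. f T * w e" T] by (simp add: sum_distrib_left)
  qed
  also have "\<dots> = (\<Sum>e\<in>E. \<Sum>T\<in>arc_triangles E. if e \<in> T then f T * w e else 0)" by (rule sum.swap)
  also have "\<dots> \<le> (\<Sum>e\<in>E. w e)"
  proof (rule sum_mono)
    fix e assume e: "e \<in> E"
    have "(\<Sum>T\<in>arc_triangles E. if e \<in> T then f T * w e else 0) = (\<Sum>T\<in>{T\<in>arc_triangles E. e \<in> T}. f T) * w e"
      using finH by (simp add: sum.inter_filter[symmetric] sum_distrib_right)
    also have "\<dots> \<le> 1 * w e" using fz(2)[OF e] w(1)[OF e] by (intro mult_right_mono)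
    finally show "(\<Sum>T\<in>arc_triangles E. if e \<in> T then f T * w e else 0) \<le> w e" by simp
  qed
  finally have "c * (\<Sum>T\<in>arc_triangles E. f T) \<le> (\<Sum>e\<in>E. w e)" .
  moreover have "c * real (card S) \<le> c * (1.8 * (\<Sum>T\<in>arc_triangles E. f T))"
    using S(3) c by (intro mult_left_mono) auto
  ultimately have "c * real (card S) \<le> 1.8 * (\<Sum>e\<in>E. w e)" by simp
  with S that show thesis by blast
qed

text \<open>
  Rounding the weights down to multiples of \<open>1/K\<close> splits the triangles of small weight into boundedly
  many classes, each consisting of all triangles of a triple of relations.
\<close>

lemma weighted_triangle_removal:
  fixes \<delta> \<eta> :: real
  assumes \<delta>: "\<delta> > 0" and \<eta>: "0 < \<eta>"
  obtains \<gamma> where "\<gamma> > 0"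
    "\<And>(V :: 'a set) E w. finite V \<Longrightarrow> E \<subseteq> V \<times> V \<Longrightarrow> (\<And>v. (v, v) \<notin> E) \<Longrightarrow> (\<And>e. e \<in> E \<Longrightarrow> w e \<ge> 0) \<Longrightarrow>
      real (card {T\<in>arc_triangles E. (\<Sum>e\<in>T. w e) < 1 - \<eta> / 2}) \<le> \<gamma> * real (card V) ^ 3 \<Longrightarrow>
      \<exists>R\<subseteq>E. real (card R) \<le> \<delta> * (real (card V))\<^sup>2 \<and>
        (\<forall>T\<in>arc_triangles (E - R). (\<Sum>e\<in>T. w e) \<ge> 1 - \<eta>)"
proof -
  \<comment> \<open>Rounding three weights down loses at most \<open>3 / K\<close>, which must stay
    within \<open>\<eta> / 2\<close>.\<close>
  obtain K :: nat where K6: "6 / \<eta> < real K" using reals_Archimedean2 by blast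
  have "0 < 6 / \<eta>" using \<eta> by simp
  with K6 have K0: "0 < real K" by linarith
  with K6 \<eta> have "3 / real K \<le> \<eta> / 2" by (simp add: field_simps)
  note K = K0 this
  have "\<delta> / real K ^ 3 > 0" using \<delta> K by simp
  then obtain \<gamma> where \<gamma>: "\<gamma> > 0"
    "\<And>(V :: 'a set) X Y Z. finite V \<Longrightarrow> X \<subseteq> V \<times> V \<Longrightarrow> Y \<subseteq> V \<times> V \<Longrightarrow> Z \<subseteq> V \<times> V \<Longrightarrow>
      real (card (rel_triangles X Y Z)) \<le> \<gamma> * (real (card V)) ^ 3 \<Longrightarrow>
      \<exists>S. real (card S) \<le> \<delta> / real K ^ 3 * (real (card V))\<^sup>2 \<and> S \<subseteq> V \<times> V \<and> rel_triangles (X - S) (Y - S) (Z - S) = {}"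
    using triangle_removal[of "\<delta> / real K ^ 3", where 'a = 'a] by blast
  show thesis
  proof (rule that[of "\<gamma> / 3"])
    fix V :: "'a set" and E w
    assume V: "finite V" "E \<subseteq> V \<times> V" "\<And>v. (v, v) \<notin> E" and w: "\<And>e. e \<in> E \<Longrightarrow> w e \<ge> (0 :: real)"
      and few: "real (card {T\<in>arc_triangles E. (\<Sum>e\<in>T. w e) < 1 - \<eta> / 2}) \<le> \<gamma> / 3 * real (card V) ^ 3"
    let ?B = "{T\<in>arc_triangles E. (\<Sum>e\<in>T. w e) < 1 - \<eta> / 2}"
    have fin: "finite E" using V by (meson finite_SigmaI finite_subset)
    have finB: "finite ?B" using finite_arc_triangles[OF fin] by simp
    have finT: "finite T" if "T \<in> arc_triangles E" for T
      by (rule finite_subset[OF arc_triangle_subset[OF that] fin])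
    define lev where "lev = (\<lambda>e. nat \<lfloor>w e * K\<rfloor>)"
    define L where "L = (\<lambda>j. {e\<in>E. lev e = j})"
    have lev: "real (lev e) / K \<le> w e" "w e < (real (lev e) + 1) / K" if "e \<in> E" for e
    proof -
      have "real (lev e) = of_int \<lfloor>w e * K\<rfloor>" using w[OF that] K by (simp add: lev_def)
      then have "real (lev e) \<le> w e * K" "w e * K < real (lev e) + 1" by linarith+
      then show "real (lev e) / K \<le> w e" "w e < (real (lev e) + 1) / K" using K by (simp_all add: field_simps)
    qed
    \<comment> \<open>The upper ends of the three levels still sum to at most
      \<open>1 - \<eta> / 2\<close>, so all triangles of such a class are among the few in
      \<open>?B\<close>. At most \<open>K ^ 3\<close> classes share the budget \<delta>.\<close>
    define I where "I = {(i, j, k). i < K \<and> j < K \<and> k < K \<and> (real i + real j + real k + 3) / K \<le> 1 - \<eta> / 2}"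
    have Isub: "I \<subseteq> {..<K} \<times> {..<K} \<times> {..<K}" by (auto simp: I_def)
    then have finI: "finite I" by (rule finite_subset) simp
    have "card I \<le> card ({..<K} \<times> {..<K} \<times> {..<K})" using Isub by (intro card_mono) auto
    then have "card I \<le> K ^ 3" by (simp add: card_cartesian_product power3_eq_cube mult.assoc)
    then have "real (card I) \<le> real (K ^ 3)" by (rule of_nat_mono)
    then have cI: "real (card I) \<le> real K ^ 3" by (simp only: of_nat_power)
    have "\<exists>S. real (card S) \<le> \<delta> / real K ^ 3 * (real (card V))\<^sup>2 \<and> S \<subseteq> V \<times> V \<and> rel_triangles (L i - S) (L j - S) (L k - S) = {}"
      if ijk: "(i, j, k) \<in> I" for i j k
    proof (rule \<gamma>(2)[OF V(1)])
      show "L i \<subseteq> V \<times> V" "L j \<subseteq> V \<times> V" "L k \<subseteq> V \<times> V" using V(2) by (auto simp: L_def)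
      \<comment> \<open>A triple is recorded as its triangle together with its first arc, which
        tells the rotations apart. A triangle has three arcs, so there are at most
        \<open>3 * card ?B\<close> triples; this explains the bound
        \<open>\<gamma> / 3\<close>.\<close>
      let ?m = "\<lambda>(u, v, x). ({(u, v), (v, x), (x, u)}, (u, v))"
      have tri: "{(u, v), (v, x), (x, u)} \<in> ?B \<and> u \<noteq> v \<and> v \<noteq> x \<and> x \<noteq> u"
        if "(u, v, x) \<in> rel_triangles (L i) (L j) (L k)" for u v x
      proof -
        have arcs: "(u, v) \<in> E" "(v, x) \<in> E" "(x, u) \<in> E" "lev (u, v) = i" "lev (v, x) = j" "lev (x, u) = k"
          using that by (auto simp: rel_triangles_def L_def)
        then have d: "u \<noteq> v" "v \<noteq> x" "x \<noteq> u" using V(3) by metis+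
        have "w (u, v) + w (v, x) + w (x, u) < (real i + real j + real k + 3) / K"
          using lev(2)[OF arcs(1)] lev(2)[OF arcs(2)] lev(2)[OF arcs(3)] arcs(4-6)
          by (simp add: add_divide_distrib)
        also have "\<dots> \<le> 1 - \<eta> / 2" using ijk by (simp add: I_def)
        finally have "(\<Sum>e\<in>{(u, v), (v, x), (x, u)}. w e) < 1 - \<eta> / 2" using d by simp
        with arc_trianglesI[OF d arcs(1-3)] d show ?thesis by simp
      qed
      have inj: "inj_on ?m (rel_triangles (L i) (L j) (L k))"
      proof (rule inj_onI)
        fix p q assume p: "p \<in> rel_triangles (L i) (L j) (L k)" and q: "q \<in> rel_triangles (L i) (L j) (L k)"
          and eq: "?m p = ?m q"
        obtain u v x where p': "p = (u, v, x)" by (cases p)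
        obtain u' v' x' where q': "q = (u', v', x')" by (cases q)
        have uv: "u' = u" "v' = v" using eq p' q' by simp_all
        have "(v, x) \<in> {(u, v), (v, x'), (x', u)}" using eq p' q' uv by auto
        with tri[of u v x] tri[of u' v' x'] p q p' q' uv show "p = q" by auto
      qed
      have "card (rel_triangles (L i) (L j) (L k)) \<le> card (SIGMA T:?B. T)"
      proof (rule card_inj_on_le[OF inj])
        show "?m ` rel_triangles (L i) (L j) (L k) \<subseteq> (SIGMA T:?B. T)"
        proof
          fix y assume "y \<in> ?m ` rel_triangles (L i) (L j) (L k)"
          then obtain u v x where "(u, v, x) \<in> rel_triangles (L i) (L j) (L k)"
            "y = ({(u, v), (v, x), (x, u)}, (u, v))" by auto
          with tri[of u v x] show "y \<in> (SIGMA T:?B. T)" by (simp only: mem_Sigma_iff) simp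
        qed
        show "finite (SIGMA T:?B. T)"
          by (intro finite_SigmaI finB) (use finT in auto)
      qed
      also have "\<dots> = (\<Sum>T\<in>?B. card T)"
        by (intro card_SigmaI finB) (use finT in auto)
      also have "\<dots> = (\<Sum>T\<in>?B. 3)" by (rule sum.cong) (auto dest: card_arc_triangle)
      also have "\<dots> = 3 * card ?B" by simp
      finally have "real (card (rel_triangles (L i) (L j) (L k))) \<le> 3 * real (card ?B)" by linarith
      with few show "real (card (rel_triangles (L i) (L j) (L k))) \<le> \<gamma> * (real (card V)) ^ 3" by linarith
    qed
    then have "\<forall>p\<in>I. \<exists>S. real (card S) \<le> \<delta> / real K ^ 3 * (real (card V))\<^sup>2 \<and> S \<subseteq> V \<times> V \<and>
       rel_triangles (L (fst p) - S) (L (fst (snd p)) - S) (L (snd (snd p)) - S) = {}" by auto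
    from bchoice[OF this] obtain S where S: "\<forall>p\<in>I. real (card (S p)) \<le> \<delta> / real K ^ 3 * (real (card V))\<^sup>2 \<and> S p \<subseteq> V \<times> V \<and>
       rel_triangles (L (fst p) - S p) (L (fst (snd p)) - S p) (L (snd (snd p)) - S p) = {}" by (rule exE)
    define R where "R = E \<inter> (\<Union>p\<in>I. S p)"
    have finU: "finite (\<Union>p\<in>I. S p)"
    proof (rule finite_UN_I[OF finI])
      fix p assume "p \<in> I"
      then have "S p \<subseteq> V \<times> V" using S by blast
      then show "finite (S p)" by (rule finite_subset) (use V(1) in simp)
    qed
    have "card R \<le> card (\<Union>p\<in>I. S p)" using finU by (intro card_mono) (auto simp: R_def)
    also have "\<dots> \<le> (\<Sum>p\<in>I. card (S p))" using finI by (rule card_UN_le)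
    finally have "real (card R) \<le> (\<Sum>p\<in>I. real (card (S p)))" by (simp flip: of_nat_sum)
    also have "\<dots> \<le> (\<Sum>p\<in>I. \<delta> / real K ^ 3 * (real (card V))\<^sup>2)" using S by (intro sum_mono) blast
    also have "\<dots> = real (card I) * (\<delta> / real K ^ 3 * (real (card V))\<^sup>2)" by simp
    also have "\<dots> \<le> real K ^ 3 * (\<delta> / real K ^ 3 * (real (card V))\<^sup>2)"
      using cI \<delta> K by (intro mult_right_mono) auto
    also have "\<dots> = \<delta> * (real (card V))\<^sup>2" using K by simp
    finally have cR: "real (card R) \<le> \<delta> * (real (card V))\<^sup>2" .
    have "(\<Sum>e\<in>T. w e) \<ge> 1 - \<eta>" if T: "T \<in> arc_triangles (E - R)" for T
    proof (rule ccontr)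
      assume small: "\<not> (\<Sum>e\<in>T. w e) \<ge> 1 - \<eta>"
      obtain u v x where uvx: "T = {(u, v), (v, x), (x, u)}" "u \<noteq> v" "v \<noteq> x" "x \<noteq> u"
        "(u, v) \<in> E - R" "(v, x) \<in> E - R" "(x, u) \<in> E - R"
        using T by (rule arc_trianglesE)
      have arcs: "(u, v) \<in> E" "(v, x) \<in> E" "(x, u) \<in> E" using uvx by auto
      define i j k where "i = lev (u, v)" and "j = lev (v, x)" and "k = lev (x, u)"
      have sum: "w (u, v) + w (v, x) + w (x, u) < 1 - \<eta>" using small uvx by simp
      \<comment> \<open>A triangle of weight below \<open>1 - \<eta>\<close> belongs to a class in
        \<open>I\<close>: the lower ends of its levels sum to less than \<open>1 - \<eta>\<close>,
        the upper ends add at most \<open>\<eta> / 2\<close>, and each level is below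
        \<open>K\<close>.\<close>
      have "(real i + real j + real k) / K \<le> w (u, v) + w (v, x) + w (x, u)"
        using lev(1)[OF arcs(1)] lev(1)[OF arcs(2)] lev(1)[OF arcs(3)]
        by (simp add: add_divide_distrib i_def j_def k_def)
      with sum have le: "(real i + real j + real k) / K < 1 - \<eta>" by linarith
      then have le3: "(real i + real j + real k + 3) / K \<le> 1 - \<eta> / 2"
        using K(2) by (simp add: add_divide_distrib)
      have "(real i + real j + real k) / K < 1" using le \<eta> by linarith
      then have "real i + real j + real k < real K" using K(1) by (simp add: divide_less_eq)
      then have "i < K" "j < K" "k < K" by linarith+
      with le3 have I: "(i, j, k) \<in> I" by (simp add: I_def)
      then have "rel_triangles (L i - S (i, j, k)) (L j - S (i, j, k)) (L k - S (i, j, k)) = {}"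
        using S by auto
      moreover have "(u, v) \<in> L i - S (i, j, k)" "(v, x) \<in> L j - S (i, j, k)" "(x, u) \<in> L k - S (i, j, k)"
        using uvx(5-7) I by (auto simp: R_def L_def i_def j_def k_def)
      ultimately show False by (auto simp: rel_triangles_def)
    qed
    with cR show "\<exists>R\<subseteq>E. real (card R) \<le> \<delta> * (real (card V))\<^sup>2 \<and>
        (\<forall>T\<in>arc_triangles (E - R). (\<Sum>e\<in>T. w e) \<ge> 1 - \<eta>)"
      by (intro exI[of _ R]) (auto simp: R_def)
  qed (use \<gamma>(1) in simp)
qed

lemma packing_and_cover:
  fixes \<delta> :: real
  assumes \<delta>: "\<delta> > 0"
  shows "\<exists>n0. \<forall>(V :: 'a set) E. finite V \<and> E \<subseteq> V \<times> V \<and> (\<forall>v. (v, v) \<notin> E) \<and> card V \<ge> n0 \<longrightarrow>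
    (\<exists>S M. S \<subseteq> E \<and> arc_triangles (E - S) = {} \<and> M \<subseteq> arc_triangles E \<and> pairwise disjnt M \<and>
      real (card S) \<le> 1.8 * real (card M) + \<delta> * (real (card V))\<^sup>2)"
proof -
  \<comment> \<open>The error budget: \<delta> / 3 for the removed arcs, 1.8 * \<delta> / 6 = 0.3
    \<delta> for the nibble, and 3.6 * \<delta> / 12 = 0.3 \<delta> for covering triangles with
    weight \<open>1 - \<eta>\<close> in place of 1.\<close>
  define \<eta> where "\<eta> = min (1/2) (\<delta> / 12)"
  have \<eta>: "0 < \<eta>" "\<eta> \<le> 1/2" "\<eta> \<le> \<delta> / 12" using \<delta> by (auto simp: \<eta>_def)
  obtain \<epsilon> where \<epsilon>: "\<epsilon> > 0" "\<And>(E :: ('a \<times> 'a) set) H f. fractional_matching E H f \<epsilon> \<Longrightarrow>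
    (\<exists>M\<subseteq>H. pairwise disjnt M \<and> real (card M) \<ge> (\<Sum>T\<in>H. f T) - \<delta> / 6 * card E)"
    using matching_from_fractional[of "\<delta> / 6"] \<delta> by auto
  have "\<delta> / 3 > 0" using \<delta> by simp
  from weighted_triangle_removal[OF this \<eta>(1), where 'a = 'a] obtain \<gamma> where \<gamma>: "\<gamma> > 0"
    "\<And>(V :: 'a set) E w. finite V \<Longrightarrow> E \<subseteq> V \<times> V \<Longrightarrow> (\<And>v. (v, v) \<notin> E) \<Longrightarrow> (\<And>e. e \<in> E \<Longrightarrow> w e \<ge> 0) \<Longrightarrow>
      real (card {T\<in>arc_triangles E. (\<Sum>e\<in>T. w e) < 1 - \<eta> / 2}) \<le> \<gamma> * real (card V) ^ 3 \<Longrightarrow>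
      \<exists>R\<subseteq>E. real (card R) \<le> \<delta> / 3 * (real (card V))\<^sup>2 \<and>
        (\<forall>T\<in>arc_triangles (E - R). (\<Sum>e\<in>T. w e) \<ge> 1 - \<eta>)" by blast
  \<comment> \<open>From here on \<open>2 / (\<eta> * \<epsilon>)\<close> times n^2, the bound on
    the number of exceptional triangles, is at most \<gamma> n^3.\<close>
  obtain n0 :: nat where n0: "2 / (\<eta> * \<epsilon> * \<gamma>) < real n0" using reals_Archimedean2 by blast
  show ?thesis
  proof (intro exI[of _ n0] allI impI)
    fix V :: "'a set" and E assume "finite V \<and> E \<subseteq> V \<times> V \<and> (\<forall>v. (v, v) \<notin> E) \<and> card V \<ge> n0"
    then have V: "finite V" "E \<subseteq> V \<times> V" "\<And>v. (v, v) \<notin> E" and n: "card V \<ge> n0" by auto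
    have fin: "finite E" using V by (meson finite_SigmaI finite_subset)
    let ?n2 = "(real (card V))\<^sup>2" and ?H = "arc_triangles E"
    have "card E \<le> card (V \<times> V)" using V by (intro card_mono) auto
    then have "real (card E) \<le> real (card V * card V)" unfolding card_cartesian_product of_nat_le_iff .
    then have cE: "real (card E) \<le> ?n2" by (simp add: power2_eq_square)
    have ne: "T \<noteq> {}" if "T \<in> ?H" for T using card_arc_triangle[OF that] by auto
    have "\<exists>f w s. (\<forall>T\<in>?H. 0 \<le> f T) \<and> (\<forall>T\<in>?H. f T \<le> \<epsilon>) \<and> (\<forall>e\<in>E. (\<Sum>T\<in>{T\<in>?H. e \<in> T}. f T) \<le> 1) \<and>
      (\<forall>e\<in>E. w e \<ge> 0) \<and> (\<forall>T\<in>?H. s T \<ge> 0) \<and> (\<forall>T\<in>?H. (\<Sum>e\<in>T. w e) + s T \<ge> 1) \<and>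
      (\<Sum>T\<in>?H. f T) = (\<Sum>e\<in>E. w e) + \<epsilon> * (\<Sum>T\<in>?H. s T)"
      by (rule capped_fractional_duality[OF fin arc_triangle_subset ne less_imp_le[OF \<epsilon>(1)]])
    then obtain f w s where fws': "\<forall>T\<in>?H. 0 \<le> f T" "\<forall>T\<in>?H. f T \<le> \<epsilon>" "\<forall>e\<in>E. (\<Sum>T\<in>{T\<in>?H. e \<in> T}. f T) \<le> 1"
      "\<forall>e\<in>E. w e \<ge> 0" "\<forall>T\<in>?H. s T \<ge> 0" "\<forall>T\<in>?H. (\<Sum>e\<in>T. w e) + s T \<ge> 1"
      "(\<Sum>T\<in>?H. f T) = (\<Sum>e\<in>E. w e) + \<epsilon> * (\<Sum>T\<in>?H. s T)"
      by (elim exE conjE) (rule that)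
    note fws = fws'(1-6)[rule_format] fws'(7)
    define F where "F = (\<Sum>T\<in>?H. f T)"
    have fm: "fractional_matching E ?H f \<epsilon>"
      by (unfold_locales; (fact fin | erule arc_triangle_subset | erule card_arc_triangle
        | erule (2) arc_triangles_linear | erule fws(1-3)))
    obtain M where M: "M \<subseteq> ?H" "pairwise disjnt M" "real (card M) \<ge> F - \<delta> / 6 * card E"
      using \<epsilon>(2)[OF fm] by (auto simp: F_def)
    have F: "0 \<le> F" "F \<le> ?n2"
    proof -
      show "0 \<le> F" unfolding F_def by (intro sum_nonneg fws(1))
      show "F \<le> ?n2" using fractional_matching.total_le[OF fm] cE unfolding F_def by linarith
    qed
    have finH: "finite ?H" using fin by (rule finite_arc_triangles)
    have s0: "(\<Sum>T\<in>?H. s T) \<ge> 0" and w0: "(\<Sum>e\<in>E. w e) \<ge> 0" using fws(4,5) by (auto intro: sum_nonneg)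
    let ?B = "{T\<in>?H. (\<Sum>e\<in>T. w e) < 1 - \<eta> / 2}"
    \<comment> \<open>An exceptional triangle has slack above \<open>\<eta> / 2\<close>, and the
      dual objective, of value at most n^2, charges \<epsilon> per unit of slack.\<close>
    have "\<eta> / 2 * real (card ?B) = (\<Sum>T\<in>?B. \<eta> / 2)" by simp
    also have "\<dots> \<le> (\<Sum>T\<in>?B. s T)" using fws(6) by (intro sum_mono) fastforce
    also have "\<dots> \<le> (\<Sum>T\<in>?H. s T)" using finH fws(5) by (intro sum_mono2) auto
    finally have "\<epsilon> * (\<eta> / 2 * real (card ?B)) \<le> \<epsilon> * (\<Sum>T\<in>?H. s T)" using \<epsilon>(1) by (intro mult_left_mono) auto
    also have "\<dots> \<le> F" using fws(7) w0 by (simp add: F_def)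
    also have "\<dots> \<le> ?n2" by (rule F)
    finally have B: "real (card ?B) \<le> 2 / (\<eta> * \<epsilon>) * ?n2" using \<eta> \<epsilon>(1) by (simp add: field_simps)
    also have "\<dots> \<le> (\<gamma> * real (card V)) * ?n2"
    proof (intro mult_right_mono)
      have "2 / (\<eta> * \<epsilon> * \<gamma>) \<le> real (card V)" using n0 n by linarith
      then show "2 / (\<eta> * \<epsilon>) \<le> \<gamma> * real (card V)" using \<eta> \<epsilon>(1) \<gamma>(1) by (simp add: field_simps)
    qed simp
    finally have few: "real (card ?B) \<le> \<gamma> * real (card V) ^ 3" by (simp add: power3_eq_cube power2_eq_square mult.assoc)
    obtain R where R: "R \<subseteq> E" "real (card R) \<le> \<delta> / 3 * ?n2"
      "\<And>T. T \<in> arc_triangles (E - R) \<Longrightarrow> (\<Sum>e\<in>T. w e) \<ge> 1 - \<eta>"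
      using \<gamma>(2)[OF V fws(4) few] by blast
    have loopless: "\<And>v. (v, v) \<notin> E - R" using V(3) by auto
    obtain S where S: "S \<subseteq> E - R" "arc_triangles (E - R - S) = {}"
      "(1 - \<eta>) * real (card S) \<le> 1.8 * (\<Sum>e\<in>E - R. w e)"
    proof (rule cover_from_weights[OF V(1) _ loopless _ R(3)])
      show "E - R \<subseteq> V \<times> V" using V(2) by auto
      show "\<And>e. e \<in> E - R \<Longrightarrow> w e \<ge> 0" using fws(4) by auto
      show "1 - \<eta> > 0" using \<eta> by simp
    qed (use that in blast)
    have "(\<Sum>e\<in>E - R. w e) \<le> (\<Sum>e\<in>E. w e)" using fin fws(4) by (intro sum_mono2) auto
    also have "\<dots> \<le> F" using fws(7) s0 \<epsilon>(1) by (simp add: F_def)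
    finally have "(1 - \<eta>) * real (card S) \<le> 1.8 * F" using S(3) by simp
    \<comment> \<open>For \<open>\<eta> \<le> 1/2\<close> the factor \<open>1 / (1 - \<eta>)\<close>
      is at most \<open>1 + 2 * \<eta>\<close>.\<close>
    moreover have "1 \<le> (1 + 2 * \<eta>) * (1 - \<eta>)"
    proof -
      have "\<eta> * \<eta> \<le> 1/2 * \<eta>" using \<eta> by (intro mult_right_mono) auto
      then show ?thesis by (simp add: algebra_simps)
    qed
    ultimately have "1 * real (card S) \<le> (1 + 2 * \<eta>) * (1.8 * F)"
    proof -
      have "1 * real (card S) \<le> (1 + 2 * \<eta>) * (1 - \<eta>) * real (card S)"
        using \<open>1 \<le> (1 + 2 * \<eta>) * (1 - \<eta>)\<close> by (intro mult_right_mono) auto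
      also have "\<dots> = (1 + 2 * \<eta>) * ((1 - \<eta>) * real (card S))" by simp
      also have "\<dots> \<le> (1 + 2 * \<eta>) * (1.8 * F)"
        using \<open>(1 - \<eta>) * real (card S) \<le> 1.8 * F\<close> \<eta> by (intro mult_left_mono) auto
      finally show ?thesis .
    qed
    also have "\<dots> = 1.8 * F + 3.6 * (\<eta> * F)" by (simp add: algebra_simps)
    also have "\<eta> * F \<le> \<delta> / 12 * ?n2" using \<eta> F \<delta> by (intro mult_mono) auto
    finally have "real (card S) \<le> 1.8 * F + 3.6 * (\<delta> / 12 * ?n2)" by simp
    moreover have "F \<le> real (card M) + \<delta> / 6 * ?n2"
    proof -
      have "\<delta> / 6 * real (card E) \<le> \<delta> / 6 * ?n2" using cE \<delta> by (intro mult_left_mono) auto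
      with M(3) show ?thesis by linarith
    qed
    moreover have "real (card (R \<union> S)) \<le> real (card R) + real (card S)"
      using card_Un_le[of R S] by linarith
    moreover have "0 \<le> \<delta> * ?n2" using \<delta> by simp
    ultimately have "real (card (R \<union> S)) \<le> 1.8 * real (card M) + \<delta> * ?n2" using R(2) by simp
    moreover have "E - (R \<union> S) = E - R - S" by blast
    ultimately show "\<exists>S M. S \<subseteq> E \<and> arc_triangles (E - S) = {} \<and> M \<subseteq> ?H \<and> pairwise disjnt M \<and>
      real (card S) \<le> 1.8 * real (card M) + \<delta> * ?n2"
      using M(1,2) R(1) S(1,2) by (intro exI[of _ "R \<union> S"] exI[of _ M]) auto
  qed
qed

section \<open>Transfer to \<open>tau_t\<close> and \<open>nu_t\<close>, and the asymptotic
  form\<close>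

lemma dir_triangles_eq: "dir_triangles D = arc_triangles (parcs D)"
  by (simp only: dir_triangles_def arc_triangles_def)

lemma tau_le_nu_eventually:
  fixes \<delta> :: real
  assumes "\<delta> > 0"
  shows "\<exists>n\<^sub>0. \<forall>D :: 'a pair_pre_digraph. pair_digraph D \<and> card (pverts D) \<ge> n\<^sub>0 \<longrightarrow>
    real (tau_t D) \<le> 1.8 * real (nu_t D) + \<delta> * (real (card (pverts D)))\<^sup>2"
proof -
  obtain n0 where n0: "\<forall>(V :: 'a set) E. finite V \<and> E \<subseteq> V \<times> V \<and> (\<forall>v. (v, v) \<notin> E) \<and> card V \<ge> n0 \<longrightarrow>
    (\<exists>S M. S \<subseteq> E \<and> arc_triangles (E - S) = {} \<and> M \<subseteq> arc_triangles E \<and> pairwise disjnt M \<and>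
      real (card S) \<le> 1.8 * real (card M) + \<delta> * (real (card V))\<^sup>2)"
    using packing_and_cover[OF assms, where 'a = 'a] by (rule exE)
  show ?thesis
  proof (intro exI[of _ n0] allI impI)
    fix D :: "'a pair_pre_digraph" assume D: "pair_digraph D \<and> card (pverts D) \<ge> n0"
    interpret pair_digraph D using D by (rule conjunct1)
    have fin: "finite (parcs D)" by (rule pair_finite_arcs)
    have sub: "parcs D \<subseteq> pverts D \<times> pverts D"
    proof
      fix e assume "e \<in> parcs D"
      then show "e \<in> pverts D \<times> pverts D"
        using arc_fst_in_verts[of e] arc_snd_in_verts[of e] by (simp add: mem_Times_iff)
    qed
    have loopless: "\<forall>v. (v, v) \<notin> parcs D"
    proof (intro allI notI)
      fix v assume "(v, v) \<in> parcs D"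
      from pair_no_loops[OF this] show False by simp
    qed
    have "finite (pverts D) \<and> parcs D \<subseteq> pverts D \<times> pverts D \<and> (\<forall>v. (v, v) \<notin> parcs D) \<and> card (pverts D) \<ge> n0"
      by (intro conjI pair_finite_verts sub loopless conjunct2[OF D])
    with n0 have "\<exists>S M. S \<subseteq> parcs D \<and> arc_triangles (parcs D - S) = {} \<and> M \<subseteq> arc_triangles (parcs D) \<and>
      pairwise disjnt M \<and> real (card S) \<le> 1.8 * real (card M) + \<delta> * (real (card (pverts D)))\<^sup>2"
      by (elim allE impE)
    then obtain S M where SM: "S \<subseteq> parcs D" "arc_triangles (parcs D - S) = {}"
      "M \<subseteq> arc_triangles (parcs D)" "pairwise disjnt M"
      "real (card S) \<le> 1.8 * real (card M) + \<delta> * (real (card (pverts D)))\<^sup>2"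
      by (elim exE conjE) (rule that)
    have "S \<in> triangle_covers D" using SM(1,2) by (simp add: triangle_covers_def dir_triangles_eq)
    then have "tau_t D \<le> card S" by (rule tau_t_le_card[OF fin])
    moreover have "M \<in> triangle_packings D" using SM(3,4) by (simp add: triangle_packings_def dir_triangles_eq)
    then have "card M \<le> nu_t D" by (rule card_le_nu_t[OF fin])
    ultimately show "real (tau_t D) \<le> 1.8 * real (nu_t D) + \<delta> * (real (card (pverts D)))\<^sup>2"
      using SM(5) by linarith
  qed
qed

text \<open>There may be infinitely many digraphs on \<open>n\<close> vertices, so a uniform bound
  is needed for the supremum in \<open>theorem2\<close> to exist.\<close>

lemma tau_t_le_square:
  assumes "pair_digraph D"
  shows "real (tau_t D) \<le> (real (card (pverts D)))\<^sup>2"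
proof -
  interpret pair_digraph D by (rule assms)
  have "parcs D \<subseteq> pverts D \<times> pverts D"
  proof
    fix e assume "e \<in> parcs D"
    then show "e \<in> pverts D \<times> pverts D"
      using arc_fst_in_verts[of e] arc_snd_in_verts[of e] by (simp add: mem_Times_iff)
  qed
  then have "card (parcs D) \<le> card (pverts D \<times> pverts D)"
    using pair_finite_verts by (intro card_mono) simp_all
  moreover have "tau_t D \<le> card (parcs D)"
    by (rule tau_t_le_card[OF pair_finite_arcs parcs_in_triangle_covers])
  ultimately have "tau_t D \<le> card (pverts D) * card (pverts D)" by (simp add: card_cartesian_product)
  then have "real (tau_t D) \<le> real (card (pverts D) * card (pverts D))" by (rule of_nat_mono)
  then show ?thesis by (simp add: power2_eq_square)
qed

theorem theorem2:
  shows "(\<forall>\<delta>::real. \<delta> > 0 \<longrightarrow>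
           (\<exists>n\<^sub>0::nat. \<forall>D :: 'a pair_pre_digraph.
              pair_digraph D \<and> card (pverts D) \<ge> n\<^sub>0 \<longrightarrow>
              real (tau_t D) \<le> 1.8 * real (nu_t D) + \<delta> * (real (card (pverts D)))\<^sup>2))
       \<and> (\<exists>f :: nat \<Rightarrow> real. f \<in> o(\<lambda>n. (real n)\<^sup>2) \<and>
           (\<forall>D :: 'a pair_pre_digraph. pair_digraph D \<longrightarrow>
              real (tau_t D) \<le> 1.8 * real (nu_t D) + f (card (pverts D))))"
proof (rule conjI)
  show "\<forall>\<delta>::real. \<delta> > 0 \<longrightarrow>
           (\<exists>n\<^sub>0::nat. \<forall>D :: 'a pair_pre_digraph.
              pair_digraph D \<and> card (pverts D) \<ge> n\<^sub>0 \<longrightarrow>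
              real (tau_t D) \<le> 1.8 * real (nu_t D) + \<delta> * (real (card (pverts D)))\<^sup>2)"
    by (intro allI impI tau_le_nu_eventually)
next
  define x where "x = (\<lambda>D :: 'a pair_pre_digraph. real (tau_t D) - 1.8 * real (nu_t D))"
  \<comment> \<open>The least possible error term is a supremum over all digraphs on
    \<open>n\<close> vertices. Inserting 0 makes this supremum nonnegative, hence equal to its norm,
    and keeps the set nonempty when no digraph over \<open>'a\<close> has \<open>n\<close>
    vertices.\<close>
  define excess where "excess = (\<lambda>n. insert 0 (x ` {D. pair_digraph D \<and> card (pverts D) = n}))"
  have "y \<le> (real n)\<^sup>2" if "y \<in> excess n" for y n
    using that unfolding excess_def
  proof (elim insertE imageE CollectE conjE)
    fix D assume D: "y = x D" "pair_digraph D" "card (pverts D) = n"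
    have "x D \<le> real (tau_t D)" by (simp add: x_def)
    also have "\<dots> \<le> (real (card (pverts D)))\<^sup>2" by (rule tau_t_le_square[OF D(2)])
    finally show ?thesis by (simp only: D)
  qed simp
  then have bdd: "bdd_above (excess n)" for n by (rule bdd_aboveI)
  have small: "(\<lambda>n. Sup (excess n)) \<in> o(\<lambda>n. (real n)\<^sup>2)"
  proof (rule landau_o.smallI)
    fix c :: real assume c: "c > 0"
    obtain n0 where n0: "\<forall>D :: 'a pair_pre_digraph. pair_digraph D \<and> card (pverts D) \<ge> n0 \<longrightarrow>
        real (tau_t D) \<le> 1.8 * real (nu_t D) + c * (real (card (pverts D)))\<^sup>2"
      using tau_le_nu_eventually[OF c, where 'a = 'a] by (rule exE)
    show "eventually (\<lambda>n. norm (Sup (excess n)) \<le> c * norm ((real n)\<^sup>2)) sequentially"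
      using eventually_ge_at_top[of n0]
    proof eventually_elim
      case (elim n)
      have "0 \<le> Sup (excess n)" by (rule cSup_upper[OF _ bdd]) (simp add: excess_def)
      moreover have "Sup (excess n) \<le> c * (real n)\<^sup>2"
      proof (rule cSup_least)
        fix y assume "y \<in> excess n"
        then show "y \<le> c * (real n)\<^sup>2"
          unfolding excess_def
        proof (elim insertE imageE CollectE conjE)
          fix D assume D: "y = x D" "pair_digraph D" "card (pverts D) = n"
          then have "real (tau_t D) \<le> 1.8 * real (nu_t D) + c * (real (card (pverts D)))\<^sup>2"
            using elim by (intro n0[rule_format]) simp
          with D show ?thesis by (simp add: x_def)
        qed (use c in simp)
      qed (simp add: excess_def)
      ultimately show ?case by simp
    qed
  qed
  have bound: "real (tau_t D) \<le> 1.8 * real (nu_t D) + Sup (excess (card (pverts D)))"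
    if "pair_digraph D" for D :: "'a pair_pre_digraph"
  proof -
    have "x D \<in> excess (card (pverts D))" using that by (simp add: excess_def)
    then have "x D \<le> Sup (excess (card (pverts D)))" by (rule cSup_upper[OF _ bdd])
    then show ?thesis by (simp add: x_def)
  qed
  show "\<exists>f :: nat \<Rightarrow> real. f \<in> o(\<lambda>n. (real n)\<^sup>2) \<and>
     (\<forall>D :: 'a pair_pre_digraph. pair_digraph D \<longrightarrow>
        real (tau_t D) \<le> 1.8 * real (nu_t D) + f (card (pverts D)))"
    by (intro exI[of _ "\<lambda>n. Sup (excess n)"] conjI allI impI small bound)
qed

end
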